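(* Let $l\in\mathbb{N}$ ($l\ge1$), $1<p\leq q\leq\infty$, let $u,v$ be non-negative functions on $\mathbb{R}^+$, and let $$\int_0^r u^{-p'}(x)\,dx<\infty\quad\text{for all } r>0.$$ If $l\geq 2$, assume also that there exists a constant $D(u)$ such that $$\int_0^{2r}x^{(l-2)p'}u^{-p'}(x)\,dx\leq D(u)\int_0^r x^{(l-2)p'}u^{-p'}(x)\,dx\quad\text{for all } r>0.$$ Let $b_0,\dots,b_l$ be functions on $\mathbb{R}^+$, let $P(x,D)=\sum_{m=0}^l b_m(x)D^m$ be the differential operator acting by $P(x,D)f(x)=\sum_{m=0}^l b_m(x)f^{(m)}(x)$, and let $$d_k(x)=\sum_{m=0}^{l-1-k}b_m(x)\frac{x^{l-1-k-m}}{(l-1-k-m)!},\qquad k=0,\dots,l-1.$$ Consider the conditions (A) $\displaystyle\sup_{r>0}\bigg(\int_r^\infty|d_k(x)v(x)|^q\,dx\bigg)^{1/q}\bigg(\int_0^r x^{kp'}u^{-p'}(x)\,dx\bigg)^{1/p'}<\infty$ for $k=0,\dots,l-1$; (B) $b_l(x)\equiv 0$ if $p<q$; $\|b_l v u^{-1}|L_\infty(\mathbb{R}^+)\|<\infty$ if $p=q$; (C) $\|P(x,D)x^k|L_{q,v}\|<\infty$ for $k=0,\dots,l-1$. Then: (i) In order that $P(x,D)$ act boundedly from $\overset{\circ}{W}{}^{l}_{p,u}$ to $L_{q,v}$, it is necessary and sufficient that (A) and (B) be fulfilled. (ii) In order that $P(x,D)$ act boundedly from $W^l_{p,u}$ to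 $L_{q,v}$, it is necessary and sufficient that (A), (B) and (C) be fulfilled.
   Context: $\mathbb{R}^+=(0,\infty)$. All functions are assumed to be measurable and finite almost everywhere. $p'=p/(p-1)$ is the conjugate exponent ($p'=1$ if $p=\infty$), and $u^{-p'}(x)$ means $(u(x))^{-p'}$. For a non-negative function (weight) $u$ on $\mathbb{R}^+$, $L_{p,u}$ is the weighted space of functions $f:\mathbb{R}^+\to\mathbb{C}$ with norm $\|f|L_{p,u}\|=\big(\int_0^\infty|u(x)f(x)|^p\,dx\big)^{1/p}$ for $1\le p<\infty$, and $\|f|L_{\infty,u}\|=\operatorname{ess\,sup}_{x>0}|u(x)f(x)|$. Whenever an exponent equals $\infty$, the corresponding integral expression is understood as an essential supremum in the same way. Weighted Sobolev spaces: $$W^l_{p,u}=\Big\{f:\mathbb{R}^+\to\mathbb{C}\;:\;\|f|W^l_{p,u}\|=\sum_{k=0}^{l-1}|f^{(k)}(0)|+\|f^{(l)}|L_{p,u}\|<\infty\Big\},$$ $$\overset{\circ}{W}{}^{l}_{p,u}=\Big\{f:\mathbb{R}^+\to\mathbb{C}\;:\;f^{(k)}(0)=0,\ k=0,\dots,l-1,\ \|f|\overset{\circ}{W}{}^{l}_{p,u}\|=\|f^{(l)}|L_{p,u}\|<\infty\Big\}.$$ The use of the notation $f^{(l)}$ assumes that $f$ has an absolutely continuous derivative $f^{(l-1)}$, so that $f^{(l)}=(f^{(l-1)})'$ exists almost everywhere. Under the assumption $\int_0^r u^{-p'}(x)\,dx<\infty$ for all $r>0$, finiteness of $\|f^{(l)}|L_{p,u}\|$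 implies the existence of $f^{(k)}(0)$, $k=0,\dots,l-1$, understood as the limits $f^{(k)}(0+0)$.
   Formalization: In (B) for p<q, "b_l ≡ 0" is replaced by "b_l(x)=0 for almost every x with v(x)≠0", since with v vanishing on a set of positive measure (e.g. v=0, b_l=1) the literal condition is not necessary; for v>0 a.e. it means b_l=0 a.e. *)

theory Defs
  imports "HOL-Analysis.Analysis" "HOL-Probability.Essential_Supremum"
begin

text \<open>
  Functions on the half-line are represented by total functions on \<^typ>\<open>real\<close>; every notion below
  only looks at their values on \<open>{0<..}\<close>. Weights are real-valued, so they are finite everywhere;
  changing them on a null set affects nothing. Exponents in the range from 1 to infinity
  are elements of \<^typ>\<open>ennreal\<close>.
\<close>

definition conj_exp :: "ennreal \<Rightarrow> real" where
  "conj_exp p = (if p = \<infinity> then 1 else enn2real p / (enn2real p - 1))"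

text \<open>The power \<open>t\<^sup>s\<close> of an extended nonnegative number, for real \<open>s > 0\<close>.\<close>

definition epow :: "ennreal \<Rightarrow> real \<Rightarrow> ennreal" where
  "epow t s = (if t = \<infinity> then \<infinity> else ennreal (enn2real t powr s))"

text \<open>The function \<open>u\<^bsup>-p'\<^esup>\<close>; it is infinite where \<open>u\<close> vanishes.\<close>

definition neg_conj_pow :: "(real \<Rightarrow> real) \<Rightarrow> ennreal \<Rightarrow> real \<Rightarrow> ennreal" where
  "neg_conj_pow u p x = inverse (ennreal (u x powr conj_exp p))"

subsection \<open>Weighted Lebesgue spaces\<close>

definition Lnorm_on :: "real set \<Rightarrow> ennreal \<Rightarrow> (real \<Rightarrow> real) \<Rightarrow> (real \<Rightarrow> complex) \<Rightarrow> ennreal" where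
  "Lnorm_on S p w f =
     (if p = \<infinity> then esssup (lebesgue_on S) (\<lambda>x. ennreal (cmod (of_real (w x) * f x)))
      else epow (\<integral>\<^sup>+x. ennreal (cmod (of_real (w x) * f x) powr enn2real p) \<partial>lebesgue_on S)
                (1 / enn2real p))"

abbreviation Lnorm :: "ennreal \<Rightarrow> (real \<Rightarrow> real) \<Rightarrow> (real \<Rightarrow> complex) \<Rightarrow> ennreal" where
  "Lnorm \<equiv> Lnorm_on {0<..}"

definition Lspace :: "ennreal \<Rightarrow> (real \<Rightarrow> real) \<Rightarrow> (real \<Rightarrow> complex) set" where
  "Lspace p w = {f \<in> borel_measurable (lebesgue_on {0<..}). Lnorm p w f < \<infinity>}"

subsection \<open>Weighted Sobolev spaces\<close>

text \<open>At points of non-differentiability \<^const>\<open>vector_derivative\<close> returns a junk value; for the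
  functions considered here this concerns only the top derivative, on a null set.\<close>

definition nth_deriv :: "nat \<Rightarrow> (real \<Rightarrow> complex) \<Rightarrow> real \<Rightarrow> complex" where
  "nth_deriv k f = ((\<lambda>g x. vector_derivative g (at x)) ^^ k) f"

definition abs_cont_on :: "real set \<Rightarrow> (real \<Rightarrow> complex) \<Rightarrow> bool" where
  "abs_cont_on S f \<longleftrightarrow>
     (\<forall>\<epsilon>>0. \<exists>\<delta>>0. \<forall>I :: (real \<times> real) set.
        finite I \<longrightarrow> (\<forall>(a, b)\<in>I. a < b \<and> {a..b} \<subseteq> S) \<longrightarrow>
        disjoint_family_on (\<lambda>(a, b). {a<..<b}) I \<longrightarrow>
        (\<Sum>(a, b)\<in>I. b - a) < \<delta> \<longrightarrow> (\<Sum>(a, b)\<in>I. cmod (f b - f a)) < \<epsilon>)"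

text \<open>The derivative of order \<open>l - 1\<close> of \<open>f\<close> exists and is locally absolutely continuous on the open
  half-line (used for \<open>l \<ge> 1\<close> only).\<close>

definition has_ac_deriv :: "nat \<Rightarrow> (real \<Rightarrow> complex) \<Rightarrow> bool" where
  "has_ac_deriv l f \<longleftrightarrow>
     (\<forall>k<l - 1. \<forall>x>0. nth_deriv k f differentiable (at x)) \<and>
     (\<forall>a b. 0 < a \<longrightarrow> a < b \<longrightarrow> abs_cont_on {a..b} (nth_deriv (l - 1) f))"

text \<open>The value \<open>f\<^bsup>(k)\<^esup>(0)\<close>, understood as the limit \<open>f\<^bsup>(k)\<^esup>(0+0)\<close>.\<close>

definition deriv_at_0 :: "nat \<Rightarrow> (real \<Rightarrow> complex) \<Rightarrow> complex" where
  "deriv_at_0 k f = Lim (at_right 0) (nth_deriv k f)"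

definition sobolev_norm :: "nat \<Rightarrow> ennreal \<Rightarrow> (real \<Rightarrow> real) \<Rightarrow> (real \<Rightarrow> complex) \<Rightarrow> ennreal" where
  "sobolev_norm l p u f =
     (\<Sum>k<l. ennreal (cmod (deriv_at_0 k f))) + Lnorm p u (nth_deriv l f)"

text \<open>The existence of the limits at 0 is part of the definition, so that the norm is meaningful
  for every weight; it is automatic when \<open>u\<^bsup>-p'\<^esup>\<close> is integrable near 0.\<close>

definition sobolev :: "nat \<Rightarrow> ennreal \<Rightarrow> (real \<Rightarrow> real) \<Rightarrow> (real \<Rightarrow> complex) set" where
  "sobolev l p u =
     {f. has_ac_deriv l f \<and> (\<forall>k<l. \<exists>c. (nth_deriv k f \<longlongrightarrow> c) (at_right 0)) \<and>
         sobolev_norm l p u f < \<infinity>}"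

definition sobolev0_norm :: "nat \<Rightarrow> ennreal \<Rightarrow> (real \<Rightarrow> real) \<Rightarrow> (real \<Rightarrow> complex) \<Rightarrow> ennreal" where
  "sobolev0_norm l p u f = Lnorm p u (nth_deriv l f)"

definition sobolev0 :: "nat \<Rightarrow> ennreal \<Rightarrow> (real \<Rightarrow> real) \<Rightarrow> (real \<Rightarrow> complex) set" where
  "sobolev0 l p u =
     {f. has_ac_deriv l f \<and> (\<forall>k<l. (nth_deriv k f \<longlongrightarrow> 0) (at_right 0)) \<and>
         sobolev0_norm l p u f < \<infinity>}"

subsection \<open>The differential operator\<close>

definition diff_op ::
  "nat \<Rightarrow> (nat \<Rightarrow> real \<Rightarrow> complex) \<Rightarrow> (real \<Rightarrow> complex) \<Rightarrow> real \<Rightarrow> complex" where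
  "diff_op l b f x = (\<Sum>m\<le>l. b m x * nth_deriv m f x)"

definition d_coeff :: "nat \<Rightarrow> (nat \<Rightarrow> real \<Rightarrow> complex) \<Rightarrow> nat \<Rightarrow> real \<Rightarrow> complex" where
  "d_coeff l b k x =
     (\<Sum>m\<le>l - 1 - k. b m x * of_real (x ^ (l - 1 - k - m) / fact (l - 1 - k - m)))"

definition acts_boundedly ::
  "('a \<Rightarrow> 'b) \<Rightarrow> 'a set \<Rightarrow> ('a \<Rightarrow> ennreal) \<Rightarrow> 'b set \<Rightarrow> ('b \<Rightarrow> ennreal) \<Rightarrow> bool" where
  "acts_boundedly T X normX Y normY \<longleftrightarrow>
     (\<forall>f\<in>X. T f \<in> Y) \<and> (\<exists>C::real. \<forall>f\<in>X. normY (T f) \<le> ennreal C * normX f)"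

subsection \<open>The conditions\<close>

definition cond_A ::
  "nat \<Rightarrow> ennreal \<Rightarrow> ennreal \<Rightarrow> (real \<Rightarrow> real) \<Rightarrow> (real \<Rightarrow> real) \<Rightarrow> (nat \<Rightarrow> real \<Rightarrow> complex) \<Rightarrow> bool" where
  "cond_A l p q u v b \<longleftrightarrow>
     (\<forall>k<l. (SUP r\<in>{0<..}.
        Lnorm_on {r<..} q v (d_coeff l b k) *
        epow (\<integral>\<^sup>+x. ennreal (x powr (real k * conj_exp p)) * neg_conj_pow u p x
                \<partial>lebesgue_on {0<..<r})
             (1 / conj_exp p)) < \<infinity>)"

text \<open>For \<open>p < q\<close> the requirement that \<open>b\<^sub>l\<close> vanish identically is read modulo the null sets of the
  weight \<open>v\<close>, i.e. as equality in the target space \<open>L\<^bsub>q,v\<^esub>\<close>: nothing can be said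
  about \<open>b\<^sub>l\<close> where \<open>v = 0\<close>. If \<open>v > 0\<close> almost everywhere, this is \<open>b\<^sub>l = 0\<close> almost everywhere.
  For \<open>p = q\<close>, the quotient by \<open>u\<close> is harmless when \<open>u\<^bsup>-p'\<^esup>\<close> is locally integrable, because then
  \<open>u > 0\<close> almost everywhere.\<close>

definition cond_B ::
  "nat \<Rightarrow> ennreal \<Rightarrow> ennreal \<Rightarrow> (real \<Rightarrow> real) \<Rightarrow> (real \<Rightarrow> real) \<Rightarrow> (nat \<Rightarrow> real \<Rightarrow> complex) \<Rightarrow> bool" where
  "cond_B l p q u v b \<longleftrightarrow>
     (p < q \<longrightarrow> (AE x in lebesgue_on {0<..}. v x \<noteq> 0 \<longrightarrow> b l x = 0)) \<and>
     (p = q \<longrightarrow> Lnorm \<infinity> (\<lambda>x. v x / u x) (b l) < \<infinity>)"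

definition cond_C ::
  "nat \<Rightarrow> ennreal \<Rightarrow> (real \<Rightarrow> real) \<Rightarrow> (nat \<Rightarrow> real \<Rightarrow> complex) \<Rightarrow> bool" where
  "cond_C l q v b \<longleftrightarrow> (\<forall>k<l. Lnorm q v (diff_op l b (\<lambda>x. of_real x ^ k)) < \<infinity>)"

end

theory Submission
  imports Defs "HOL-Computational_Algebra.Fundamental_Theorem_Algebra"
begin

text \<open>
  Write \<open>p'\<close> for the conjugate exponent. The theorem rests on an explicit formula for the operator in
  terms of \<open>g = f\<^sup>(\<^sup>l\<^sup>)\<close>. Taylor's formula at \<open>0\<close> with integral remainder expresses each \<open>f\<^sup>(\<^sup>m\<^sup>)\<close>,
  \<open>m < l\<close>, by the values \<open>a\<^sub>k = f\<^sup>(\<^sup>k\<^sup>)(0)\<close> and by \<open>\<integral>\<^sub>0\<^sup>x (x - t)\<^sup>n / n! g(t) dt\<close> with \<open>n = l - 1 - m\<close>. Expanding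
  the kernel by the binomial theorem and collecting powers of \<open>t\<close> gives
    \<open>P(x,D) f(x) = (\<Sum>k<l. a\<^sub>k / k! \<cdot> P(x,D) x\<^sup>k) + (\<Sum>j<l. (-1)\<^sup>j / j! \<cdot> d\<^sub>j(x) \<integral>\<^sub>0\<^sup>x t\<^sup>j g(t) dt) + b\<^sub>l(x) g(x)\<close>
  (theorem \<open>diff_op_representation\<close>). If the initial values vanish, only the last two terms
  remain, and every \<open>g\<close> in the weighted Lebesgue space arises from such an \<open>f\<close> (lemma
  \<open>volterra_sobolev0\<close>). So one has to characterize the boundedness of the operator \<open>reduced_op\<close> formed by
  the last two terms; on the larger space the first sum only adds the requirement that the finitely
  many functions \<open>P(x,D) x\<^sup>k\<close> lie in the target space.

  Sufficiency. Each term \<open>d\<^sub>j(x) \<integral>\<^sub>0\<^sup>x t\<^sup>j g(t) dt\<close> is a weighted Hardy operator, and condition (A) for \<open>j\<close> is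
  exactly Muckenhoupt's condition for it. The inequality (\<open>dyadic_Hardy\<close>, \<open>weighted_Hardy\<close>) follows by
  cutting the half-line where the increasing majorant \<open>H(x) = \<integral>\<^sub>0\<^sup>x t\<^sup>j |g(t)| dt\<close> passes through powers
  of two: on the piece \<open>2\<^sup>k < H \<le> 2\<^sup>k\<^sup>+\<^sup>1\<close> the integrand is controlled by the tail of \<open>d\<^sub>j v\<close>, while \<open>2\<^sup>k\<close> is
  controlled through Hoelder's inequality by the norm of \<open>g\<close> on the preceding piece; these preceding
  pieces are disjoint and \<open>p \<le> q\<close> allows the sum to be taken.

  Necessity of (A). The terms have to be separated from each other. For \<open>g\<close> supported in \<open>(0,r)\<close> all
  moments are constant beyond \<open>r\<close>, and if all of them vanish except that of order \<open>k\<close>, then the output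
  on \<open>(r,\<infinity>)\<close> is a multiple of \<open>d\<^sub>k\<close>. So boundedness dominates the \<open>k\<close>-th moment by the norm of \<open>g\<close> on
  the common kernel of the other moments. A Hahn-Banach argument with finitely many functionals
  (\<open>dominated_extension_finite\<close>) extends this to all \<open>g\<close>, at the price of replacing \<open>t\<^sup>k\<close> by a polynomial
  \<open>Q\<close> of degree below \<open>l\<close> with coefficient \<open>1\<close> at \<open>t\<^sup>k\<close>; the converse of Hoelder's inequality bounds the
  \<open>L\<^sub>p\<^sub>'\<close> norm of \<open>Q u\<^sup>-\<^sup>1\<close> on \<open>(0,r)\<close>. The doubling condition is what permits a return from \<open>Q\<close> to \<open>t\<^sup>k\<close>:
  by \<open>coefficient_bound\<close>, each monomial of a polynomial is dominated, in that weighted norm, by the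
  polynomial itself. The reason is that \<open>|Q(t)|\<close> is comparable, up to the leading coefficient, with the product
  of the \<open>t + |z|\<close> over the roots \<open>z\<close> unless \<open>t\<close> is close to some \<open>|z|\<close>, and by doubling the integral of this
  product over these exceptional annuli is at most a fixed multiple of the integral to their left.

  Condition (B). Once (A) is known, subtracting the Hardy terms leaves multiplication by \<open>b\<^sub>l\<close> as a
  bounded operator. Testing on \<open>1\<^sub>S / u\<close> for small sets \<open>S\<close> compares \<open>|S|\<close> to the powers \<open>1/q\<close> and \<open>1/p\<close>:
  for \<open>p < q\<close> this forces \<open>v b\<^sub>l = 0\<close>, for \<open>p = q\<close> it bounds \<open>v b\<^sub>l / u\<close>.

  All of this uses that an absolutely continuous function is differentiable almost everywhere and is
  the integral of its derivative, and Lebesgue's differentiation theorem for indefinite integrals; both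
  are derived from the Vitali covering theorem.
\<close>

section \<open>Monotone functions are differentiable almost everywhere\<close>

lemma Vitali_covering_intervals:
  fixes S :: "real set" and K :: "(real \<times> real) set"
  assumes K: "\<And>s t. (s, t) \<in> K \<Longrightarrow> s < t"
    and S: "\<And>x d. x \<in> S \<Longrightarrow> 0 < d \<Longrightarrow> \<exists>(s, t)\<in>K. s \<le> x \<and> x \<le> t \<and> t - s < d"
  obtains C where "countable C" "C \<subseteq> K"
    "pairwise (\<lambda>(s, t) (s', t'). disjnt {s..t} {s'..t'}) C"
    "negligible (S - (\<Union>(s, t)\<in>C. {s..t}))"
proof -
  have eq: "cball ((fst i + snd i) / 2) ((snd i - fst i) / 2) = {fst i..snd i}" for i :: "real \<times> real"
    by (auto simp: cball_eq_atLeastAtMost field_simps)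
  obtain C where C: "countable C" "C \<subseteq> K"
     "pairwise (\<lambda>i j. disjnt (cball ((fst i + snd i) / 2) ((snd i - fst i) / 2))
                              (cball ((fst j + snd j) / 2) ((snd j - fst j) / 2))) C"
     "negligible(S - (\<Union>i \<in> C. cball ((fst i + snd i) / 2) ((snd i - fst i) / 2)))"
  proof (rule Vitali_covering_theorem_cballs)
    show "0 < (snd i - fst i) / 2" if "i \<in> K" for i
      using that K[of "fst i" "snd i"] by simp
  next
    fix x d :: real assume "x \<in> S" "0 < d"
    then obtain s t where "(s, t) \<in> K" "s \<le> x" "x \<le> t" "t - s < d"
      using S by blast
    then show "\<exists>i. i \<in> K \<and> x \<in> cball ((fst i + snd i) / 2) ((snd i - fst i) / 2) \<and> (snd i - fst i) / 2 < d"
      using \<open>0 < d\<close> unfolding eq by (intro exI[of _ "(s, t)"]) auto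
  qed
  then show thesis
    using that[of C] unfolding eq by (simp add: case_prod_unfold)
qed

text \<open>
  Peel off the interval with the largest right endpoint: disjointness puts all others to its left.
\<close>

lemma mono_on_sum_increments_le:
  fixes F :: "real \<Rightarrow> real"
  assumes "finite C" and "mono_on {c..d} F" and "c \<le> d"
    and "\<And>s t. (s, t) \<in> C \<Longrightarrow> c \<le> s \<and> s \<le> t \<and> t \<le> d"
    and "pairwise (\<lambda>(s, t) (s', t'). disjnt {s..t} {s'..t'}) C"
  shows "(\<Sum>(s, t)\<in>C. F t - F s) \<le> F d - F c"
  using assms
proof (induction "card C" arbitrary: C d)
  case 0
  then show ?case by (auto simp: mono_on_def)
next
  case (Suc n)
  have "Max (snd ` C) \<in> snd ` C"
    using Suc.prems(1) Suc.hyps(2) by (intro Max_in) auto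
  then obtain s t where st: "(s, t) \<in> C" "t = Max (snd ` C)" by auto
  have max: "t' \<le> t" if "(s', t') \<in> C" for s' t'
    using that Suc.prems(1) unfolding st by (intro Max_ge) force+
  have ord: "c \<le> s" "s \<le> t" "t \<le> d" using Suc.prems(4)[OF st(1)] by auto
  have "(\<Sum>(s, t)\<in>C - {(s, t)}. F t - F s) \<le> F s - F c"
  proof (rule Suc.hyps(1))
    show "n = card (C - {(s, t)})" using Suc.hyps(2) Suc.prems(1) st(1) by simp
    show "finite (C - {(s, t)})" using Suc.prems(1) by simp
    show "mono_on {c..s} F" using Suc.prems(2) ord by (auto simp: mono_on_def)
    show "c \<le> s" by fact
    show "pairwise (\<lambda>(s, t) (s', t'). disjnt {s..t} {s'..t'}) (C - {(s, t)})"
      by (rule pairwise_subset[OF Suc.prems(5)]) auto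
    fix s' t' assume a: "(s', t') \<in> C - {(s, t)}"
    have "disjnt {s..t} {s'..t'}"
      using pairwiseD[OF Suc.prems(5) st(1), of "(s', t')"] a by auto
    moreover have "s' \<le> t'" "t' \<le> t" "c \<le> s'" using Suc.prems(4)[of s' t'] max[of s' t'] a by auto
    moreover have "t' \<in> {s..t} \<inter> {s'..t'}" if "s \<le> t'"
      using that \<open>s' \<le> t'\<close> \<open>t' \<le> t\<close> by auto
    ultimately have "t' < s" by (force simp: disjnt_def)
    then show "c \<le> s' \<and> s' \<le> t' \<and> t' \<le> s"
      using Suc.prems(4)[of s' t'] a by auto
  qed
  moreover have "(\<Sum>(s, t)\<in>C. F t - F s) = (F t - F s) + (\<Sum>(s, t)\<in>C - {(s, t)}. F t - F s)"
    using Suc.prems(1) st(1) by (subst sum.remove[of _ "(s, t)"]) auto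
  moreover have "F t \<le> F d" using Suc.prems(2) ord by (auto simp: mono_on_def)
  ultimately show ?case by simp
qed

lemma measure_disjoint_intervals:
  fixes C :: "(real \<times> real) set"
  assumes "finite C" "\<And>s t. (s, t) \<in> C \<Longrightarrow> s \<le> t"
    and "pairwise (\<lambda>(s, t) (s', t'). disjnt {s..t} {s'..t'}) C"
  shows "measure lebesgue (\<Union>(s, t)\<in>C. {s..t}) = (\<Sum>(s, t)\<in>C. t - s)"
proof -
  have fin: "emeasure lebesgue {x..y} \<noteq> \<infinity>" for x y :: real
    by (metis cbox_interval fmeasurableD2 lmeasurable_cbox infinity_ennreal_def)
  have "measure lebesgue (\<Union>i\<in>C. {fst i..snd i}) = (\<Sum>i\<in>C. measure lebesgue {fst i..snd i})"
    using assms(1,3) fin by (intro measure_finite_Union)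
      (auto simp: disjoint_family_on_def pairwise_def disjnt_def case_prod_unfold)
  also have "\<dots> = (\<Sum>i\<in>C. snd i - fst i)"
    using assms(2) by (intro sum.cong) auto
  finally show ?thesis by (simp add: case_prod_unfold)
qed

definition diff_quot :: "(real \<Rightarrow> real) \<Rightarrow> real \<Rightarrow> real \<Rightarrow> real" where
  "diff_quot F x y = (F y - F x) / (y - x)"

lemma frequently_diff_quot_interval:
  assumes freq: "\<exists>\<^sub>F y in at x. P (diff_quot F x y)" and U: "open U" "x \<in> U" and d: "0 < d"
  shows "\<exists>s t. s < t \<and> s \<le> x \<and> x \<le> t \<and> t - s < d \<and> {s..t} \<subseteq> U \<and> P ((F t - F s) / (t - s))"
proof -
  obtain e where e: "e > 0" "ball x e \<subseteq> U" using U openE by blast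
  have "\<forall>\<^sub>F y in at x. y \<in> ball x (min d e)"
    using d e by (intro eventually_at_in_open') auto
  from frequently_eventually_frequently[OF freq this]
  have "\<exists>\<^sub>F y in at x. P (diff_quot F x y) \<and> y \<in> ball x (min d e) \<and> y \<noteq> x"
    by (rule frequently_eventually_frequently[OF _ eventually_neq_at_within, THEN frequently_elim1]) auto
  then obtain y where y: "P (diff_quot F x y)" "y \<in> ball x (min d e)" "y \<noteq> x"
    using frequently_ex by blast
  have eq: "diff_quot F x y = (F (max x y) - F (min x y)) / (max x y - min x y)"
    using y(3) by (auto simp: diff_quot_def max_def min_def divide_simps) (auto simp: algebra_simps)
  have "{min x y..max x y} \<subseteq> ball x e"
    using y(2) by (auto simp: dist_real_def min_def max_def split: if_splits)
  then show ?thesis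
    using y e eq by (intro exI[of _ "min x y"] exI[of _ "max x y"])
      (auto simp: dist_real_def min_def max_def split: if_splits)
qed

text \<open>
  Near every point of \<open>S\<close> there are arbitrarily short intervals on which \<open>F\<close> grows at a rate above \<open>\<beta>\<close>.
  Vitali's theorem selects disjoint ones that cover almost all of \<open>S\<close>, and \<open>\<beta>\<close> times their total length
  is at most the total increment of \<open>F\<close>. As \<open>S\<close> need not be measurable, its outer measure is expressed by
  a superset \<open>T\<close>.
\<close>

lemma outer_measure_steep_le:
  fixes F :: "real \<Rightarrow> real"
  assumes F: "mono_on {a..b} F" and "a \<le> b" and "0 < \<beta>" and S: "S \<subseteq> {a<..<b}"
    and steep: "\<And>x. x \<in> S \<Longrightarrow> \<exists>\<^sub>F y in at x. \<beta> < diff_quot F x y"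
  obtains T where "S \<subseteq> T" "T \<in> lmeasurable" "\<beta> * measure lebesgue T \<le> F b - F a"
proof -
  define K where "K = {(s, t). s < t \<and> {s..t} \<subseteq> {a<..<b} \<and> \<beta> < (F t - F s) / (t - s)}"
  obtain C where C: "countable C" "C \<subseteq> K"
    and dis: "pairwise (\<lambda>(s, t) (s', t'). disjnt {s..t} {s'..t'}) C"
    and neg: "negligible (S - (\<Union>(s, t)\<in>C. {s..t}))"
  proof (rule Vitali_covering_intervals[of K S])
    show "s < t" if "(s, t) \<in> K" for s t using that by (simp add: K_def)
  next
    fix x d :: real assume x: "x \<in> S" "0 < d"
    have "x \<in> {a<..<b}" using x S by blast
    from frequently_diff_quot_interval[OF steep[OF x(1)] open_greaterThanLessThan this x(2)]
    obtain s t where "s < t" "s \<le> x" "x \<le> t" "t - s < d" "{s..t} \<subseteq> {a<..<b}" "\<beta> < (F t - F s) / (t - s)"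
      by blast
    then show "\<exists>(s, t)\<in>K. s \<le> x \<and> x \<le> t \<and> t - s < d"
      by (intro bexI[of _ "(s, t)"]) (auto simp: K_def)
  qed
  define T0 where "T0 = (\<Union>i\<in>C. {fst i..snd i})"
  have bd: "measure lebesgue (\<Union>i\<in>J. {fst i..snd i}) \<le> (F b - F a) / \<beta>" if J: "J \<subseteq> C" "finite J" for J
  proof -
    have J': "s < t \<and> a \<le> s \<and> t \<le> b \<and> \<beta> * (t - s) \<le> F t - F s" if "(s, t) \<in> J" for s t
    proof -
      have "(s, t) \<in> K" using that J C(2) by auto
      then have k: "s < t" "{s..t} \<subseteq> {a<..<b}" "\<beta> < (F t - F s) / (t - s)" by (auto simp: K_def)
      then have "s \<in> {s..t}" "t \<in> {s..t}" by auto
      then have "s \<in> {a<..<b}" "t \<in> {a<..<b}" using k(2) by blast+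
      with k show ?thesis by (auto simp: field_simps)
    qed
    have dJ: "pairwise (\<lambda>(s, t) (s', t'). disjnt {s..t} {s'..t'}) J"
      using dis J(1) pairwise_subset by blast
    have "measure lebesgue (\<Union>i\<in>J. {fst i..snd i}) = (\<Sum>(s, t)\<in>J. t - s)"
      using measure_disjoint_intervals[OF J(2) _ dJ] J' by (force simp: case_prod_unfold)
    also have "\<beta> * \<dots> \<le> (\<Sum>(s, t)\<in>J. F t - F s)"
      using J' by (subst sum_distrib_left, intro sum_mono) auto
    also have "\<dots> \<le> F b - F a"
      using J' F \<open>a \<le> b\<close> by (intro mono_on_sum_increments_le[OF J(2) _ _ _ dJ]) (auto intro: less_imp_le)
    finally show ?thesis using \<open>0 < \<beta>\<close> by (simp add: field_simps)
  qed
  have T0: "T0 \<in> lmeasurable" "measure lebesgue T0 \<le> (F b - F a) / \<beta>"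
    unfolding T0_def using fmeasurable_UN_bound[OF C(1) _ bd] measure_UN_bound[OF C(1) _ bd] by auto
  show thesis
  proof (rule that[of "T0 \<union> (S - T0)"])
    have n: "negligible (S - T0)" using neg unfolding T0_def by (simp add: case_prod_unfold)
    show "T0 \<union> (S - T0) \<in> lmeasurable"
      by (rule fmeasurable.Un[OF T0(1) negligible_imp_measurable[OF n]])
    have "measure lebesgue (T0 \<union> (S - T0)) = measure lebesgue T0"
      by (rule measure_Un_null_set[OF fmeasurableD[OF T0(1)] n[unfolded negligible_iff_null_sets]])
    then show "\<beta> * measure lebesgue (T0 \<union> (S - T0)) \<le> F b - F a"
      using T0(2) \<open>0 < \<beta>\<close> by (simp add: field_simps)
  qed auto
qed

text \<open>
  Let \<open>S\<close> be the set in question and \<open>\<mu>\<close> its outer measure. Cover \<open>S\<close> by an open \<open>U\<close> of measure close to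
  \<open>\<mu>\<close>, and almost all of \<open>S\<close> by disjoint intervals inside \<open>U\<close> on which \<open>F\<close> grows at a rate below \<open>\<alpha>\<close>;
  the total increment of \<open>F\<close> there is at most \<open>\<alpha> |U|\<close>. Within each of these intervals the points of \<open>S\<close>
  are also steep, so their outer measure is at most the increment divided by \<open>\<beta>\<close>. Altogether
  \<open>\<mu> \<le> \<alpha> / \<beta> \<cdot> \<mu>\<close>, hence \<open>\<mu> = 0\<close>.
\<close>

lemma negligible_slow_and_steep:
  fixes F :: "real \<Rightarrow> real"
  assumes F: "mono_on {a..b} F" and "0 < \<alpha>" "\<alpha> < \<beta>"
  shows "negligible {x \<in> {a<..<b}. (\<exists>\<^sub>F y in at x. diff_quot F x y < \<alpha>) \<and> (\<exists>\<^sub>F y in at x. \<beta> < diff_quot F x y)}"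
proof -
  define S where "S = {x \<in> {a<..<b}. (\<exists>\<^sub>F y in at x. diff_quot F x y < \<alpha>) \<and> (\<exists>\<^sub>F y in at x. \<beta> < diff_quot F x y)}"
  have S_ab: "S \<subseteq> {a<..<b}" by (auto simp: S_def)
  have shrink: "\<exists>T. S \<subseteq> T \<and> T \<in> lmeasurable \<and> measure lebesgue T \<le> \<alpha> / \<beta> * measure lebesgue U"
    if U: "open U" "S \<subseteq> U" "U \<subseteq> {a<..<b}" "U \<in> lmeasurable" for U
  proof -
    define K where "K = {(s, t). s < t \<and> {s..t} \<subseteq> U \<and> (F t - F s) / (t - s) < \<alpha>}"
    obtain C where C: "countable C" "C \<subseteq> K"
      and dis: "pairwise (\<lambda>(s, t) (s', t'). disjnt {s..t} {s'..t'}) C"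
      and neg: "negligible (S - (\<Union>(s, t)\<in>C. {s..t}))"
    proof (rule Vitali_covering_intervals[of K S])
      show "s < t" if "(s, t) \<in> K" for s t using that by (simp add: K_def)
    next
      fix x d :: real assume x: "x \<in> S" "0 < d"
      then have "\<exists>\<^sub>F y in at x. diff_quot F x y < \<alpha>" "x \<in> U" using U(2) by (auto simp: S_def)
      from frequently_diff_quot_interval[OF this(1) U(1) this(2) x(2)]
      obtain s t where "s < t" "s \<le> x" "x \<le> t" "t - s < d" "{s..t} \<subseteq> U" "(F t - F s) / (t - s) < \<alpha>"
        by blast
      then show "\<exists>(s, t)\<in>K. s \<le> x \<and> x \<le> t \<and> t - s < d"
        by (intro bexI[of _ "(s, t)"]) (auto simp: K_def)
    qed
    have CK: "fst i < snd i" "{fst i..snd i} \<subseteq> U" "F (snd i) - F (fst i) \<le> \<alpha> * (snd i - fst i)"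
      if "i \<in> C" for i
    proof -
      have "(fst i, snd i) \<in> K" using C(2) that by auto
      then show "fst i < snd i" "{fst i..snd i} \<subseteq> U" "F (snd i) - F (fst i) \<le> \<alpha> * (snd i - fst i)"
        unfolding K_def by (auto simp: field_simps)
    qed
    have ex: "\<exists>T. S \<inter> {fst i<..<snd i} \<subseteq> T \<and> T \<in> lmeasurable \<and> \<beta> * measure lebesgue T \<le> F (snd i) - F (fst i)"
      if i: "i \<in> C" for i
    proof -
      have "{fst i..snd i} \<subseteq> {a..b}" using CK(2)[OF i] U(3) by force
      then have "mono_on {fst i..snd i} F"
        using F by (meson mono_on_subset)
      then show ?thesis
      proof (rule outer_measure_steep_le[of _ _ F \<beta> "S \<inter> {fst i<..<snd i}"])
        show "fst i \<le> snd i" "0 < \<beta>" using CK(1)[OF i] \<open>0 < \<alpha>\<close> \<open>\<alpha> < \<beta>\<close> by auto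
        show "\<exists>\<^sub>F y in at x. \<beta> < diff_quot F x y" if "x \<in> S \<inter> {fst i<..<snd i}" for x
          using that by (simp add: S_def)
      qed (use S_ab in blast)+
    qed
    obtain T where T': "\<forall>i\<in>C. S \<inter> {fst i<..<snd i} \<subseteq> T i \<and> T i \<in> lmeasurable
        \<and> \<beta> * measure lebesgue (T i) \<le> F (snd i) - F (fst i)"
      using ex by metis
    then have T: "\<And>i. i \<in> C \<Longrightarrow> S \<inter> {fst i<..<snd i} \<subseteq> T i" "\<And>i. i \<in> C \<Longrightarrow> T i \<in> lmeasurable"
       "\<And>i. i \<in> C \<Longrightarrow> \<beta> * measure lebesgue (T i) \<le> F (snd i) - F (fst i)"
      by blast+
    \<comment> \<open>The steepness estimate applies to open intervals; the countably many endpoints join the exceptional set.\<close>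
    define N where "N = (S - (\<Union>(s, t)\<in>C. {s..t})) \<union> (fst ` C \<union> snd ` C)"
    have N: "negligible N"
      unfolding N_def using neg C(1)
      by (intro negligible_Un) (auto simp: negligible_iff_null_sets intro!: null_sets_completionI countable_imp_null_set_lborel)
    have bd: "measure lebesgue (\<Union>i\<in>J. T i) \<le> \<alpha> / \<beta> * measure lebesgue U" if J: "J \<subseteq> C" "finite J" for J
    proof -
      have dJ: "pairwise (\<lambda>(s, t) (s', t'). disjnt {s..t} {s'..t'}) J"
        using dis J(1) pairwise_subset by blast
      have "\<beta> * measure lebesgue (\<Union>i\<in>J. T i) \<le> \<beta> * (\<Sum>i\<in>J. measure lebesgue (T i))"
        using T(2) J \<open>0 < \<alpha>\<close> \<open>\<alpha> < \<beta>\<close>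
        by (intro mult_left_mono measure_UNION_le) (auto intro: fmeasurableD)
      also have "\<dots> \<le> (\<Sum>i\<in>J. F (snd i) - F (fst i))"
        using T(3) J by (subst sum_distrib_left, intro sum_mono) auto
      also have "\<dots> \<le> (\<Sum>i\<in>J. \<alpha> * (snd i - fst i))"
        using CK J by (intro sum_mono) auto
      also have "\<dots> = \<alpha> * measure lebesgue (\<Union>(s, t)\<in>J. {s..t})"
        using J CK(1) by (subst measure_disjoint_intervals[OF J(2) _ dJ])
          (force simp: case_prod_unfold sum_distrib_left)+
      also have "\<dots> \<le> \<alpha> * measure lebesgue U"
        using J CK(2) U(4) \<open>0 < \<alpha>\<close>
        by (intro mult_left_mono measure_mono_fmeasurable) (auto simp: case_prod_unfold)
      finally show ?thesis using \<open>0 < \<alpha>\<close> \<open>\<alpha> < \<beta>\<close> by (simp add: field_simps)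
    qed
    have T': "(\<Union>i\<in>C. T i) \<in> lmeasurable" "measure lebesgue (\<Union>i\<in>C. T i) \<le> \<alpha> / \<beta> * measure lebesgue U"
      using fmeasurable_UN_bound[OF C(1) T(2) bd] measure_UN_bound[OF C(1) T(2) bd] by auto
    show ?thesis
    proof (intro exI[of _ "(\<Union>i\<in>C. T i) \<union> N"] conjI)
      show "S \<subseteq> (\<Union>i\<in>C. T i) \<union> N"
      proof
        fix x assume x: "x \<in> S"
        show "x \<in> (\<Union>i\<in>C. T i) \<union> N"
        proof (cases "x \<in> N")
          case False
          then obtain i where i: "i \<in> C" "x \<in> {fst i..snd i}" using x unfolding N_def by auto
          then have "x \<in> {fst i<..<snd i}" using False unfolding N_def by force
          then show ?thesis using T(1)[OF i(1)] i x by blast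
        qed simp
      qed
      show "(\<Union>i\<in>C. T i) \<union> N \<in> lmeasurable"
        by (rule fmeasurable.Un[OF T'(1) negligible_imp_measurable[OF N]])
      have "measure lebesgue ((\<Union>i\<in>C. T i) \<union> N) = measure lebesgue (\<Union>i\<in>C. T i)"
        by (rule measure_Un_null_set[OF fmeasurableD[OF T'(1)] N[unfolded negligible_iff_null_sets]])
      then show "measure lebesgue ((\<Union>i\<in>C. T i) \<union> N) \<le> \<alpha> / \<beta> * measure lebesgue U"
        using T'(2) by simp
    qed
  qed
  \<comment> \<open>The infimum of \<open>M\<close> is the outer measure of \<open>S\<close>.\<close>
  define M where "M = {measure lebesgue T |T. T \<in> lmeasurable \<and> S \<subseteq> T}"
  have M_bdd: "bdd_below M" unfolding M_def by (rule bdd_belowI[of _ 0]) auto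
  have M_ne: "M \<noteq> {}"
    unfolding M_def using S_ab by (auto intro!: exI[of _ "cbox a b"])
  have step: "Inf M \<le> \<alpha> / \<beta> * (Inf M + e)" if e: "e > 0" for e
  proof -
    obtain T where T: "T \<in> lmeasurable" "S \<subseteq> T" "measure lebesgue T < Inf M + e / 2"
      using cInf_lessD[OF M_ne, of "Inf M + e / 2"] e unfolding M_def by force
    obtain U where U: "open U" "T \<subseteq> U" "U - T \<in> lmeasurable" "emeasure lebesgue (U - T) < ennreal (e / 2)"
      using sets_lebesgue_outer_open[OF fmeasurableD[OF T(1)], of "e / 2"] e by (metis half_gt_zero)
    have mU: "U \<in> lmeasurable"
      using fmeasurable.Un[OF T(1) U(3)] U(2) by (simp add: Un_absorb1)
    have "measure lebesgue U \<le> measure lebesgue T + measure lebesgue (U - T)"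
      using measure_Un_le[of T lebesgue "U - T"] T(1) U(2,3) by (auto simp: Un_absorb1 dest: fmeasurableD)
    also have "measure lebesgue (U - T) < e / 2"
      using U(3,4) e by (simp add: emeasure_eq_measure2 ennreal_less_iff)
    finally have U_le: "measure lebesgue U < Inf M + e" using T(3) by simp
    have "U \<inter> {a<..<b} \<in> lmeasurable"
      using mU by (intro fmeasurable_Int_fmeasurable) auto
    from shrink[OF _ _ _ this] obtain T2 where T2: "S \<subseteq> T2" "T2 \<in> lmeasurable"
        "measure lebesgue T2 \<le> \<alpha> / \<beta> * measure lebesgue (U \<inter> {a<..<b})"
      using U(1,2) T(2) S_ab by (auto simp: open_Int)
    have "Inf M \<le> measure lebesgue T2"
      using M_bdd T2 by (intro cInf_lower) (auto simp: M_def)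
    also note T2(3)
    also have "\<alpha> / \<beta> * measure lebesgue (U \<inter> {a<..<b}) \<le> \<alpha> / \<beta> * (Inf M + e)"
    proof -
      have "measure lebesgue (U \<inter> {a<..<b}) \<le> measure lebesgue U"
        using mU by (intro measure_mono_fmeasurable) auto
      then show ?thesis using U_le \<open>0 < \<alpha>\<close> \<open>\<alpha> < \<beta>\<close> by (intro mult_left_mono) auto
    qed
    finally show ?thesis .
  qed
  have "Inf M \<le> \<alpha> / \<beta> * Inf M"
  proof (rule field_le_epsilon)
    fix e :: real assume "e > 0"
    then have "Inf M \<le> \<alpha> / \<beta> * (Inf M + \<beta> / \<alpha> * e)" using \<open>0 < \<alpha>\<close> \<open>\<alpha> < \<beta>\<close> by (intro step) auto
    also have "\<dots> = \<alpha> / \<beta> * Inf M + e" using \<open>0 < \<alpha>\<close> \<open>\<alpha> < \<beta>\<close> by (simp add: field_simps)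
    finally show "Inf M \<le> \<alpha> / \<beta> * Inf M + e" .
  qed
  then have "(\<beta> - \<alpha>) * Inf M \<le> 0" using \<open>0 < \<alpha>\<close> \<open>\<alpha> < \<beta>\<close> by (simp add: field_simps)
  then have M0: "Inf M \<le> 0" using \<open>\<alpha> < \<beta>\<close> by (simp add: mult_le_0_iff)
  show ?thesis
    unfolding negligible_outer S_def[symmetric]
  proof (intro allI impI)
    fix e :: real assume "e > 0"
    then obtain T where "T \<in> lmeasurable" "S \<subseteq> T" "measure lebesgue T < e"
      using cInf_lessD[OF M_ne, of e] M0 unfolding M_def by auto
    then show "\<exists>T. S \<subseteq> T \<and> T \<in> lmeasurable \<and> measure lebesgue T < e" by auto
  qed
qed

text \<open>
  With rate \<open>n\<close> in \<open>outer_measure_steep_le\<close>, the outer measure is at most \<open>(F b - F a) / n\<close>.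
\<close>

lemma negligible_infinitely_steep:
  fixes F :: "real \<Rightarrow> real"
  assumes F: "mono_on {a..b} F"
  shows "negligible {x \<in> {a<..<b}. \<forall>n::nat. \<exists>\<^sub>F y in at x. real n < diff_quot F x y}" (is "negligible ?S")
proof (cases "a \<le> b")
  case True
  show ?thesis
    unfolding negligible_outer_le
  proof (intro allI impI)
    fix e :: real assume "e > 0"
    obtain n :: nat where n: "(F b - F a) / e < real n" "0 < n"
      by (metis gr0I less_trans of_nat_0_less_iff reals_Archimedean2 of_nat_less_0_iff not_less zero_less_Suc of_nat_0 less_le_trans lessI of_nat_mono less_imp_le)
    obtain T where T: "?S \<subseteq> T" "T \<in> lmeasurable" "real n * measure lebesgue T \<le> F b - F a"
    proof (rule outer_measure_steep_le[OF F True, of "real n" ?S])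
      show "0 < real n" "?S \<subseteq> {a<..<b}" using n by auto
      show "\<exists>\<^sub>F y in at x. real n < diff_quot F x y" if "x \<in> ?S" for x
        using that by blast
    qed
    have "real n * measure lebesgue T \<le> real n * e"
      using T(3) n(1) \<open>e > 0\<close> by (simp add: divide_less_eq mult.commute)
    then have "measure lebesgue T \<le> e"
      using n(2) by (simp add: mult_le_cancel_left)
    then show "\<exists>T. ?S \<subseteq> T \<and> T \<in> lmeasurable \<and> measure lebesgue T \<le> e"
      using T(1,2) by blast
  qed
qed auto

text \<open>
  Where the lower and upper limits of the difference quotient differ, rational \<open>\<alpha> < \<beta>\<close> separate them,
  which leaves countably many null sets; where they agree, the common value is finite off a further
  null set.
\<close>

theorem negligible_not_differentiable_mono:
  fixes F :: "real \<Rightarrow> real"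
  assumes F: "mono_on {a..b} F"
  shows "negligible {x \<in> {a<..<b}. \<not> F differentiable (at x)}"
proof -
  let ?A = "\<lambda>\<alpha> \<beta>. {x \<in> {a<..<b}. (\<exists>\<^sub>F y in at x. diff_quot F x y < \<alpha>) \<and> (\<exists>\<^sub>F y in at x. \<beta> < diff_quot F x y)}"
  let ?I = "{x \<in> {a<..<b}. \<forall>n::nat. \<exists>\<^sub>F y in at x. real n < diff_quot F x y}"
  define Q where "Q = {(\<alpha>, \<beta>). \<alpha> \<in> \<rat> \<and> \<beta> \<in> \<rat> \<and> 0 < \<alpha> \<and> \<alpha> < (\<beta>::real)}"
  have "countable Q"
    by (rule countable_subset[of _ "\<rat> \<times> \<rat>"]) (auto simp: Q_def countable_rat)
  then have "negligible (?I \<union> (\<Union>i\<in>Q. ?A (fst i) (snd i)))"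
  proof (intro negligible_Un negligible_countable_Union)
    show "negligible ?I" using F by (rule negligible_infinitely_steep)
    show "negligible T" if "T \<in> (\<lambda>i. ?A (fst i) (snd i)) ` Q" for T
    proof -
      from that obtain i where i: "i \<in> Q" "T = ?A (fst i) (snd i)" by blast
      then have "0 < fst i" "fst i < snd i" by (auto simp: Q_def)
      then show ?thesis unfolding i(2) by (rule negligible_slow_and_steep[OF F])
    qed
    show "countable ((\<lambda>i. ?A (fst i) (snd i)) ` Q)" using \<open>countable Q\<close> by simp
  qed
  moreover have "{x \<in> {a<..<b}. \<not> F differentiable (at x)} \<subseteq> ?I \<union> (\<Union>i\<in>Q. ?A (fst i) (snd i))"
  proof (rule subsetI, rule ccontr)
    fix x assume x: "x \<in> {x \<in> {a<..<b}. \<not> F differentiable (at x)}" and nx: "x \<notin> ?I \<union> (\<Union>i\<in>Q. ?A (fst i) (snd i))"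
    let ?q = "\<lambda>y. ereal (diff_quot F x y)"
    obtain n :: nat where "\<not> (\<exists>\<^sub>F y in at x. real n < diff_quot F x y)" using x nx by auto
    then have up: "\<forall>\<^sub>F y in at x. diff_quot F x y \<le> real n"
      by (auto simp: frequently_def not_less)
    have lo: "\<forall>\<^sub>F y in at x. 0 \<le> diff_quot F x y"
    proof -
      have "\<forall>\<^sub>F y in at x. y \<in> {a<..<b}" using x by (intro eventually_at_in_open') auto
      then show ?thesis
      proof eventually_elim
        case (elim y)
        then show ?case using F x unfolding diff_quot_def mono_on_def
          by (cases "y \<le> x") (auto intro!: divide_nonneg_nonneg divide_nonpos_nonpos)
      qed
    qed
    have Ls: "Limsup (at x) ?q \<le> ereal (real n)" using up by (intro Limsup_bounded) auto
    have Li: "0 \<le> Liminf (at x) ?q" using lo by (intro Liminf_bounded) (auto simp: zero_ereal_def)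
    have le: "Liminf (at x) ?q \<le> Limsup (at x) ?q" by (intro Liminf_le_Limsup) auto
    have "Limsup (at x) ?q \<le> Liminf (at x) ?q"
    proof (rule ccontr)
      assume "\<not> ?thesis"
      then obtain \<beta>' where \<beta>': "Liminf (at x) ?q < ereal \<beta>'" "ereal \<beta>' < Limsup (at x) ?q"
        using ereal_dense2 by (auto simp: not_le)
      obtain \<alpha>' where \<alpha>': "Liminf (at x) ?q < ereal \<alpha>'" "\<alpha>' < \<beta>'"
        using ereal_dense2[OF \<beta>'(1)] by auto
      obtain \<alpha> where \<alpha>: "\<alpha> \<in> \<rat>" "\<alpha>' < \<alpha>" "\<alpha> < \<beta>'" using Rats_dense_in_real[OF \<alpha>'(2)] by auto
      obtain \<beta>'' where \<beta>'': "\<beta>' < \<beta>''" "ereal \<beta>'' < Limsup (at x) ?q"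
        using ereal_dense2[OF \<beta>'(2)] by auto
      obtain \<beta> where \<beta>: "\<beta> \<in> \<rat>" "\<beta>' < \<beta>" "\<beta> < \<beta>''" using Rats_dense_in_real[OF \<beta>''(1)] by auto
      have a0: "0 < \<alpha>'" using Li \<alpha>'(1) by (metis ereal_less(2) le_less_trans)
      have "(\<alpha>, \<beta>) \<in> Q" using \<alpha> \<beta> a0 by (auto simp: Q_def)
      moreover have "\<exists>\<^sub>F y in at x. diff_quot F x y < \<alpha>"
      proof (rule ccontr)
        assume "\<not> ?thesis"
        then have "\<forall>\<^sub>F y in at x. ereal \<alpha> \<le> ?q y" by (auto simp: frequently_def not_less)
        then have "ereal \<alpha> \<le> Liminf (at x) ?q" by (intro Liminf_bounded) auto
        then have "ereal \<alpha> < ereal \<alpha>'" using \<alpha>' le_less_trans by blast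
        then show False using \<alpha> by simp
      qed
      moreover have "\<exists>\<^sub>F y in at x. \<beta> < diff_quot F x y"
      proof (rule ccontr)
        assume "\<not> ?thesis"
        then have "\<forall>\<^sub>F y in at x. ?q y \<le> ereal \<beta>" by (auto simp: frequently_def not_less)
        then have "Limsup (at x) ?q \<le> ereal \<beta>" by (intro Limsup_bounded) auto
        then have "ereal \<beta>'' < ereal \<beta>" using \<beta>'' less_le_trans by blast
        then show False using \<beta> by simp
      qed
      ultimately show False using nx x by force
    qed
    with le have eq: "Liminf (at x) ?q = Limsup (at x) ?q" by simp
    obtain D where D: "Limsup (at x) ?q = ereal D"
      using Ls Li eq by (cases "Limsup (at x) ?q") auto
    have "(?q \<longlongrightarrow> ereal D) (at x)"
      using eq D by (intro Liminf_eq_Limsup) auto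
    then have "(diff_quot F x \<longlongrightarrow> D) (at x)" by simp
    then have "(F has_field_derivative D) (at x)"
      unfolding has_field_derivative_iff diff_quot_def .
    then have "F differentiable (at x)"
      by (blast intro: differentiableI has_field_derivative_imp_has_derivative)
    then show False using x by blast
  qed
  ultimately show ?thesis by (rule negligible_subset)
qed

section \<open>Absolutely continuous functions and indefinite integrals\<close>

lemma sum_lengths_le_measure:
  fixes I :: "(real \<times> real) set"
  assumes "finite I" "\<And>s t. (s, t) \<in> I \<Longrightarrow> s < t" "disjoint_family_on (\<lambda>(s, t). {s<..<t}) I"
    and "\<And>s t. (s, t) \<in> I \<Longrightarrow> {s<..<t} \<subseteq> U" and U: "U \<in> lmeasurable"
  shows "(\<Sum>(s, t)\<in>I. t - s) \<le> measure lebesgue U"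
proof -
  have fin: "{x<..<y} \<in> lmeasurable" for x y :: real
    by (metis box_real(1) lmeasurable_box)
  have dis: "disjoint_family_on (\<lambda>i. {fst i<..<snd i}) I"
    using assms(3) by (simp add: case_prod_unfold)
  have "(\<Sum>(s, t)\<in>I. t - s) = (\<Sum>i\<in>I. measure lebesgue {fst i<..<snd i})"
    unfolding case_prod_unfold using assms(2) by (intro sum.cong) (auto simp: less_imp_le)
  also have "\<dots> = measure lebesgue (\<Union>i\<in>I. {fst i<..<snd i})"
    using assms(1) dis fmeasurableD2[OF fin]
    by (intro measure_finite_Union[symmetric]) (auto simp del: emeasure_completion)
  also have "\<dots> \<le> measure lebesgue U"
  proof (rule measure_mono_fmeasurable)
    show "(\<Union>i\<in>I. {fst i<..<snd i}) \<subseteq> U" using assms(4) by fastforce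
    show "(\<Union>i\<in>I. {fst i<..<snd i}) \<in> sets lebesgue" using assms(1) by (auto intro!: sets.finite_UN)
  qed (rule U)
  finally show ?thesis .
qed

lemma abs_cont_onD:
  assumes "abs_cont_on S f" "0 < e"
  obtains d where "0 < d" and
    "\<And>I. \<lbrakk>finite I; \<And>s t. (s, t) \<in> I \<Longrightarrow> s < t \<and> {s..t} \<subseteq> S; disjoint_family_on (\<lambda>(s, t). {s<..<t}) I;
       (\<Sum>(s, t)\<in>I. t - s) < d\<rbrakk> \<Longrightarrow> (\<Sum>(s, t)\<in>I. cmod (f t - f s)) < e"
  using assms unfolding abs_cont_on_def by (smt (verit, best) case_prodI2)

lemma abs_cont_on_subset:
  assumes "abs_cont_on S f" "T \<subseteq> S"
  shows "abs_cont_on T f"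
  unfolding abs_cont_on_def
proof (intro allI impI)
  fix e :: real assume "e > 0"
  obtain d where d: "0 < d"
    "\<And>I. \<lbrakk>finite I; \<And>s t. (s, t) \<in> I \<Longrightarrow> s < t \<and> {s..t} \<subseteq> S; disjoint_family_on (\<lambda>(s, t). {s<..<t}) I;
       (\<Sum>(s, t)\<in>I. t - s) < d\<rbrakk> \<Longrightarrow> (\<Sum>(s, t)\<in>I. cmod (f t - f s)) < e"
    using abs_cont_onD[OF assms(1) \<open>e > 0\<close>] by metis
  have "(\<Sum>(s, t)\<in>I. cmod (f t - f s)) < e"
    if "finite I" "\<forall>(s, t)\<in>I. s < t \<and> {s..t} \<subseteq> T" "disjoint_family_on (\<lambda>(s, t). {s<..<t}) I"
      "(\<Sum>(s, t)\<in>I. t - s) < d" for I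
  proof (rule d(2))
    fix s t assume "(s, t) \<in> I"
    then have "s < t \<and> {s..t} \<subseteq> T" using that(2) by blast
    then show "s < t \<and> {s..t} \<subseteq> S" using assms(2) by blast
  qed (use that in blast)+
  then show "\<exists>\<delta>>0. \<forall>I. finite I \<longrightarrow> (\<forall>(a, b)\<in>I. a < b \<and> {a..b} \<subseteq> T) \<longrightarrow>
        disjoint_family_on (\<lambda>(a, b). {a<..<b}) I \<longrightarrow>
        (\<Sum>(a, b)\<in>I. b - a) < \<delta> \<longrightarrow> (\<Sum>(a, b)\<in>I. cmod (f b - f a)) < e"
    using d(1) by blast
qed

text \<open>
  Families of intervals with disjoint interiors replace partitions here, since absolute continuity is
  phrased by them; the supremum of the variation sums is the same total variation.
\<close>

definition variation_families :: "real \<Rightarrow> real \<Rightarrow> (real \<times> real) set set" where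
  "variation_families c x = {I. finite I \<and> (\<forall>(s, t)\<in>I. s < t \<and> {s..t} \<subseteq> {c..x}) \<and>
     disjoint_family_on (\<lambda>(s, t). {s<..<t}) I}"

definition variation_sum :: "(real \<Rightarrow> complex) \<Rightarrow> (real \<times> real) set \<Rightarrow> real" where
  "variation_sum f I = (\<Sum>(s, t)\<in>I. cmod (f t - f s))"

text \<open>
  Any family in \<open>[c,x]\<close> can be enlarged by the interval from \<open>x\<close> to \<open>y\<close>.
\<close>

lemma mono_variation:
  assumes bdd: "bdd_above (variation_sum f ` variation_families c d)"
  defines "V \<equiv> \<lambda>x. Sup (variation_sum f ` variation_families c x)"
  assumes xy: "c \<le> x" "x \<le> y" "y \<le> d"
  shows "V x + cmod (f y - f x) \<le> V y"
proof (cases "x = y")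
  case False
  then have "x < y" using xy by simp
  have sub: "variation_families c y \<subseteq> variation_families c d"
    using xy unfolding variation_families_def by fastforce
  have bdd_y: "bdd_above (variation_sum f ` variation_families c y)"
    by (rule bdd_above_mono[OF bdd]) (use sub in blast)
  have "V x \<le> V y - cmod (f y - f x)"
    unfolding V_def
  proof (rule cSUP_least)
    show "variation_families c x \<noteq> {}"
      by (auto simp: variation_families_def disjoint_family_on_def intro!: exI[of _ "{}"])
    fix I assume I: "I \<in> variation_families c x"
    have tx: "s < t \<and> c \<le> s \<and> t \<le> x" if "(s, t) \<in> I" for s t
      using I that unfolding variation_families_def by fastforce
    have ni: "(x, y) \<notin> I" using tx[of x y] \<open>x < y\<close> by auto
    have "disjoint_family_on (\<lambda>(s, t). {s<..<t}) (insert (x, y) I)"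
      using I ni tx unfolding variation_families_def
      by (subst disjoint_family_on_insert) (force dest: tx)+
    then have "insert (x, y) I \<in> variation_families c y"
      using I xy \<open>x < y\<close> tx unfolding variation_families_def by force
    then have "variation_sum f (insert (x, y) I) \<le> (SUP I\<in>variation_families c y. variation_sum f I)"
      by (intro cSUP_upper bdd_y)
    moreover have "variation_sum f (insert (x, y) I) = cmod (f y - f x) + variation_sum f I"
      using I ni unfolding variation_sum_def variation_families_def by (subst sum.insert) auto
    ultimately show "variation_sum f I \<le> (SUP I\<in>variation_families c y. variation_sum f I) - cmod (f y - f x)"
      by simp
  qed
  then show ?thesis by simp
qed simp

text \<open>
  The real and imaginary parts of \<open>f\<close> are differences of monotone functions: the total variation \<open>V\<close>,
  and \<open>V\<close> minus the part itself.
\<close>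

lemma negligible_not_differentiable_bounded_variation:
  fixes f :: "real \<Rightarrow> complex"
  assumes bdd: "bdd_above (variation_sum f ` variation_families c d)"
  shows "negligible {x \<in> {c<..<d}. \<not> f differentiable (at x)}"
proof -
  define V where "V = (\<lambda>x. Sup (variation_sum f ` variation_families c x))"
  have V: "V x + cmod (f y - f x) \<le> V y" if "c \<le> x" "x \<le> y" "y \<le> d" for x y
    unfolding V_def using mono_variation[OF bdd that] .
  have m0: "mono_on {c..d} V"
    by (rule mono_onI) (use V in \<open>smt (verit) atLeastAtMost_iff norm_ge_zero\<close>)
  have m1: "mono_on {c..d} (\<lambda>x. V x - Re (f x))"
  proof (rule mono_onI)
    fix x y assume "x \<in> {c..d}" "y \<in> {c..d}" "x \<le> y"
    then show "V x - Re (f x) \<le> V y - Re (f y)"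
      using V[of x y] abs_Re_le_cmod[of "f y - f x"] by auto
  qed
  have m2: "mono_on {c..d} (\<lambda>x. V x - Im (f x))"
  proof (rule mono_onI)
    fix x y assume "x \<in> {c..d}" "y \<in> {c..d}" "x \<le> y"
    then show "V x - Im (f x) \<le> V y - Im (f y)"
      using V[of x y] abs_Im_le_cmod[of "f y - f x"] by auto
  qed
  let ?N = "\<lambda>F. {x \<in> {c<..<d}. \<not> F differentiable (at x)}"
  have "negligible (?N V \<union> ?N (\<lambda>x. V x - Re (f x)) \<union> ?N (\<lambda>x. V x - Im (f x)))"
    using negligible_not_differentiable_mono[OF m0] negligible_not_differentiable_mono[OF m1]
      negligible_not_differentiable_mono[OF m2] by simp
  moreover have "?N f \<subseteq> ?N V \<union> ?N (\<lambda>x. V x - Re (f x)) \<union> ?N (\<lambda>x. V x - Im (f x))"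
  proof (rule subsetI, rule ccontr)
    fix x assume x: "x \<in> ?N f" and nx: "x \<notin> ?N V \<union> ?N (\<lambda>x. V x - Re (f x)) \<union> ?N (\<lambda>x. V x - Im (f x))"
    then have d0: "V differentiable (at x)" and d1: "(\<lambda>x. V x - Re (f x)) differentiable (at x)"
      and d2: "(\<lambda>x. V x - Im (f x)) differentiable (at x)" by auto
    have dR: "(\<lambda>x. Re (f x)) differentiable (at x)" using differentiable_diff[OF d0 d1] by simp
    have dI: "(\<lambda>x. Im (f x)) differentiable (at x)" using differentiable_diff[OF d0 d2] by simp
    obtain R' I' where RI: "((\<lambda>x. Re (f x)) has_derivative R') (at x)" "((\<lambda>x. Im (f x)) has_derivative I') (at x)"
      using dR dI unfolding differentiable_def by blast
    have "((\<lambda>x. of_real (Re (f x)) + \<i> * of_real (Im (f x))) has_derivative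
        (\<lambda>h. of_real (R' h) + \<i> * of_real (I' h))) (at x)"
      using RI by (auto intro!: derivative_intros)
    then have "(f has_derivative (\<lambda>h. of_real (R' h) + \<i> * of_real (I' h))) (at x)"
      by (simp flip: complex_eq)
    then show False using x differentiableI by blast
  qed
  ultimately show ?thesis by (rule negligible_subset)
qed

text \<open>
  On an interval shorter than the \<open>\<delta>\<close> belonging to \<open>\<epsilon> = 1\<close>, all variation sums stay below \<open>1\<close>. Bounded
  variation on short intervals suffices because negligibility is a local property.
\<close>

theorem negligible_not_differentiable_abs_cont:
  assumes ac: "abs_cont_on {a..b} f"
  shows "negligible {x \<in> {a<..<b}. \<not> f differentiable (at x)}" (is "negligible ?S")
proof -
  obtain \<delta> where \<delta>: "0 < \<delta>" and
    ac': "\<And>I. \<lbrakk>finite I; \<And>s t. (s, t) \<in> I \<Longrightarrow> s < t \<and> {s..t} \<subseteq> {a..b}; disjoint_family_on (\<lambda>(s, t). {s<..<t}) I;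
       (\<Sum>(s, t)\<in>I. t - s) < \<delta>\<rbrakk> \<Longrightarrow> (\<Sum>(s, t)\<in>I. cmod (f t - f s)) < 1"
    using abs_cont_onD[OF ac, of 1] by (metis zero_less_one)
  show ?thesis
  proof (rule iffD2[OF locally_negligible_alt], rule ballI)
    fix x assume x: "x \<in> ?S"
    \<comment> \<open>The interval around \<open>x\<close> of length \<open>2 e < \<delta>\<close> remains inside \<open>[a,b]\<close>.\<close>
    define e where "e = min (\<delta> / 3) (min (x - a) (b - x))"
    have xab: "a < x" "x < b" using x by simp_all
    have "e \<le> \<delta> / 3" unfolding e_def by (rule min.cobounded1)
    then have e: "0 < e" "2 * e < \<delta>" using xab \<delta> by (auto simp: e_def)
    have "a \<le> x - e" "x + e \<le> b" unfolding e_def by linarith+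
    then have esub: "{x - e..x + e} \<subseteq> {a..b}" by auto
    have "bdd_above (variation_sum f ` variation_families (x - e) (x + e))"
    proof (rule bdd_aboveI2)
      fix I assume I: "I \<in> variation_families (x - e) (x + e)"
      then have I': "s < t" "{s..t} \<subseteq> {x - e..x + e}" if "(s, t) \<in> I" for s t
        using that unfolding variation_families_def by auto
      have I2: "finite I" "disjoint_family_on (\<lambda>(s, t). {s<..<t}) I"
        using I unfolding variation_families_def by blast+
      have "(\<Sum>(s, t)\<in>I. t - s) \<le> measure lebesgue (cbox (x - e) (x + e))"
      proof (rule sum_lengths_le_measure)
        show "{s<..<t} \<subseteq> cbox (x - e) (x + e)" if "(s, t) \<in> I" for s t
          using greaterThanLessThan_subseteq_atLeastAtMost_iff[of s t "x - e" "x + e"] I'[OF that] by auto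
      qed (use I2 I'(1) in auto)
      also have "\<dots> = 2 * e" using e(1) by simp
      finally have "(\<Sum>(s, t)\<in>I. t - s) < \<delta>" using e(2) by simp
      moreover have "s < t \<and> {s..t} \<subseteq> {a..b}" if "(s, t) \<in> I" for s t
        using I'[OF that] esub by blast
      ultimately show "variation_sum f I \<le> 1"
        using ac'[OF I2(1) _ I2(2)] unfolding variation_sum_def by (simp add: less_imp_le)
    qed
    from negligible_not_differentiable_bounded_variation[OF this]
    have "negligible (?S \<inter> {x - e<..<x + e})"
      by (rule negligible_subset) auto
    moreover have "openin (top_of_set ?S) (?S \<inter> {x - e<..<x + e})"
      by (intro openin_open_Int) auto
    ultimately show "\<exists>U. openin (top_of_set ?S) U \<and> x \<in> U \<and> negligible U"
      using x e(1) by (intro exI[of _ "?S \<inter> {x - e<..<x + e}"]) auto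
  qed
qed

text \<open>
  The gauge integral is tailored to this. At a point where \<open>f\<close> has derivative \<open>g\<close>, the gauge is so fine
  that \<open>g(x) |k|\<close> differs from the increment of \<open>f\<close> over \<open>k\<close> by at most \<open>e/2 |k|\<close>. At the points of \<open>N\<close>
  the gauge is an open set \<open>U \<supseteq> N\<close> of measure below the \<open>\<delta>\<close> of absolute continuity, so that the
  increments of \<open>f\<close> over all intervals tagged there add up to at most \<open>\<epsilon>\<close>.
\<close>

theorem has_integral_abs_cont_derivative:
  fixes f :: "real \<Rightarrow> complex"
  assumes "a \<le> b" and ac: "abs_cont_on {a..b} f" and N: "negligible N"
    and deriv: "\<And>x. x \<in> {a..b} - N \<Longrightarrow> (f has_vector_derivative g x) (at x within {a..b})"
  shows "(g has_integral (f b - f a)) {a..b}"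
proof -
  define h where "h x = (if x \<in> N then 0 else g x)" for x
  have "(h has_integral (f b - f a)) {a..b}"
    unfolding has_integral_factor_content_real
  proof (intro allI impI)
    fix e :: real assume "e > 0"
    show "\<exists>d. gauge d \<and> (\<forall>p. p tagged_division_of {a..b} \<and> d fine p \<longrightarrow>
      norm (sum (\<lambda>(x,k). measure lborel k *\<^sub>R h x) p - (f b - f a)) \<le> e * measure lborel {a..b})"
    proof (cases "a = b")
      case True
      show ?thesis
      proof (intro exI[of _ "\<lambda>x. ball x 1"] conjI allI impI gauge_ball)
        fix p assume "p tagged_division_of {a..b} \<and> (\<lambda>x. ball x 1) fine p"
        then have p: "p tagged_division_of cbox a b" by simp
        have "(\<Sum>(x, k)\<in>p. measure lborel k *\<^sub>R h x) = 0"
          using sum_content_null[OF _ p, of h] True by simp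
        then show "norm (sum (\<lambda>(x,k). measure lborel k *\<^sub>R h x) p - (f b - f a)) \<le> e * measure lborel {a..b}"
          using True by simp
      qed simp
    next
      case False
      then have "a < b" using \<open>a \<le> b\<close> by simp
      define \<epsilon> where "\<epsilon> = e * (b - a) / 2"
      have "0 < \<epsilon>" using \<open>e > 0\<close> \<open>a < b\<close> by (simp add: \<epsilon>_def)
      obtain \<delta> where \<delta>: "0 < \<delta>" and
        ac': "\<And>I. \<lbrakk>finite I; \<And>s t. (s, t) \<in> I \<Longrightarrow> s < t \<and> {s..t} \<subseteq> {a..b}; disjoint_family_on (\<lambda>(s, t). {s<..<t}) I;
           (\<Sum>(s, t)\<in>I. t - s) < \<delta>\<rbrakk> \<Longrightarrow> (\<Sum>(s, t)\<in>I. cmod (f t - f s)) < \<epsilon>"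
        using abs_cont_onD[OF ac \<open>0 < \<epsilon>\<close>] by metis
      have N0: "N \<in> null_sets lebesgue" using N by (simp add: negligible_iff_null_sets)
      obtain U where U: "open U" "N \<subseteq> U" "U - N \<in> lmeasurable" "emeasure lebesgue (U - N) < ennreal \<delta>"
        using sets_lebesgue_outer_open[of N \<delta>] N0 \<delta> by auto
      have "U = (U - N) \<union> N" using U(2) by auto
      have mU: "U \<in> lmeasurable"
        by (subst \<open>U = (U - N) \<union> N\<close>) (rule fmeasurable.Un[OF U(3) negligible_imp_measurable[OF N]])
      have "measure lebesgue U = measure lebesgue (U - N)"
        by (subst \<open>U = (U - N) \<union> N\<close>) (rule measure_Un_null_set[OF fmeasurableD[OF U(3)] N0])
      also have "\<dots> < \<delta>" using U(3,4) \<delta> by (simp add: emeasure_eq_measure2 ennreal_less_iff)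
      finally have U_small: "measure lebesgue U < \<delta>" .
      have "\<exists>r>0. \<forall>y\<in>{a..b}. \<bar>y - x\<bar> < r \<longrightarrow> cmod (f y - f x - (y - x) *\<^sub>R g x) \<le> e / 2 * \<bar>y - x\<bar>"
        if "x \<in> {a..b} - N" for x
        using deriv[OF that] \<open>e > 0\<close>
        unfolding has_vector_derivative_def has_derivative_within_alt
        by (elim conjE allE[of _ "e/2"]) (auto simp: algebra_simps)
      then obtain r where r: "\<And>x. x \<in> {a..b} - N \<Longrightarrow> 0 < r x"
        "\<And>x y. x \<in> {a..b} - N \<Longrightarrow> y \<in> {a..b} \<Longrightarrow> \<bar>y - x\<bar> < r x \<Longrightarrow> cmod (f y - f x - (y - x) *\<^sub>R g x) \<le> e / 2 * \<bar>y - x\<bar>"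
        by metis
      define d where "d x = (if x \<in> N then U else if x \<in> {a..b} then ball x (r x) else UNIV)" for x
      have "gauge d"
        unfolding gauge_def d_def using U(1,2) r(1) by auto
      moreover have bound: "norm (sum (\<lambda>(x,k). measure lborel k *\<^sub>R h x) p - (f b - f a)) \<le> e * measure lborel {a..b}"
        if p: "p tagged_division_of {a..b}" and fine: "d fine p" for p
      proof -
        note pD = tagged_division_ofD[OF p]
        have kD: "\<exists>u v. k = {u..v} \<and> u \<le> x \<and> x \<le> v \<and> a \<le> u \<and> v \<le> b \<and> {u..v} \<subseteq> d x" if "(x, k) \<in> p" for x k
          using pD(2)[OF that] pD(3)[OF that] pD(4)[OF that] fineD[OF fine that] by fastforce
        have kI: "k = {Inf k..Sup k} \<and> Inf k \<le> x \<and> x \<le> Sup k \<and> a \<le> Inf k \<and> Sup k \<le> b \<and> k \<subseteq> d x"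
          if "(x, k) \<in> p" for x k
        proof -
          obtain u v where uv: "k = {u..v}" "u \<le> x" "x \<le> v" "a \<le> u" "v \<le> b" "{u..v} \<subseteq> d x"
            using kD[OF \<open>(x, k) \<in> p\<close>] by blast
          then have "Inf k = u" "Sup k = v" by auto
          then show ?thesis using uv by auto
        qed
        define E where "E = (\<lambda>(x, k). measure lborel k *\<^sub>R h x - (f (Sup k) - f (Inf k)))"
        have eq: "sum (\<lambda>(x,k). measure lborel k *\<^sub>R h x) p - (f b - f a) = sum E p"
          unfolding E_def case_prod_unfold sum_subtractf
          using additive_tagged_division_1[OF \<open>a \<le> b\<close> p, of f] by (simp add: case_prod_unfold sum_subtractf)
        define A where "A = {xk \<in> p. fst xk \<in> N}"
        have fin: "finite p" by (rule pD(1))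
        have split: "sum E p = sum E A + sum E (p - A)"
          using fin by (subst sum.subset_diff[of A p]) (auto simp: A_def)
        have good: "norm (sum E (p - A)) \<le> \<epsilon>"
        proof -
          have "norm (sum E (p - A)) \<le> (\<Sum>(x, k)\<in>p - A. e / 2 * measure lborel k)"
          proof (rule sum_norm_le)
            fix xk assume xk: "xk \<in> p - A"
            obtain x k where [simp]: "xk = (x, k)" by (cases xk)
            have xkp: "(x, k) \<in> p" and xN: "x \<notin> N" using xk by (auto simp: A_def)
            define s t where "s = Inf k" and "t = Sup k"
            have st: "k = {s..t}" "s \<le> x" "x \<le> t" "a \<le> s" "t \<le> b" "k \<subseteq> d x"
              using kI[OF xkp] by (auto simp: s_def t_def)
            have x: "x \<in> {a..b} - N" using st xN by auto
            have "s \<in> d x" "t \<in> d x" using st by auto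
            then have "\<bar>s - x\<bar> < r x" "\<bar>t - x\<bar> < r x"
              using x unfolding d_def by (auto simp: dist_real_def)
            then have "cmod (f s - f x - (s - x) *\<^sub>R g x) \<le> e / 2 * \<bar>s - x\<bar>"
                      "cmod (f t - f x - (t - x) *\<^sub>R g x) \<le> e / 2 * \<bar>t - x\<bar>"
              using r(2)[OF x, of s] r(2)[OF x, of t] st by auto
            then have "cmod ((f s - f x - (s - x) *\<^sub>R g x) - (f t - f x - (t - x) *\<^sub>R g x)) \<le> e / 2 * \<bar>s - x\<bar> + e / 2 * \<bar>t - x\<bar>"
              by (rule order_trans[OF norm_triangle_ineq4 add_mono])
            also have "\<dots> = e / 2 * (\<bar>s - x\<bar> + \<bar>t - x\<bar>)" by (simp add: distrib_left)
            also have "\<bar>s - x\<bar> + \<bar>t - x\<bar> = t - s" using st by simp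
            also have "(f s - f x - (s - x) *\<^sub>R g x) - (f t - f x - (t - x) *\<^sub>R g x) = (t - s) *\<^sub>R g x - (f t - f s)"
              by (simp add: algebra_simps)
            finally show "norm (E xk) \<le> (case xk of (x, k) \<Rightarrow> e / 2 * measure lborel k)"
              using st xN unfolding E_def h_def s_def[symmetric] t_def[symmetric]
              by (simp flip: s_def t_def)
          qed
          also have "\<dots> \<le> (\<Sum>(x, k)\<in>p. e / 2 * measure lborel k)"
            using fin \<open>e > 0\<close> by (intro sum_mono2) (auto simp: content_pos_le)
          also have "\<dots> = \<epsilon>"
            using additive_content_tagged_division[of p a b] p \<open>a < b\<close>
            by (simp add: \<epsilon>_def case_prod_unfold flip: sum_divide_distrib sum_distrib_left)
          finally show ?thesis .
        qed
        have bad: "norm (sum E A) \<le> \<epsilon>"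
        proof -
          \<comment> \<open>Degenerate intervals contribute nothing but would spoil injectivity of the passage to endpoints.\<close>
          define A' where "A' = {xk \<in> A. Inf (snd xk) < Sup (snd xk)}"
          define \<iota> where "\<iota> xk = (Inf (snd xk), Sup (snd xk))" for xk :: "real \<times> real set"
          have finA: "finite A" "finite A'" "A' \<subseteq> A" "A' \<subseteq> p" using fin by (auto simp: A_def A'_def)
          have int: "interior k = {Inf k<..<Sup k}" if "(x, k) \<in> p" for x k
            using kI[OF that] interior_atLeastAtMost_real by metis
          have disj: "{Inf k<..<Sup k} \<inter> {Inf k'<..<Sup k'} = {}"
            if "(x, k) \<in> p" "(x', k') \<in> p" "(x, k) \<noteq> (x', k')" for x k x' k'
            using pD(5)[OF that(1,2)] that int by metis
          have inj: "inj_on \<iota> A'"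
          proof (rule inj_onI)
            fix xk yk assume xy: "xk \<in> A'" "yk \<in> A'" "\<iota> xk = \<iota> yk"
            show "xk = yk"
            proof (rule ccontr)
              assume "xk \<noteq> yk"
              then have "{Inf (snd xk)<..<Sup (snd xk)} \<inter> {Inf (snd yk)<..<Sup (snd yk)} = {}"
                using disj[of "fst xk" "snd xk" "fst yk" "snd yk"] xy finA by auto
              then show False using xy unfolding \<iota>_def A'_def by (auto simp: not_less[symmetric])
            qed
          qed
          have "norm (sum E A) \<le> (\<Sum>xk\<in>A. norm (f (Sup (snd xk)) - f (Inf (snd xk))))"
            by (rule sum_norm_le) (auto simp: E_def A_def h_def norm_minus_commute)
          also have "\<dots> = (\<Sum>xk\<in>A'. norm (f (Sup (snd xk)) - f (Inf (snd xk))))"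
          proof (rule sum.mono_neutral_right)
            show "\<forall>i\<in>A - A'. cmod (f (Sup (snd i)) - f (Inf (snd i))) = 0"
            proof
              fix i assume i: "i \<in> A - A'"
              then have "(fst i, snd i) \<in> p" "\<not> Inf (snd i) < Sup (snd i)" by (auto simp: A_def A'_def)
              then have "Inf (snd i) = Sup (snd i)" using kI[of "fst i" "snd i"] by linarith
              then show "cmod (f (Sup (snd i)) - f (Inf (snd i))) = 0" by simp
            qed
          qed (use finA in auto)
          also have "\<dots> = (\<Sum>(s, t)\<in>\<iota> ` A'. cmod (f t - f s))"
            unfolding sum.reindex[OF inj] by (simp add: \<iota>_def)
          also have "\<dots> < \<epsilon>"
          proof (rule ac')
            show "finite (\<iota> ` A')" using finA by simp
            have st: "\<exists>x. (x, {s..t}) \<in> p \<and> x \<in> N \<and> s < t \<and> Inf {s..t} = s \<and> Sup {s..t} = t \<and> a \<le> s \<and> t \<le> b \<and> {s..t} \<subseteq> U"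
              if "(s, t) \<in> \<iota> ` A'" for s t
            proof -
              obtain xk where xk: "xk \<in> A'" "s = Inf (snd xk)" "t = Sup (snd xk)" using \<open>(s, t) \<in> \<iota> ` A'\<close> by (auto simp: \<iota>_def)
              have m: "(fst xk, snd xk) \<in> p" "fst xk \<in> N" "s < t" using xk by (auto simp: A'_def A_def)
              have k: "snd xk = {s..t}" "a \<le> s" "t \<le> b" "snd xk \<subseteq> d (fst xk)" using kI[OF m(1)] xk by auto
              have "d (fst xk) = U" using m(2) by (simp add: d_def)
              then show ?thesis using m k by (intro exI[of _ "fst xk"]) auto
            qed
            show "s < t \<and> {s..t} \<subseteq> {a..b}" if "(s, t) \<in> \<iota> ` A'" for s t using st[OF that] by auto
            show dis: "disjoint_family_on (\<lambda>(s, t). {s<..<t}) (\<iota> ` A')"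
              unfolding disjoint_family_on_def
            proof (intro ballI impI)
              fix i j assume m0: "i \<in> \<iota> ` A'" "j \<in> \<iota> ` A'" "i \<noteq> j"
              obtain s t s' t' where ij: "i = (s, t)" "j = (s', t')" by (metis surj_pair)
              have m: "(s, t) \<in> \<iota> ` A'" "(s', t') \<in> \<iota> ` A'" and ne: "s = s' \<longrightarrow> t \<noteq> t'" using m0 ij by auto
              obtain x where x: "(x, {s..t}) \<in> p" "Inf {s..t} = s" "Sup {s..t} = t" "s < t" using st[OF m(1)] by blast
              obtain x' where x': "(x', {s'..t'}) \<in> p" "Inf {s'..t'} = s'" "Sup {s'..t'} = t'" "s' < t'" using st[OF m(2)] by blast
              have "{s..t} \<noteq> {s'..t'}" using ne x x' by metis
              then show "(case i of (s, t) \<Rightarrow> {s<..<t}) \<inter> (case j of (s, t) \<Rightarrow> {s<..<t}) = {}"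
                using disj[OF x(1) x'(1)] x x' ij by simp
            qed
            have "(\<Sum>(s, t)\<in>\<iota> ` A'. t - s) \<le> measure lebesgue U"
              by (rule sum_lengths_le_measure[OF _ _ dis _ mU]) (use finA st in \<open>fastforce+\<close>)
            then show "(\<Sum>(s, t)\<in>\<iota> ` A'. t - s) < \<delta>" using U_small by simp
          qed
          finally show ?thesis by simp
        qed
        have "norm (sum E p) \<le> \<epsilon> + \<epsilon>"
          unfolding split using good bad by (intro norm_triangle_le) simp
        also have "\<epsilon> + \<epsilon> = e * measure lborel {a..b}" using \<open>a < b\<close> by (simp add: \<epsilon>_def)
        finally show ?thesis unfolding eq .
      qed
      ultimately have *: "gauge d" "\<forall>p. p tagged_division_of {a..b} \<and> d fine p \<longrightarrow>
          norm (sum (\<lambda>(x,k). measure lborel k *\<^sub>R h x) p - (f b - f a)) \<le> e * measure lborel {a..b}"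
        by auto
      show ?thesis by (rule exI[of _ d], rule conjI, rule *(1), rule *(2))
    qed
  qed
  then show ?thesis
    by (rule has_integral_spike[OF N, rotated]) (simp add: h_def)
qed

text \<open>
  By Henstock's lemma the sums of \<open>|k(x)| |K|\<close> over fine divisions differ little from the sums of the
  norms of the integrals of \<open>k\<close> over the pieces, which are all zero; hence the norm of \<open>k\<close> integrates to \<open>0\<close>.
\<close>

lemma negligible_nonzero_of_zero_integrals:
  fixes k :: "real \<Rightarrow> complex"
  assumes z: "\<And>c d. a \<le> c \<Longrightarrow> c \<le> d \<Longrightarrow> d \<le> b \<Longrightarrow> (k has_integral 0) {c..d}"
  shows "negligible {x \<in> {a..b}. k x \<noteq> 0}"
proof (cases "a \<le> b")
  case True
  have int: "k integrable_on cbox a b" using z[of a b] True by auto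
  have "((\<lambda>x. norm (k x)) has_integral 0) (cbox a b)"
    unfolding has_integral
  proof (intro allI impI)
    fix e :: real assume "e > 0"
    obtain \<gamma> where \<gamma>: "gauge \<gamma>" and le: "\<And>p. \<lbrakk>p tagged_partial_division_of (cbox a b); \<gamma> fine p\<rbrakk> \<Longrightarrow>
             (\<Sum>(x,K)\<in>p. norm (measure lborel K *\<^sub>R k x - integral K k)) < e"
      using Henstock_lemma[OF int \<open>e > 0\<close>] by blast
    have "norm ((\<Sum>(x, K)\<in>p. measure lborel K *\<^sub>R norm (k x)) - 0) < e"
      if p: "p tagged_division_of cbox a b" "\<gamma> fine p" for p
    proof -
      have "(\<Sum>(x, K)\<in>p. measure lborel K *\<^sub>R norm (k x)) = (\<Sum>(x,K)\<in>p. norm (measure lborel K *\<^sub>R k x - integral K k))"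
      proof (rule sum.cong[OF refl])
        fix xK assume xK: "xK \<in> p"
        obtain x K where [simp]: "xK = (x, K)" by (cases xK)
        obtain u v where uv: "K = cbox u v" "x \<in> K" "K \<subseteq> cbox a b"
          using tagged_division_ofD(2,3,4)[OF p(1), of x K] xK by auto
        then have "integral K k = 0"
          using z[of u v] by (intro integral_unique) auto
        then show "(case xK of (x, K) \<Rightarrow> measure lborel K *\<^sub>R norm (k x)) = (case xK of (x, K) \<Rightarrow> norm (measure lborel K *\<^sub>R k x - integral K k))"
          by simp
      qed
      also have "\<dots> < e" using p by (intro le) (auto simp: tagged_division_of_def)
      finally show ?thesis
        by (simp add: case_prod_unfold abs_of_nonneg sum_nonneg)
    qed
    then show "\<exists>\<gamma>. gauge \<gamma> \<and> (\<forall>\<D>. \<D> tagged_division_of cbox a b \<and> \<gamma> fine \<D> \<longrightarrow>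
        norm ((\<Sum>(x, K)\<in>\<D>. measure lborel K *\<^sub>R norm (k x)) - 0) < e)"
      using \<gamma> by blast
  qed
  then have "((\<lambda>x. if x \<in> {a..b} then norm (k x) else 0) has_integral 0) UNIV"
    by (simp only: has_integral_restrict_UNIV box_real)
  then have m: "(\<lambda>x. if x \<in> {a..b} then norm (k x) else 0) \<in> borel_measurable lebesgue"
    and i: "(\<integral>\<^sup>+x. ennreal (if x \<in> {a..b} then norm (k x) else 0) \<partial>lebesgue) = 0"
    by (subst (asm) has_integral_iff_nn_integral_lebesgue; auto)+
  have "AE x in lebesgue. ennreal (if x \<in> {a..b} then norm (k x) else 0) = 0"
    using i m by (subst (asm) nn_integral_0_iff_AE) auto
  then have "AE x in lebesgue. x \<notin> {x \<in> {a..b}. k x \<noteq> 0}"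
    by eventually_elim (auto split: if_splits)
  then show ?thesis
    unfolding eventually_ae_filter by (auto simp: negligible_iff_null_sets[symmetric] intro: negligible_subset)
qed auto

text \<open>
  Split \<open>G = |g|\<close> at a height \<open>n\<close>: by dominated convergence the part above \<open>n\<close> has integral below \<open>e/2\<close>
  for some \<open>n\<close>, and the part below \<open>n\<close> contributes at most \<open>n\<close> times the total length.
\<close>

lemma abs_cont_on_indefinite_integral:
  fixes g :: "real \<Rightarrow> complex"
  assumes g: "g absolutely_integrable_on {a..b}"
  shows "abs_cont_on {a..b} (\<lambda>x. integral {a..x} g)"
  unfolding abs_cont_on_def
proof (intro allI impI)
  fix e :: real assume "e > 0"
  define G where "G x = indicator {a..b} x * norm (g x)" for x
  have G: "integrable lebesgue G"
  proof -
    have "G = (\<lambda>x. norm (indicator {a..b} x *\<^sub>R g x))" by (auto simp: G_def fun_eq_iff indicator_def)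
    then show ?thesis using integrable_norm[OF g[unfolded set_integrable_def]] by simp
  qed
  have G0: "0 \<le> G x" for x by (simp add: G_def)
  have "(\<lambda>n. LINT x|lebesgue. (G x - min (G x) (real n))) \<longlonglongrightarrow> (LINT x::real|lebesgue. (0::real))"
  proof (rule Bochner_Integration.integral_dominated_convergence[where s="\<lambda>n x. G x - min (G x) (real n)" and f="\<lambda>_. 0" and w=G])
    show "AE x in lebesgue. (\<lambda>n. G x - min (G x) (real n)) \<longlonglongrightarrow> 0"
    proof (rule AE_I2)
      fix x
      obtain N :: nat where "G x \<le> real N" using real_arch_simple by blast
      then have "\<forall>\<^sub>F n in sequentially. G x - min (G x) (real n) = 0"
        unfolding eventually_sequentially by (intro exI[of _ N]) (auto simp: min_def)
      then show "(\<lambda>n. G x - min (G x) (real n)) \<longlonglongrightarrow> 0" by (rule tendsto_eventually)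
    qed
    show "AE x in lebesgue. norm (G x - min (G x) (real n)) \<le> G x" for n
      using G0 by (intro AE_I2) (auto simp: min_def)
  qed (use G in auto)
  then have "\<forall>\<^sub>F n in sequentially. (LINT x|lebesgue. (G x - min (G x) (real n))) < e / 2"
    using \<open>e > 0\<close> by (intro order_tendstoD) auto
  then obtain n :: nat where n: "(LINT x|lebesgue. (G x - min (G x) (real n))) < e / 2"
    by (auto simp: eventually_sequentially)
  have intm: "integrable lebesgue (\<lambda>x. G x - min (G x) (real n))"
    by (rule Bochner_Integration.integrable_bound[OF G]) (use G G0 in \<open>auto simp: min_def\<close>)
  show "\<exists>\<delta>>0. \<forall>I. finite I \<longrightarrow> (\<forall>(c, d)\<in>I. c < d \<and> {c..d} \<subseteq> {a..b}) \<longrightarrow>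
      disjoint_family_on (\<lambda>(c, d). {c<..<d}) I \<longrightarrow> (\<Sum>(c, d)\<in>I. d - c) < \<delta> \<longrightarrow>
      (\<Sum>(c, d)\<in>I. cmod (integral {a..d} g - integral {a..c} g)) < e"
  proof (rule exI[of _ "e / (2 * (real n + 1))"], intro conjI allI impI)
    show "0 < e / (2 * (real n + 1))" using \<open>e > 0\<close> by simp
    fix I :: "(real \<times> real) set"
    assume fin: "finite I" and I: "\<forall>(c, d)\<in>I. c < d \<and> {c..d} \<subseteq> {a..b}"
      and dis: "disjoint_family_on (\<lambda>(c, d). {c<..<d}) I" and small: "(\<Sum>(c, d)\<in>I. d - c) < e / (2 * (real n + 1))"
    have ID: "fst i < snd i" "a \<le> fst i" "snd i \<le> b" if "i \<in> I" for i
      using I that by force+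
    have single: "cmod (integral {a..snd i} g - integral {a..fst i} g) \<le> (LINT x|lebesgue. (indicator {fst i<..<snd i} x * G x))"
      if i: "i \<in> I" for i
    proof -
      have sub: "g absolutely_integrable_on S" if "S \<subseteq> {a..b}" "S \<in> sets lebesgue" for S
        using set_integrable_subset[OF g that(2,1)] .
      have s1: "g absolutely_integrable_on {fst i..snd i}" "g absolutely_integrable_on {fst i<..<snd i}"
        by (intro sub; use ID[OF i] in auto)+
      have "integral {a..fst i} g + integral {fst i..snd i} g = integral {a..snd i} g"
        using ID[OF i] by (intro Henstock_Kurzweil_Integration.integral_combine absolutely_integrable_on_def[THEN iffD1, THEN conjunct1] sub) auto
      then have "cmod (integral {a..snd i} g - integral {a..fst i} g) = cmod (integral {fst i..snd i} g)"
        by (metis add_diff_cancel_left')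
      also have "\<dots> = cmod (integral {fst i<..<snd i} g)"
        by (simp add: integral_open_interval_real)
      also have "\<dots> = cmod (LINT x:{fst i<..<snd i}|lebesgue. g x)"
        using set_lebesgue_integral_eq_integral(2)[OF s1(2)] by simp
      also have "\<dots> \<le> (LINT x:{fst i<..<snd i}|lebesgue. norm (g x))"
        using s1(2) by (rule set_integral_norm_bound)
      also have "\<dots> = (LINT x|lebesgue. (indicator {fst i<..<snd i} x * G x))"
        unfolding set_lebesgue_integral_def using ID[OF i]
        by (intro Bochner_Integration.integral_cong) (auto simp: G_def indicator_def)
      finally show ?thesis .
    qed
    have intG: "integrable lebesgue (\<lambda>x. indicator {fst i<..<snd i} x * G x)" for i :: "real \<times> real"
      using integrable_mult_indicator[OF _ G, of "{fst i<..<snd i}"] by simp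
    have inti: "integrable lebesgue (\<lambda>x. indicator {fst i<..<snd i} x :: real)" for i :: "real \<times> real"
      by (metis (no_types, lifting) box_real(1) integrable_indicator_iff fmeasurableD fmeasurableD2 lmeasurable_box integrable_real_indicator top.not_eq_extremum infinity_ennreal_def)
    let ?S = "\<lambda>x. \<Sum>i\<in>I. indicator {fst i<..<snd i} x :: real"
    have S1: "?S x \<le> 1" for x
    proof (cases "\<exists>i\<in>I. x \<in> {fst i<..<snd i}")
      case True
      then obtain i where i: "i \<in> I" "x \<in> {fst i<..<snd i}" by blast
      have "j \<in> I - {i} \<Longrightarrow> indicator {fst j<..<snd j} x = (0::real)" for j
        using dis i unfolding disjoint_family_on_def by (fastforce simp: indicator_def case_prod_unfold)
      then have "?S x = indicator {fst i<..<snd i} x"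
        using i(1) fin by (subst sum.remove[of _ i]) auto
      then show ?thesis by simp
    next
      case False
      then have "?S x = 0" by (intro sum.neutral) (auto simp: indicator_def)
      then show ?thesis by simp
    qed
    have "(\<Sum>(c, d)\<in>I. cmod (integral {a..d} g - integral {a..c} g)) \<le> (\<Sum>i\<in>I. LINT x|lebesgue. (indicator {fst i<..<snd i} x * G x))"
      unfolding case_prod_unfold by (intro sum_mono single)
    also have "\<dots> = (LINT x|lebesgue. (\<Sum>i\<in>I. indicator {fst i<..<snd i} x * G x))"
      using intG by (subst Bochner_Integration.integral_sum) auto
    also have "\<dots> \<le> (LINT x|lebesgue. ((G x - min (G x) (real n)) + real n * ?S x))"
    proof (rule integral_mono)
      show "integrable lebesgue (\<lambda>x. \<Sum>i\<in>I. indicator {fst i<..<snd i} x * G x)"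
        using intG by (intro Bochner_Integration.integrable_sum) auto
      show "integrable lebesgue (\<lambda>x. G x - min (G x) (real n) + real n * ?S x)"
        using inti intm by (intro Bochner_Integration.integrable_add integrable_mult_right Bochner_Integration.integrable_sum) auto
      fix x
      have "(\<Sum>i\<in>I. indicator {fst i<..<snd i} x * G x) = ?S x * G x" by (simp add: sum_distrib_right)
      also have "\<dots> \<le> ?S x * ((G x - min (G x) (real n)) + real n)"
        by (intro mult_left_mono sum_nonneg) (auto simp: min_def)
      also have "\<dots> = ?S x * (G x - min (G x) (real n)) + real n * ?S x" by (simp add: algebra_simps)
      also have "?S x * (G x - min (G x) (real n)) \<le> 1 * (G x - min (G x) (real n))"
        using S1 by (intro mult_right_mono) auto
      finally show "(\<Sum>i\<in>I. indicator {fst i<..<snd i} x * G x) \<le> G x - min (G x) (real n) + real n * ?S x" by simp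
    qed
    also have "\<dots> = (LINT x|lebesgue. (G x - min (G x) (real n))) + real n * (\<Sum>i\<in>I. LINT x|lebesgue. indicator {fst i<..<snd i} x)"
      using inti intm by (subst Bochner_Integration.integral_add) (auto intro!: Bochner_Integration.integrable_sum simp: Bochner_Integration.integral_sum)
    also have "(\<Sum>i\<in>I. LINT x|lebesgue. indicator {fst i<..<snd i} x) = (\<Sum>(c, d)\<in>I. d - c)"
      unfolding case_prod_unfold using ID by (intro sum.cong) (auto simp: less_imp_le)
    also have "real n * (\<Sum>(c, d)\<in>I. d - c) \<le> real n * (e / (2 * (real n + 1)))"
      using small by (intro mult_left_mono) auto
    also have "\<dots> \<le> e / 2" using \<open>e > 0\<close> by (simp add: field_simps)
    finally show "(\<Sum>(c, d)\<in>I. cmod (integral {a..d} g - integral {a..c} g)) < e"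
      using n by simp
  qed
qed

text \<open>
  The indefinite integral is absolutely continuous, so it has a derivative \<open>h\<close> almost everywhere and is
  also the indefinite integral of \<open>h\<close>. Thus \<open>h - g\<close> has integral \<open>0\<close> over every interval.
\<close>

theorem negligible_not_has_derivative_indefinite_integral:
  fixes g :: "real \<Rightarrow> complex"
  assumes g: "g absolutely_integrable_on {a..b}"
  shows "negligible {x \<in> {a<..<b}. \<not> ((\<lambda>x. integral {a..x} g) has_vector_derivative g x) (at x)}"
proof (cases "a \<le> b")
  case True
  define F where "F x = integral {a..x} g" for x
  define h where "h x = vector_derivative F (at x)" for x
  have ac: "abs_cont_on {a..b} F"
    unfolding F_def by (rule abs_cont_on_indefinite_integral[OF g])
  define N where "N = {x \<in> {a<..<b}. \<not> F differentiable (at x)} \<union> {a, b}"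
  have N: "negligible N"
    unfolding N_def using negligible_not_differentiable_abs_cont[OF ac] by simp
  have dF: "(F has_vector_derivative h x) (at x)" if "x \<in> {a..b} - N" for x
    using that unfolding h_def by (subst (asm) N_def) (auto simp: vector_derivative_works[symmetric])
  have zero: "((\<lambda>x. h x - g x) has_integral 0) {c..d}" if "a \<le> c" "c \<le> d" "d \<le> b" for c d
  proof -
    have "abs_cont_on {c..d} F"
      using that by (intro abs_cont_on_subset[OF ac]) auto
    then have "(h has_integral (F d - F c)) {c..d}"
      using that dF by (intro has_integral_abs_cont_derivative[OF _ _ N])
        (auto intro: has_vector_derivative_at_within)
    moreover have "g integrable_on {a..d}" "g integrable_on {c..d}"
      using that by (auto intro!: set_lebesgue_integral_eq_integral(1) set_integrable_subset[OF g])
    moreover from this have "F c + integral {c..d} g = F d"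
      unfolding F_def using that by (intro Henstock_Kurzweil_Integration.integral_combine) auto
    ultimately show ?thesis
      using has_integral_diff[of h "F d - F c" "{c..d}" g "integral {c..d} g"]
      by (simp add: algebra_simps has_integral_integral)
  qed
  have "negligible (N \<union> {x \<in> {a..b}. h x - g x \<noteq> 0})"
    using N negligible_nonzero_of_zero_integrals[OF zero] by simp
  moreover have "{x \<in> {a<..<b}. \<not> (F has_vector_derivative g x) (at x)} \<subseteq> N \<union> {x \<in> {a..b}. h x - g x \<noteq> 0}"
  proof (rule subsetI, rule ccontr)
    fix x assume x: "x \<in> {x \<in> {a<..<b}. \<not> (F has_vector_derivative g x) (at x)}"
      and nx: "x \<notin> N \<union> {x \<in> {a..b}. h x - g x \<noteq> 0}"
    then have "x \<in> {a..b} - N" "h x = g x" by auto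
    then show False using dF[of x] x by simp
  qed
  ultimately show ?thesis
    unfolding F_def[abs_def, symmetric] by (rule negligible_subset)
qed auto

section \<open>Lebesgue norms with extended exponents\<close>

text \<open>
  A norm of nonnegative real functions on an arbitrary measure space: \<open>Lnorm_on\<close> is the case of
  Lebesgue measure on a set and of the absolute value of weight times function.
\<close>

definition Lp_norm :: "'a measure \<Rightarrow> ennreal \<Rightarrow> ('a \<Rightarrow> real) \<Rightarrow> ennreal" where
  "Lp_norm M p h = (if p = \<infinity> then esssup M (\<lambda>x. ennreal (h x))
     else epow (\<integral>\<^sup>+x. ennreal (h x powr enn2real p) \<partial>M) (1 / enn2real p))"

lemma Lnorm_on_eq_Lp_norm: "Lnorm_on S p w f = Lp_norm (lebesgue_on S) p (\<lambda>x. cmod (of_real (w x) * f x))"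
  by (simp add: Lnorm_on_def Lp_norm_def)

lemma epow_le_iff:
  assumes "0 < s" "0 \<le> C"
  shows "epow t (1 / s) \<le> ennreal C \<longleftrightarrow> t \<le> ennreal (C powr s)"
proof (cases "t = \<infinity>")
  case False
  then obtain r where r: "t = ennreal r" "0 \<le> r" by (cases t) auto
  have "r powr (1 / s) \<le> C \<longleftrightarrow> r \<le> C powr s"
  proof
    assume "r powr (1 / s) \<le> C"
    then have "(r powr (1 / s)) powr s \<le> C powr s" using assms by (intro powr_mono2) auto
    then show "r \<le> C powr s" using r assms by (simp add: powr_powr)
  next
    assume "r \<le> C powr s"
    then have "r powr (1 / s) \<le> (C powr s) powr (1 / s)" using assms r by (intro powr_mono2) auto
    then show "r powr (1 / s) \<le> C" using assms by (simp add: powr_powr)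
  qed
  then show ?thesis using r assms by (simp add: epow_def ennreal_le_iff)
qed (simp add: epow_def top_unique)

lemma exponent_real:
  assumes "1 < p" "p \<noteq> (\<infinity>::ennreal)"
  shows "1 < enn2real p" "p = ennreal (enn2real p)"
proof -
  obtain r where r: "p = ennreal r" "0 \<le> r" using assms by (cases p) auto
  then show "p = ennreal (enn2real p)" by simp
  show "1 < enn2real p" using r assms(1) by (metis enn2real_ennreal ennreal_1 ennreal_less_iff zero_le_one)
qed

lemma Lp_norm_le_iff_finite:
  assumes "1 < p" "p \<noteq> \<infinity>" "0 \<le> C"
  shows "Lp_norm M p h \<le> ennreal C \<longleftrightarrow> (\<integral>\<^sup>+x. ennreal (h x powr enn2real p) \<partial>M) \<le> ennreal (C powr enn2real p)"
  unfolding Lp_norm_def using assms exponent_real[OF assms(1,2)] by (simp add: epow_le_iff)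

lemma Lp_norm_le_iff_infinite:
  assumes "h \<in> borel_measurable M" "0 \<le> C"
  shows "Lp_norm M \<infinity> h \<le> ennreal C \<longleftrightarrow> (AE x in M. h x \<le> C)"
proof
  assume *: "Lp_norm M \<infinity> h \<le> ennreal C"
  have "AE x in M. ennreal (h x) \<le> Lp_norm M \<infinity> h"
    unfolding Lp_norm_def using esssup_AE[of "\<lambda>x. ennreal (h x)" M] by simp
  then show "AE x in M. h x \<le> C"
  proof eventually_elim
    case (elim x)
    then have "ennreal (h x) \<le> ennreal C" using * by (rule order_trans)
    then show ?case using assms(2) by (simp add: ennreal_le_iff)
  qed
next
  assume *: "AE x in M. h x \<le> C"
  show "Lp_norm M \<infinity> h \<le> ennreal C"
    unfolding Lp_norm_def using assms *
    by (auto intro!: esssup_I elim!: eventually_mono intro: ennreal_leI)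
qed

lemma Lp_norm_mono_AE:
  assumes p: "1 < p" and h: "h \<in> borel_measurable M" and hk: "AE x in M. 0 \<le> h x \<and> h x \<le> k x"
  shows "Lp_norm M p h \<le> Lp_norm M p k"
proof (cases "p = \<infinity>")
  case True
  have "AE x in M. ennreal (h x) \<le> ennreal (k x)"
    using hk by eventually_elim (auto intro: ennreal_leI)
  then show ?thesis
    unfolding Lp_norm_def using True h by (auto intro!: esssup_AE_mono)
next
  case False
  show ?thesis
  proof (cases "Lp_norm M p k = \<infinity>")
    case fin: False
    then obtain C where C: "Lp_norm M p k = ennreal C" "0 \<le> C" by (cases "Lp_norm M p k") auto
    have "(\<integral>\<^sup>+x. ennreal (h x powr enn2real p) \<partial>M) \<le> (\<integral>\<^sup>+x. ennreal (k x powr enn2real p) \<partial>M)"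
    proof (rule nn_integral_mono_AE)
      show "AE x in M. ennreal (h x powr enn2real p) \<le> ennreal (k x powr enn2real p)"
        using hk by eventually_elim (auto intro!: ennreal_leI powr_mono2)
    qed
    also have "\<dots> \<le> ennreal (C powr enn2real p)"
      using C Lp_norm_le_iff_finite[OF p False C(2), of M k] by simp
    finally show ?thesis using C Lp_norm_le_iff_finite[OF p False C(2), of M h] by simp
  qed simp
qed

lemma Lp_norm_cong_AE:
  assumes p: "1 < p" and "h \<in> borel_measurable M" "k \<in> borel_measurable M" and hk: "AE x in M. 0 \<le> h x \<and> h x = k x"
  shows "Lp_norm M p h = Lp_norm M p k"
proof (rule antisym)
  have "AE x in M. 0 \<le> h x \<and> h x \<le> k x" using hk by eventually_elim auto
  then show "Lp_norm M p h \<le> Lp_norm M p k" using assms by (intro Lp_norm_mono_AE)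
  have "AE x in M. 0 \<le> k x \<and> k x \<le> h x" using hk by eventually_elim auto
  then show "Lp_norm M p k \<le> Lp_norm M p h" using assms by (intro Lp_norm_mono_AE)
qed

text \<open>
  Convexity of the power, applied to \<open>x + y = l (x / l) + (1 - l) (y / (1 - l))\<close>; integrated with
  \<open>l = A / (A + B)\<close> it becomes Minkowski's inequality.
\<close>

lemma powr_add_le_weighted:
  fixes x y l s :: real
  assumes "1 \<le> s" "0 \<le> x" "0 \<le> y" "0 < l" "l < 1"
  shows "(x + y) powr s \<le> l * (x / l) powr s + (1 - l) * (y / (1 - l)) powr s"
proof (cases "x = 0 \<or> y = 0")
  case False
  then have pos: "x / l \<in> {0<..}" "y / (1 - l) \<in> {0<..}" using assms by auto
  have "(l *\<^sub>R (x / l) + (1 - l) *\<^sub>R (y / (1 - l))) powr s \<le> l * (x / l) powr s + (1 - l) * (y / (1 - l)) powr s"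
    using convex_onD[OF powr_convex[OF assms(1)], of "1 - l" "x / l" "y / (1 - l)"] assms pos by simp
  then show ?thesis using assms by simp
next
  case True
  have *: "z powr s \<le> l' * (z / l') powr s" if "0 \<le> z" "0 < l'" "l' < 1" for z l'
  proof -
    have "z powr s = l' powr s * (z / l') powr s" using that by (simp add: powr_divide)
    also have "\<dots> \<le> l' powr 1 * (z / l') powr s"
      using that assms(1) by (intro mult_right_mono powr_mono') auto
    finally show ?thesis using that by simp
  qed
  show ?thesis using True *[of x l] *[of y "1 - l"] assms by auto
qed

lemma Lp_norm_add_le:
  assumes p: "1 < p" and [measurable]: "h \<in> borel_measurable M" "k \<in> borel_measurable M"
    and nn: "\<And>x. 0 \<le> h x" "\<And>x. 0 \<le> k x"
  shows "Lp_norm M p (\<lambda>x. h x + k x) \<le> Lp_norm M p h + Lp_norm M p k"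
proof (cases "Lp_norm M p h = \<infinity> \<or> Lp_norm M p k = \<infinity>")
  case False
  then obtain a b where ab: "Lp_norm M p h = ennreal a" "0 \<le> a" "Lp_norm M p k = ennreal b" "0 \<le> b"
    by (cases "Lp_norm M p h"; cases "Lp_norm M p k") auto
  show ?thesis
  proof (rule ennreal_le_epsilon)
    fix e :: real assume "0 < e"
    \<comment> \<open>Both norms are enlarged, so that the weight \<open>l = A / (A + B)\<close> lies strictly between \<open>0\<close> and \<open>1\<close>.\<close>
    define A B where "A = a + e / 2" and "B = b + e / 2"
    have AB: "0 < A" "0 < B" "Lp_norm M p h \<le> ennreal A" "Lp_norm M p k \<le> ennreal B"
      using ab \<open>0 < e\<close> by (auto simp: A_def B_def intro!: ennreal_leI)
    have "Lp_norm M p (\<lambda>x. h x + k x) \<le> ennreal (A + B)"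
    proof (cases "p = \<infinity>")
      case True
      then have "AE x in M. h x \<le> A" "AE x in M. k x \<le> B"
        using AB unfolding True by (subst Lp_norm_le_iff_infinite[symmetric]; auto)+
      then have "AE x in M. h x + k x \<le> A + B" by eventually_elim simp
      then show ?thesis using AB True by (subst True, subst Lp_norm_le_iff_infinite) auto
    next
      case False
      define s where "s = enn2real p"
      have s: "1 < s" using exponent_real[OF p False] by (simp add: s_def)
      define l where "l = A / (A + B)"
      have l: "0 < l" "l < 1" "A / l = A + B" "B / (1 - l) = A + B"
        using AB by (auto simp: l_def field_simps)
      have IA: "(\<integral>\<^sup>+x. ennreal (h x powr s) \<partial>M) \<le> ennreal (A powr s)"
        using AB Lp_norm_le_iff_finite[OF p False, of A M h] by (simp add: s_def)
      have IB: "(\<integral>\<^sup>+x. ennreal (k x powr s) \<partial>M) \<le> ennreal (B powr s)"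
        using AB Lp_norm_le_iff_finite[OF p False, of B M k] by (simp add: s_def)
      have "(\<integral>\<^sup>+x. ennreal ((h x + k x) powr s) \<partial>M)
        \<le> (\<integral>\<^sup>+x. ennreal (l / l powr s) * ennreal (h x powr s) + ennreal ((1 - l) / (1 - l) powr s) * ennreal (k x powr s) \<partial>M)"
      proof (rule nn_integral_mono)
        fix x
        have "(h x + k x) powr s \<le> l * (h x / l) powr s + (1 - l) * (k x / (1 - l)) powr s"
          using s nn l by (intro powr_add_le_weighted) auto
        also have "\<dots> = l / l powr s * (h x powr s) + (1 - l) / (1 - l) powr s * (k x powr s)"
          using nn l by (simp add: powr_divide)
        finally have "ennreal ((h x + k x) powr s) \<le> ennreal (l / l powr s * (h x powr s) + (1 - l) / (1 - l) powr s * (k x powr s))"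
          by (rule ennreal_leI)
        also have "\<dots> = ennreal (l / l powr s) * ennreal (h x powr s) + ennreal ((1 - l) / (1 - l) powr s) * ennreal (k x powr s)"
          using l by (subst ennreal_plus) (auto simp: ennreal_mult[symmetric])
        finally show "ennreal ((h x + k x) powr s) \<le> \<dots>" .
      qed
      also have "\<dots> = ennreal (l / l powr s) * (\<integral>\<^sup>+x. ennreal (h x powr s) \<partial>M) + ennreal ((1 - l) / (1 - l) powr s) * (\<integral>\<^sup>+x. ennreal (k x powr s) \<partial>M)"
        by (subst nn_integral_add) (auto simp: nn_integral_cmult)
      also have "\<dots> \<le> ennreal (l / l powr s) * ennreal (A powr s) + ennreal ((1 - l) / (1 - l) powr s) * ennreal (B powr s)"
        by (intro add_mono mult_left_mono IA IB) auto
      also have "\<dots> = ennreal (l * (A / l) powr s + (1 - l) * (B / (1 - l)) powr s)"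
      proof -
        have "l / l powr s * A powr s = l * (A / l) powr s" "(1 - l) / (1 - l) powr s * B powr s = (1 - l) * (B / (1 - l)) powr s"
          using l(1,2) AB(1,2) by (simp_all add: powr_divide)
        moreover have "0 \<le> l / l powr s * A powr s" "0 \<le> (1 - l) / (1 - l) powr s * B powr s" using l(1,2) by auto
        ultimately show ?thesis
          using l(1,2) by (simp add: ennreal_mult[symmetric] ennreal_plus[symmetric] del: ennreal_plus)
      qed
      also have "l * (A / l) powr s + (1 - l) * (B / (1 - l)) powr s = (A + B) powr s"
        unfolding l(3,4) by (simp add: algebra_simps)
      finally show ?thesis
        using AB by (subst Lp_norm_le_iff_finite[OF p False]) (auto simp: s_def)
    qed
    also have "ennreal (A + B) = Lp_norm M p h + Lp_norm M p k + ennreal e"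
      using ab \<open>0 < e\<close> by (simp add: A_def B_def flip: ennreal_plus)
    finally show "Lp_norm M p (\<lambda>x. h x + k x) \<le> Lp_norm M p h + Lp_norm M p k + ennreal e" .
  qed
qed auto

lemma Lp_norm_zero: "1 < p \<Longrightarrow> Lp_norm M p (\<lambda>x. 0) = 0"
  using Lp_norm_le_iff_finite[of p 0 M "\<lambda>_. 0"] Lp_norm_le_iff_infinite[of "\<lambda>_. 0" M 0]
  by (cases "p = \<infinity>") auto

lemma Lp_norm_cmult_le:
  assumes p: "1 < p" and [measurable]: "h \<in> borel_measurable M" and nn: "\<And>x. 0 \<le> h x" and "0 \<le> c"
  shows "Lp_norm M p (\<lambda>x. c * h x) \<le> ennreal c * Lp_norm M p h"
proof (cases "c = 0")
  case True
  then show ?thesis using Lp_norm_zero[OF p] by simp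
next
  case False
  then have "0 < c" using assms by simp
  show ?thesis
  proof (cases "Lp_norm M p h")
    case (real a)
    have "Lp_norm M p (\<lambda>x. c * h x) \<le> ennreal (c * a)"
    proof (cases "p = \<infinity>")
      case True
      have "AE x in M. h x \<le> a" using real True by (subst Lp_norm_le_iff_infinite[symmetric]) auto
      then have "AE x in M. c * h x \<le> c * a" using \<open>0 < c\<close> by (auto elim!: eventually_mono)
      then show ?thesis unfolding True using \<open>0 < c\<close> real by (subst Lp_norm_le_iff_infinite) auto
    next
      case pf: False
      have "(\<integral>\<^sup>+x. ennreal ((c * h x) powr enn2real p) \<partial>M) = ennreal (c powr enn2real p) * (\<integral>\<^sup>+x. ennreal (h x powr enn2real p) \<partial>M)"
        using nn \<open>0 < c\<close> by (subst nn_integral_cmult[symmetric]) (auto simp: powr_mult ennreal_mult)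
      also have "\<dots> \<le> ennreal (c powr enn2real p) * ennreal (a powr enn2real p)"
        using real Lp_norm_le_iff_finite[OF p pf, of a M h] by (intro mult_left_mono) auto
      also have "\<dots> = ennreal ((c * a) powr enn2real p)"
        using \<open>0 < c\<close> real by (simp add: powr_mult ennreal_mult)
      finally show ?thesis using \<open>0 < c\<close> real by (subst Lp_norm_le_iff_finite[OF p pf]) auto
    qed
    then show ?thesis using real \<open>0 < c\<close> by (simp add: ennreal_mult)
  next
    case top
    then show ?thesis using \<open>0 < c\<close> by (simp add: ennreal_mult_top)
  qed
qed

lemma Lp_norm_cmult:
  assumes p: "1 < p" and [measurable]: "h \<in> borel_measurable M" and nn: "\<And>x. 0 \<le> h x" and "0 \<le> c"
  shows "Lp_norm M p (\<lambda>x. c * h x) = ennreal c * Lp_norm M p h"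
proof (cases "c = 0")
  case True
  then show ?thesis using Lp_norm_zero[OF p] by simp
next
  case False
  then have c: "0 < c" using assms by simp
  have "ennreal c * Lp_norm M p h = ennreal c * Lp_norm M p (\<lambda>x. (1 / c) * (c * h x))" using c by simp
  also have "\<dots> \<le> ennreal c * (ennreal (1 / c) * Lp_norm M p (\<lambda>x. c * h x))"
    using c nn by (intro mult_left_mono Lp_norm_cmult_le p) auto
  also have "\<dots> = Lp_norm M p (\<lambda>x. c * h x)"
    using c by (simp add: mult.assoc[symmetric] ennreal_mult[symmetric])
  finally show ?thesis using Lp_norm_cmult_le[OF p assms(2) nn assms(4)] by (simp add: antisym)
qed

lemma conj_exp_ge_1:
  assumes "1 < p" shows "1 \<le> conj_exp p"
  using exponent_real(1)[OF assms] by (cases "p = \<infinity>") (auto simp: conj_exp_def field_simps)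

lemma conj_exp_conjugate:
  assumes "1 < p" "p \<noteq> \<infinity>"
  shows "1 < conj_exp p" "1 / enn2real p + 1 / conj_exp p = 1" "(conj_exp p - 1) * enn2real p = conj_exp p"
  using exponent_real(1)[OF assms] assms by (auto simp: conj_exp_def field_simps)

text \<open>
  The second factor enters through the bare integral of its power, which is meaningful for \<open>p = \<infinity>\<close> as
  well, where the conjugate exponent is \<open>1\<close>. For finite \<open>p\<close> integrate Young's inequality for \<open>h / A\<close> and \<open>k / B\<close>.
\<close>

lemma Hoelder_le:
  assumes p: "1 < p" and [measurable]: "h \<in> borel_measurable M" "k \<in> borel_measurable M"
    and nn: "\<And>x. 0 \<le> h x" "\<And>x. 0 \<le> k x"
    and A: "Lp_norm M p h \<le> ennreal A" "0 < A"
    and B: "(\<integral>\<^sup>+x. ennreal (k x powr conj_exp p) \<partial>M) \<le> ennreal (B powr conj_exp p)" "0 < B"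
  shows "(\<integral>\<^sup>+x. ennreal (h x * k x) \<partial>M) \<le> ennreal (A * B)"
proof (cases "p = \<infinity>")
  case True
  have "AE x in M. h x \<le> A" using A True by (subst Lp_norm_le_iff_infinite[symmetric]) auto
  then have "(\<integral>\<^sup>+x. ennreal (h x * k x) \<partial>M) \<le> (\<integral>\<^sup>+x. ennreal A * ennreal (k x) \<partial>M)"
    using A(2) nn by (intro nn_integral_mono_AE) (auto elim!: eventually_mono simp: ennreal_mult[symmetric] intro!: ennreal_leI mult_right_mono)
  also have "\<dots> = ennreal A * (\<integral>\<^sup>+x. ennreal (k x) \<partial>M)" by (simp add: nn_integral_cmult)
  also have "\<dots> \<le> ennreal A * ennreal B"
    using B True nn by (intro mult_left_mono) (auto simp: conj_exp_def)
  finally show ?thesis using A B by (simp add: ennreal_mult)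
next
  case False
  define s c where "s = enn2real p" and "c = conj_exp p"
  have sc: "1 < s" "1 < c" "1 / s + 1 / c = 1"
    using exponent_real[OF p False] conj_exp_conjugate[OF p False] by (auto simp: s_def c_def)
  have IA: "(\<integral>\<^sup>+x. ennreal (h x powr s) \<partial>M) \<le> ennreal (A powr s)"
    using A Lp_norm_le_iff_finite[OF p False, of A M h] by (simp add: s_def)
  have young: "x * y \<le> x powr s / s + y powr c / c" if "0 \<le> x" "0 \<le> y" for x y
    using that Youngs_inequality[of s c x y] sc by (auto)
  have "(\<integral>\<^sup>+x. ennreal (h x * k x) \<partial>M)
    \<le> (\<integral>\<^sup>+x. ennreal (A * B / (s * A powr s)) * ennreal (h x powr s) + ennreal (A * B / (c * B powr c)) * ennreal (k x powr c) \<partial>M)"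
  proof (rule nn_integral_mono)
    fix x
    have "h x * k x = A * B * ((h x / A) * (k x / B))" using A B by simp
    also have "\<dots> \<le> A * B * ((h x / A) powr s / s + (k x / B) powr c / c)"
      using A B nn by (intro mult_left_mono young) auto
    also have "\<dots> = A * B / (s * A powr s) * (h x powr s) + A * B / (c * B powr c) * (k x powr c)"
      using A B nn by (simp add: powr_divide field_simps)
    finally have "ennreal (h x * k x) \<le> ennreal (A * B / (s * A powr s) * (h x powr s) + A * B / (c * B powr c) * (k x powr c))"
      by (rule ennreal_leI)
    also have "\<dots> = ennreal (A * B / (s * A powr s)) * ennreal (h x powr s) + ennreal (A * B / (c * B powr c)) * ennreal (k x powr c)"
      using A B sc by (subst ennreal_plus) (auto simp: ennreal_mult[symmetric])
    finally show "ennreal (h x * k x) \<le> \<dots>" .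
  qed
  also have "\<dots> = ennreal (A * B / (s * A powr s)) * (\<integral>\<^sup>+x. ennreal (h x powr s) \<partial>M) + ennreal (A * B / (c * B powr c)) * (\<integral>\<^sup>+x. ennreal (k x powr c) \<partial>M)"
    by (subst nn_integral_add) (auto simp: nn_integral_cmult)
  also have "\<dots> \<le> ennreal (A * B / (s * A powr s)) * ennreal (A powr s) + ennreal (A * B / (c * B powr c)) * ennreal (B powr c)"
    using IA B by (intro add_mono mult_left_mono) (auto simp: c_def)
  also have "\<dots> = ennreal (A * B / (s * A powr s) * (A powr s) + A * B / (c * B powr c) * (B powr c))"
    using A B sc by (subst ennreal_plus) (auto simp: ennreal_mult[symmetric])
  also have "A * B / (s * A powr s) * (A powr s) + A * B / (c * B powr c) * (B powr c) = A * B * (1 / s + 1 / c)"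
    using A B sc by (simp add: field_simps)
  also have "\<dots> = A * B" using sc by simp
  finally show ?thesis .
qed

section \<open>Bounding coefficients of polynomials in a doubling weight\<close>

text \<open>
  With \<open>zs\<close> the roots of a monic polynomial \<open>q\<close>, this dominates \<open>|q|\<close> on the circle of radius \<open>t\<close>. It is
  increasing in \<open>t\<close> and dominates each single monomial of \<open>q\<close>.
\<close>

definition majorant :: "complex list \<Rightarrow> real \<Rightarrow> real" where
  "majorant zs t = (\<Prod>z\<leftarrow>zs. t + cmod z)"

lemma majorant_Cons: "majorant (z # zs) t = (t + cmod z) * majorant zs t"
  by (simp add: majorant_def)

lemma majorant_nonneg: "0 \<le> t \<Longrightarrow> 0 \<le> majorant zs t"
  unfolding majorant_def by (induction zs) auto

lemma coeff_le_majorant: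
  assumes "0 \<le> t"
  shows "cmod (coeff (\<Prod>z\<leftarrow>zs. [:-z, 1:]) k) * t ^ k \<le> majorant zs t"
proof (induction zs arbitrary: k)
  case Nil
  then show ?case by (cases k) (auto simp: majorant_def)
next
  case (Cons z zs)
  let ?q = "\<Prod>z\<leftarrow>zs. [:-z, 1:]"
  have "cmod (coeff ([:-z, 1:] * ?q) k) * t ^ k \<le> cmod z * (cmod (coeff ?q k) * t ^ k) + t * majorant zs t"
  proof (cases k)
    case 0
    then show ?thesis using assms majorant_nonneg[OF assms, of zs] by (simp add: norm_mult)
  next
    case (Suc j)
    have "cmod (coeff ([:-z, 1:] * ?q) k) * t ^ k \<le> (cmod z * cmod (coeff ?q k) + cmod (coeff ?q j)) * t ^ k"
      using assms Suc norm_triangle_ineq[of "- z * coeff ?q k" "coeff ?q j"]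
      by (intro mult_right_mono) (auto simp: norm_mult)
    also have "\<dots> = cmod z * (cmod (coeff ?q k) * t ^ k) + t * (cmod (coeff ?q j) * t ^ j)"
      by (simp add: Suc algebra_simps)
    also have "\<dots> \<le> cmod z * (cmod (coeff ?q k) * t ^ k) + t * majorant zs t"
      using assms by (intro add_left_mono mult_left_mono Cons.IH)
    finally show ?thesis .
  qed
  also have "\<dots> \<le> cmod z * majorant zs t + t * majorant zs t"
    by (intro add_right_mono mult_left_mono Cons.IH) auto
  finally show ?case by (simp add: majorant_def algebra_simps)
qed

text \<open>
  If \<open>t\<close> is at most half or at least twice \<open>|z|\<close>, then \<open>t + |z| \<le> 3 |t - |z||\<close>, and \<open>|t - |z|| \<le> |t - z|\<close>.
\<close>

lemma majorant_le_poly: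
  assumes "0 \<le> t" and "\<And>z. z \<in> set zs \<Longrightarrow> t \<le> cmod z / 2 \<or> 2 * cmod z \<le> t"
  shows "majorant zs t \<le> 3 ^ length zs * cmod (poly (\<Prod>z\<leftarrow>zs. [:-z, 1:]) (of_real t))"
  using assms(2)
proof (induction zs)
  case (Cons z zs)
  have "t + cmod z \<le> 3 * cmod (of_real t - z)"
  proof -
    have "t \<le> cmod z / 2 \<or> 2 * cmod z \<le> t" using Cons.prems by simp
    moreover have "t - cmod z \<le> cmod (of_real t - z)"
      using norm_triangle_ineq2[of "of_real t" z] assms(1) by simp
    moreover have "cmod z - t \<le> cmod (of_real t - z)"
      using norm_triangle_ineq3[of "of_real t" z] assms(1) by simp
    ultimately show ?thesis by linarith
  qed
  moreover have "majorant zs t \<le> 3 ^ length zs * cmod (poly (\<Prod>z\<leftarrow>zs. [:-z, 1:]) (of_real t))"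
    using Cons by simp
  ultimately have "(t + cmod z) * majorant zs t \<le> (3 * cmod (of_real t - z)) * (3 ^ length zs * cmod (poly (\<Prod>z\<leftarrow>zs. [:-z, 1:]) (of_real t)))"
    using assms(1) majorant_nonneg by (intro mult_mono) auto
  moreover have "poly (\<Prod>z\<leftarrow>z # zs. [:-z, 1:]) (of_real t) = (of_real t - z) * poly (\<Prod>z\<leftarrow>zs. [:-z, 1:]) (of_real t)"
    by (simp add: left_diff_distrib)
  ultimately show ?case
    by (simp only: majorant_Cons norm_mult length_Cons power_Suc mult_ac)
qed (simp add: majorant_def)

lemma majorant_growth_le:
  assumes "0 < s" "s \<le> t"
  shows "majorant zs t \<le> (t / s) ^ length zs * majorant zs s"
proof (induction zs)
  case (Cons z zs)
  have "t + cmod z \<le> t / s * (s + cmod z)"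
  proof -
    have "1 \<le> t / s" using assms by simp
    then have "cmod z \<le> t / s * cmod z" using mult_right_mono[of 1 "t / s" "cmod z"] by simp
    then show ?thesis using assms by (simp add: distrib_left)
  qed
  then have "(t + cmod z) * majorant zs t \<le> (t / s * (s + cmod z)) * ((t / s) ^ length zs * majorant zs s)"
    using assms Cons.IH majorant_nonneg[of t zs] by (intro mult_mono) auto
  then show ?case by (simp only: majorant_Cons length_Cons power_Suc mult_ac)
qed (simp add: majorant_def)

text \<open>
  A product of \<open>n + 1\<close> factors grows at most like \<open>(t / s)\<^sup>n\<^sup>+\<^sup>1\<close>. One power is saved here: as long as
  \<open>t \<le> 2 |z|\<close>, the factor \<open>t + |z|\<close> belonging to the root \<open>z\<close> grows only by the constant \<open>3\<close>. This is why
  a doubling condition for \<open>t\<^sup>n\<close> controls polynomials of degree \<open>n + 1\<close>.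
\<close>

lemma majorant_growth_below_root:
  assumes z: "z \<in> set zs" and st: "0 < s" "s \<le> t" "t \<le> 2 * cmod z" and L: "length zs \<le> Suc n"
  shows "majorant zs t \<le> 3 * (t / s) ^ n * majorant zs s"
proof -
  obtain xs ys where zs: "zs = xs @ z # ys" using z by (meson split_list)
  have eq: "majorant zs x = (x + cmod z) * majorant (xs @ ys) x" for x
    by (simp add: zs majorant_def)
  have "t + cmod z \<le> 3 * (s + cmod z)" using st by simp
  moreover have "majorant (xs @ ys) t \<le> (t / s) ^ n * majorant (xs @ ys) s"
  proof -
    have "majorant (xs @ ys) t \<le> (t / s) ^ length (xs @ ys) * majorant (xs @ ys) s"
      using st by (intro majorant_growth_le)
    also have "\<dots> \<le> (t / s) ^ n * majorant (xs @ ys) s"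
      using st L majorant_nonneg[of s "xs @ ys"] by (intro mult_right_mono power_increasing) (auto simp: zs)
    finally show ?thesis .
  qed
  ultimately have "(t + cmod z) * majorant (xs @ ys) t \<le> (3 * (s + cmod z)) * ((t / s) ^ n * majorant (xs @ ys) s)"
    using st majorant_nonneg[of t "xs @ ys"] by (intro mult_mono) auto
  then show ?thesis unfolding eq by (simp add: algebra_simps)
qed

definition wint :: "(real \<Rightarrow> real) \<Rightarrow> (real \<Rightarrow> real) \<Rightarrow> real set \<Rightarrow> ennreal" where
  "wint W f S = (\<integral>\<^sup>+x. ennreal (f x * W x) * indicator S x \<partial>lebesgue)"

locale doubling_weight =
  fixes W :: "real \<Rightarrow> real" and c :: real and n :: nat and D :: real
  assumes W_meas [measurable]: "W \<in> borel_measurable lebesgue" and W_nonneg: "\<And>x. 0 \<le> W x"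
    and c: "0 < c"
    and W_fin: "\<And>r. 0 < r \<Longrightarrow> wint W (\<lambda>t. t powr (real n * c)) {0<..<r} < \<infinity>"
    and W_pos: "\<And>r. 0 < r \<Longrightarrow> 0 < wint W (\<lambda>t. t powr (real n * c)) {0<..<r}"
    and doubling: "\<And>r. 0 < r \<Longrightarrow> wint W (\<lambda>t. t powr (real n * c)) {0<..<2 * r} \<le> ennreal D * wint W (\<lambda>t. t powr (real n * c)) {0<..<r}"
begin

lemma wint_mono: "(\<And>x. x \<in> S \<Longrightarrow> f x \<le> g x) \<Longrightarrow> S \<subseteq> T \<Longrightarrow> wint W f S \<le> wint W g T"
  unfolding wint_def using W_nonneg
  by (intro nn_integral_mono) (auto simp: indicator_def intro!: ennreal_leI mult_right_mono)

lemma wint_Un_le: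
  assumes [measurable]: "f \<in> borel_measurable lebesgue" "S \<in> sets lebesgue" "T \<in> sets lebesgue"
  shows "wint W f (S \<union> T) \<le> wint W f S + wint W f T"
proof -
  have "wint W f (S \<union> T) \<le> (\<integral>\<^sup>+x. ennreal (f x * W x) * indicator S x + ennreal (f x * W x) * indicator T x \<partial>lebesgue)"
    unfolding wint_def by (intro nn_integral_mono) (auto simp: indicator_def)
  also have "\<dots> = wint W f S + wint W f T"
    unfolding wint_def by (intro nn_integral_add) measurable
  finally show ?thesis .
qed

lemma wint_cmult:
  assumes [measurable]: "f \<in> borel_measurable lebesgue" "S \<in> sets lebesgue" and "0 \<le> a"
  shows "wint W (\<lambda>x. a * f x) S = ennreal a * wint W f S"
proof -
  have "wint W (\<lambda>x. a * f x) S = (\<integral>\<^sup>+x. ennreal a * (ennreal (f x * W x) * indicator S x) \<partial>lebesgue)"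
    unfolding wint_def using assms(3)
    by (intro nn_integral_cong) (simp add: mult.assoc[symmetric] ennreal_mult'[symmetric])
  also have "\<dots> = ennreal a * wint W f S"
    unfolding wint_def by (intro nn_integral_cmult) measurable
  finally show ?thesis .
qed

lemma majorant_measurable [measurable]: "majorant zs \<in> borel_measurable lebesgue"
  by (rule measurable_completion) (simp add: majorant_def[abs_def], induction zs; simp)

lemma powr_measurable' [measurable]: "(\<lambda>t::real. t powr a) \<in> borel_measurable lebesgue"
  by (rule measurable_completion) simp

text \<open>
  Let \<open>a = |z| / 2\<close>. The growth estimate compares the majorant at every \<open>t\<close> in the annulus \<open>[a, 4a)\<close> with
  the majorant at every \<open>s < a\<close>. Integrating the cross-multiplied inequality in both variables against
  the weight leaves the ratio of the integrals of \<open>t\<^sup>n\<^sup>c W\<close> over \<open>(0, 4a)\<close> and \<open>(0, a)\<close>, which is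
  bounded by applying the doubling condition twice.
\<close>

lemma wint_annulus_le:
  assumes z: "z \<in> set zs" "z \<noteq> 0" and L: "length zs \<le> Suc n"
  shows "wint W (\<lambda>t. majorant zs t powr c) {cmod z / 2..<2 * cmod z}
    \<le> ennreal (3 powr c * (max 1 D)\<^sup>2) * wint W (\<lambda>t. majorant zs t powr c) {0<..<cmod z / 2}"
proof -
  define a where "a = cmod z / 2"
  have a: "0 < a" using z by (simp add: a_def)
  define \<nu> where "\<nu> r = wint W (\<lambda>t. t powr (real n * c)) {0<..<r}" for r
  define G where "G t = majorant zs t powr c" for t
  have Gm [measurable]: "G \<in> borel_measurable lebesgue" unfolding G_def[abs_def] by measurable
  have G0: "0 \<le> G t" for t by (simp add: G_def)
  have pw: "G t * s powr (real n * c) \<le> 3 powr c * t powr (real n * c) * G s"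
    if "s \<in> {0<..<a}" "t \<in> {a..<4 * a}" for s t
  proof -
    have st: "0 < s" "s \<le> t" "t \<le> 2 * cmod z" "0 < t" using that a by (auto simp: a_def)
    have "majorant zs t powr c \<le> (3 * (t / s) ^ n * majorant zs s) powr c"
      using majorant_growth_below_root[OF z(1) st(1,2,3) L] c majorant_nonneg[of t zs] st
      by (intro powr_mono2) auto
    also have "\<dots> = 3 powr c * (t powr (real n * c) / s powr (real n * c)) * majorant zs s powr c"
      using st majorant_nonneg[of s zs]
      by (simp add: powr_mult powr_divide powr_powr powr_realpow[symmetric])
    finally show ?thesis using st by (simp add: G_def field_simps)
  qed
  have fin: "\<nu> r < \<infinity>" "0 < \<nu> r" if "0 < r" for r using W_fin[OF that] W_pos[OF that] by (auto simp: \<nu>_def)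
  have step1: "ennreal (G t) * \<nu> a \<le> ennreal (3 powr c * t powr (real n * c)) * wint W G {0<..<a}"
    if t: "t \<in> {a..<4 * a}" for t
  proof -
    have "ennreal (G t) * \<nu> a = wint W (\<lambda>s. G t * s powr (real n * c)) {0<..<a}"
      unfolding \<nu>_def by (subst wint_cmult) (auto simp: G0)
    also have "\<dots> \<le> wint W (\<lambda>s. 3 powr c * t powr (real n * c) * G s) {0<..<a}"
      by (rule wint_mono) (use pw t in auto)
    also have "\<dots> = ennreal (3 powr c * t powr (real n * c)) * wint W G {0<..<a}"
      by (rule wint_cmult) auto
    finally show ?thesis .
  qed
  have "wint W G {a..<4 * a} * \<nu> a = (\<integral>\<^sup>+t. (ennreal (G t * W t) * indicator {a..<4 * a} t) * \<nu> a \<partial>lebesgue)"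
    unfolding wint_def
    by (subst nn_integral_multc) (auto intro!: borel_measurable_times_ennreal borel_measurable_indicator)
  also have "\<dots> \<le> (\<integral>\<^sup>+t. (ennreal (3 powr c) * wint W G {0<..<a}) * (ennreal (t powr (real n * c) * W t) * indicator {0<..<4 * a} t) \<partial>lebesgue)"
  proof (rule nn_integral_mono)
    fix t
    show "(ennreal (G t * W t) * indicator {a..<4 * a} t) * \<nu> a
      \<le> (ennreal (3 powr c) * wint W G {0<..<a}) * (ennreal (t powr (real n * c) * W t) * indicator {0<..<4 * a} t)"
    proof (cases "t \<in> {a..<4 * a}")
      case True
      have "(ennreal (G t * W t) * indicator {a..<4 * a} t) * \<nu> a = (ennreal (G t) * \<nu> a) * ennreal (W t)"
        using True G0 W_nonneg by (simp add: ennreal_mult mult_ac)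
      also have "\<dots> \<le> (ennreal (3 powr c * t powr (real n * c)) * wint W G {0<..<a}) * ennreal (W t)"
        using step1[OF True] by (intro mult_right_mono) auto
      also have "\<dots> = (ennreal (3 powr c) * wint W G {0<..<a}) * (ennreal (t powr (real n * c) * W t) * indicator {0<..<4 * a} t)"
        using True a W_nonneg by (simp add: ennreal_mult mult_ac)
      finally show ?thesis .
    qed simp
  qed
  also have "\<dots> = (ennreal (3 powr c) * wint W G {0<..<a}) * \<nu> (4 * a)"
    unfolding \<nu>_def wint_def
    by (subst nn_integral_cmult) (auto intro!: borel_measurable_times_ennreal borel_measurable_indicator)
  also have "\<dots> \<le> (ennreal (3 powr c) * wint W G {0<..<a}) * (ennreal ((max 1 D)\<^sup>2) * \<nu> a)"
  proof (rule mult_left_mono)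
    have D': "\<nu> (2 * r) \<le> ennreal (max 1 D) * \<nu> r" if "0 < r" for r
      using doubling[OF that] unfolding \<nu>_def
      by (rule order_trans) (intro mult_right_mono ennreal_leI, auto)
    have "\<nu> (4 * a) \<le> ennreal (max 1 D) * \<nu> (2 * a)" using D'[of "2 * a"] a by simp
    also have "\<dots> \<le> ennreal (max 1 D) * (ennreal (max 1 D) * \<nu> a)" using D'[of a] a by (intro mult_left_mono) auto
    also have "\<dots> = ennreal ((max 1 D)\<^sup>2) * \<nu> a" by (simp add: power2_eq_square ennreal_mult mult.assoc)
    finally show "\<nu> (4 * a) \<le> ennreal ((max 1 D)\<^sup>2) * \<nu> a" .
  qed simp
  also have "\<dots> = (ennreal (3 powr c * (max 1 D)\<^sup>2) * wint W G {0<..<a}) * \<nu> a"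
    by (simp add: ennreal_mult mult_ac)
  finally have "wint W G {a..<4 * a} * \<nu> a \<le> (ennreal (3 powr c * (max 1 D)\<^sup>2) * wint W G {0<..<a}) * \<nu> a" .
  then have "wint W G {a..<4 * a} \<le> ennreal (3 powr c * (max 1 D)\<^sup>2) * wint W G {0<..<a}"
    using fin[OF a] ennreal_mult_le_mult_iff[of "\<nu> a"] by (simp add: mult.commute[of _ "\<nu> a"] less_top)
  then show ?thesis by (simp add: G_def[abs_def] a_def)
qed

text \<open>
  The constant obtained when the annuli are removed one after the other: if removing \<open>m\<close> of them costs
  the factor \<open>e\<close>, then one more costs a factor \<open>1 + C e\<close>.
\<close>

fun annuli_const :: "real \<Rightarrow> nat \<Rightarrow> real" where
  "annuli_const C 0 = 1"
| "annuli_const C (Suc m) = annuli_const C m * (1 + C * annuli_const C m)"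

lemma annuli_const_ge_1: "0 \<le> C \<Longrightarrow> 1 \<le> annuli_const C m"
proof (induction m)
  case (Suc m)
  have "1 * 1 \<le> annuli_const C m * (1 + C * annuli_const C m)"
    using Suc by (intro mult_mono) auto
  then show ?case by simp
qed simp

lemma annuli_const_mono: "0 \<le> C \<Longrightarrow> m \<le> m' \<Longrightarrow> annuli_const C m \<le> annuli_const C m'"
proof (rule lift_Suc_mono_le[of "annuli_const C"])
  fix m assume "0 \<le> C"
  have "annuli_const C m * 1 \<le> annuli_const C m * (1 + C * annuli_const C m)"
    using annuli_const_ge_1[OF \<open>0 \<le> C\<close>, of m] \<open>0 \<le> C\<close> by (intro mult_left_mono) auto
  then show "annuli_const C m \<le> annuli_const C (Suc m)" by simp
qed

text \<open>
  An annulus around \<open>|z|\<close> carries at most \<open>C\<close> times the integral over \<open>(0, |z| / 2)\<close>. By the induction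
  hypothesis on that smaller interval, this is at most \<open>C e\<close> times the integral over its part outside the
  annuli removed before, and this part also avoids the new annulus, since it lies to its left. Intervals
  of all lengths \<open>r\<close> therefore have to be treated simultaneously.
\<close>

lemma wint_outside_annuli:
  assumes L: "length zs \<le> Suc n" and Y: "finite Y" "Y \<subseteq> set zs" and "0 < r"
  shows "wint W (\<lambda>t. majorant zs t powr c) {0<..<r}
    \<le> ennreal (annuli_const (3 powr c * (max 1 D)\<^sup>2) (card Y)) *
       wint W (\<lambda>t. majorant zs t powr c) ({0<..<r} - (\<Union>z\<in>Y. {cmod z / 2..<2 * cmod z}))"
  using Y \<open>0 < r\<close>
proof (induction arbitrary: r rule: finite_induct)
  case (insert z Y)
  define C where "C = 3 powr c * (max 1 D)\<^sup>2"
  define e where "e = annuli_const C (card Y)"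
  define A where "A z = {cmod z / 2..<2 * cmod z}" for z
  define \<kappa> where "\<kappa> = wint W (\<lambda>t. majorant zs t powr c)"
  have C: "0 \<le> C" by (simp add: C_def)
  have e: "1 \<le> e" using annuli_const_ge_1[OF C] by (simp add: e_def)
  have Am [measurable]: "A z \<in> sets lebesgue" for z by (simp add: A_def)
  have Um [measurable]: "(\<Union>z\<in>Y. A z) \<in> sets lebesgue" using insert.hyps(1) by (intro sets.finite_UN) auto
  have IH: "\<kappa> {0<..<r} \<le> ennreal e * \<kappa> ({0<..<r} - (\<Union>z\<in>Y. A z))" if "0 < r" for r
    using insert.IH[OF _ that] insert.prems unfolding \<kappa>_def e_def C_def A_def by simp
  have card: "annuli_const C (card (insert z Y)) = e * (1 + C * e)"
    using insert.hyps by (simp add: e_def)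
  have "\<kappa> {0<..<r} \<le> ennreal (e * (1 + C * e)) * \<kappa> ({0<..<r} - (\<Union>z\<in>insert z Y. A z))"
  proof (cases "{0<..<r} \<inter> A z = {}")
    case True
    then have eq: "{0<..<r} - (\<Union>z\<in>insert z Y. A z) = {0<..<r} - (\<Union>z\<in>Y. A z)" by auto
    have "\<kappa> {0<..<r} \<le> ennreal e * \<kappa> ({0<..<r} - (\<Union>z\<in>Y. A z))" by (rule IH) (rule insert.prems)
    also have "\<dots> \<le> ennreal (e * (1 + C * e)) * \<kappa> ({0<..<r} - (\<Union>z\<in>Y. A z))"
      using e C mult_left_mono[of 1 "1 + C * e" e] by (intro mult_right_mono ennreal_leI) auto
    finally show ?thesis unfolding eq .
  next
    case False
    then have a: "0 < cmod z / 2" "cmod z / 2 < r" by (auto simp: A_def)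
    have z0: "z \<noteq> 0" using a by auto
    let ?R = "{0<..<r} - (\<Union>z\<in>insert z Y. A z)"
    have "\<kappa> (A z) \<le> ennreal C * \<kappa> {0<..<cmod z / 2}"
      unfolding \<kappa>_def C_def A_def using insert.prems z0 L by (intro wint_annulus_le) auto
    also have "\<dots> \<le> ennreal C * (ennreal e * \<kappa> ({0<..<cmod z / 2} - (\<Union>z\<in>Y. A z)))"
      by (intro mult_left_mono IH a) auto
    also have "\<kappa> ({0<..<cmod z / 2} - (\<Union>z\<in>Y. A z)) \<le> \<kappa> ?R"
      unfolding \<kappa>_def using a by (intro wint_mono) (auto simp: A_def)
    finally have A_le: "\<kappa> (A z) \<le> ennreal C * (ennreal e * \<kappa> ?R)" by (simp add: mult_left_mono)
    have "\<kappa> {0<..<r} \<le> ennreal e * \<kappa> ({0<..<r} - (\<Union>z\<in>Y. A z))" by (rule IH) (rule insert.prems)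
    also have "\<kappa> ({0<..<r} - (\<Union>z\<in>Y. A z)) \<le> \<kappa> (?R \<union> A z)"
      unfolding \<kappa>_def by (intro wint_mono) auto
    also have "\<dots> \<le> \<kappa> ?R + \<kappa> (A z)"
      unfolding \<kappa>_def using insert.hyps(1) by (intro wint_Un_le) auto
    also have "\<dots> \<le> \<kappa> ?R + ennreal C * (ennreal e * \<kappa> ?R)" by (intro add_left_mono A_le)
    also have "\<dots> = ennreal (1 + C * e) * \<kappa> ?R"
      using C e by (simp add: ennreal_plus ennreal_mult distrib_right mult.assoc)
    also have "ennreal e * (ennreal (1 + C * e) * \<kappa> ?R) = ennreal (e * (1 + C * e)) * \<kappa> ?R"
      using C e by (simp add: ennreal_mult mult.assoc)
    finally show ?thesis by (simp add: mult_left_mono)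
  qed
  then show ?case unfolding card[symmetric] unfolding \<kappa>_def C_def A_def .
qed simp

text \<open>
  Factor the polynomial over the complex numbers. Each monomial is dominated by the leading coefficient
  times the majorant of the roots; the integral of the majorant is controlled by its integral outside
  the annuli around the moduli of the roots; and there the majorant is at most \<open>3\<^sup>n\<^sup>+\<^sup>1\<close> times the
  polynomial. The constant depends on \<open>n\<close>, \<open>c\<close> and \<open>D\<close> only.
\<close>

lemma coefficient_bound:
  "\<exists>C>0. \<forall>r>0. \<forall>a::nat \<Rightarrow> real. \<forall>k\<le>Suc n.
     ennreal (\<bar>a k\<bar> powr c) * wint W (\<lambda>t. t powr (real k * c)) {0<..<r}
     \<le> ennreal C * wint W (\<lambda>t. \<bar>\<Sum>j\<le>Suc n. a j * t ^ j\<bar> powr c) {0<..<r}"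
proof -
  define C0 where "C0 = 3 powr c * (max 1 D)\<^sup>2"
  have C0: "0 \<le> C0" by (simp add: C0_def)
  define e where "e = annuli_const C0 (Suc n)"
  have e: "1 \<le> e" unfolding e_def by (rule annuli_const_ge_1[OF C0])
  define C where "C = e * (3 ^ Suc n) powr c"
  have "0 < C" using e by (simp add: C_def)
  moreover have "ennreal (\<bar>a k\<bar> powr c) * wint W (\<lambda>t. t powr (real k * c)) {0<..<r}
     \<le> ennreal C * wint W (\<lambda>t. \<bar>\<Sum>j\<le>Suc n. a j * t ^ j\<bar> powr c) {0<..<r}"
    if r: "0 < r" and k: "k \<le> Suc n" for r k and a :: "nat \<Rightarrow> real"
  proof -
    define q :: "complex poly" where "q = Abs_poly (\<lambda>j. if j \<le> Suc n then of_real (a j) else 0)"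
    have cq: "coeff q j = (if j \<le> Suc n then of_real (a j) else 0)" for j
      unfolding q_def by (subst coeff_Abs_poly[of "Suc n"]) auto
    have dq: "degree q \<le> Suc n" by (rule degree_le) (simp add: cq)
    have pq: "poly q (of_real t) = of_real (\<Sum>j\<le>Suc n. a j * t ^ j)" for t
    proof -
      have "poly q (of_real t) = (\<Sum>j\<le>Suc n. coeff q j * of_real t ^ j)"
        unfolding poly_altdef using dq by (intro sum.mono_neutral_left) (auto simp: coeff_eq_0)
      then show ?thesis by (simp add: cq)
    qed
    obtain zs where mz: "mset zs = proots q" using ex_mset by blast
    have "q = smult (lead_coeff q) (\<Prod>z\<in>#mset zs. [:-z, 1:])"
      unfolding mz by (rule complex_poly_decompose_multiset[symmetric])
    then have zs: "q = smult (lead_coeff q) (\<Prod>z\<leftarrow>zs. [:-z, 1:])" "length zs = degree q"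
      using arg_cong[OF mz, of size] by (simp_all add: prod_mset_prod_list size_proots_complex flip: mset_map)
    define lc where "lc = cmod (lead_coeff q)"
    define G where "G t = majorant zs t powr c" for t
    have Gm [measurable]: "G \<in> borel_measurable lebesgue" unfolding G_def[abs_def] by measurable
    let ?F = "{0<..<r} - (\<Union>z\<in>set zs. {cmod z / 2..<2 * cmod z})"
    have Fm [measurable]: "?F \<in> sets lebesgue" by (intro sets.Diff sets.finite_UN) auto
    have "ennreal (\<bar>a k\<bar> powr c) * wint W (\<lambda>t. t powr (real k * c)) {0<..<r} = wint W (\<lambda>t. \<bar>a k\<bar> powr c * t powr (real k * c)) {0<..<r}"
      by (subst wint_cmult) auto
    also have "\<dots> \<le> wint W (\<lambda>t. lc powr c * G t) {0<..<r}"
    proof (rule wint_mono)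
      fix t assume t: "t \<in> {0<..<r}"
      have "\<bar>a k\<bar> = cmod (coeff q k)" using k by (simp add: cq)
      also have "\<dots> = lc * cmod (coeff (\<Prod>z\<leftarrow>zs. [:-z, 1:]) k)"
        by (subst zs(1)) (simp add: lc_def norm_mult)
      finally have "\<bar>a k\<bar> * t ^ k = lc * (cmod (coeff (\<Prod>z\<leftarrow>zs. [:-z, 1:]) k) * t ^ k)" by simp
      also have "\<dots> \<le> lc * majorant zs t"
        using t by (intro mult_left_mono coeff_le_majorant) (auto simp: lc_def)
      finally have "(\<bar>a k\<bar> * t ^ k) powr c \<le> (lc * majorant zs t) powr c"
        using c t by (intro powr_mono2) auto
      then show "\<bar>a k\<bar> powr c * t powr (real k * c) \<le> lc powr c * G t"
        using t majorant_nonneg[of t zs] by (simp add: powr_mult G_def powr_powr powr_realpow[symmetric] lc_def)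
    qed auto
    also have "\<dots> = ennreal (lc powr c) * wint W G {0<..<r}" by (rule wint_cmult) auto
    also have "\<dots> \<le> ennreal (lc powr c) * (ennreal e * wint W G ?F)"
    proof (rule mult_left_mono)
      have "wint W G {0<..<r} \<le> ennreal (annuli_const C0 (card (set zs))) * wint W G ?F"
        unfolding G_def[abs_def] C0_def using r zs(2) dq by (intro wint_outside_annuli) auto
      also have "\<dots> \<le> ennreal e * wint W G ?F"
        unfolding e_def using C0 zs(2) dq card_length[of zs]
        by (intro mult_right_mono ennreal_leI annuli_const_mono) auto
      finally show "wint W G {0<..<r} \<le> ennreal e * wint W G ?F" .
    qed simp
    also have "\<dots> = wint W (\<lambda>t. lc powr c * e * G t) ?F"
      using e by (subst wint_cmult) (auto simp: ennreal_mult mult.assoc)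
    also have "\<dots> \<le> wint W (\<lambda>t. C * \<bar>\<Sum>j\<le>Suc n. a j * t ^ j\<bar> powr c) {0<..<r}"
    proof (rule wint_mono)
      fix t assume t: "t \<in> ?F"
      have "lc * majorant zs t \<le> lc * (3 ^ length zs * cmod (poly (\<Prod>z\<leftarrow>zs. [:-z, 1:]) (of_real t)))"
        using t by (intro mult_left_mono majorant_le_poly) (force simp: lc_def)+
      also have "\<dots> = 3 ^ length zs * cmod (poly q (of_real t))"
        by (subst zs(1)) (simp add: lc_def norm_mult)
      also have "\<dots> \<le> 3 ^ Suc n * cmod (poly q (of_real t))"
        using zs(2) dq by (intro mult_right_mono power_increasing) auto
      also have "cmod (poly q (of_real t)) = \<bar>\<Sum>j\<le>Suc n. a j * t ^ j\<bar>"
        unfolding pq by (simp only: norm_of_real)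
      finally have "(lc * majorant zs t) powr c \<le> (3 ^ Suc n * \<bar>\<Sum>j\<le>Suc n. a j * t ^ j\<bar>) powr c"
        using c t majorant_nonneg[of t zs] by (intro powr_mono2) (auto simp: lc_def)
      then have "lc powr c * G t \<le> (3 ^ Suc n) powr c * \<bar>\<Sum>j\<le>Suc n. a j * t ^ j\<bar> powr c"
        using t majorant_nonneg[of t zs] by (simp add: powr_mult G_def lc_def)
      then have "e * (lc powr c * G t) \<le> e * ((3 ^ Suc n) powr c * \<bar>\<Sum>j\<le>Suc n. a j * t ^ j\<bar> powr c)"
        using e by (intro mult_left_mono) auto
      then show "lc powr c * e * G t \<le> C * \<bar>\<Sum>j\<le>Suc n. a j * t ^ j\<bar> powr c"
        by (simp add: C_def mult_ac)
    qed auto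
    also have "\<dots> = ennreal C * wint W (\<lambda>t. \<bar>\<Sum>j\<le>Suc n. a j * t ^ j\<bar> powr c) {0<..<r}"
      using \<open>0 < C\<close> by (intro wint_cmult) (auto intro!: measurable_completion)
    finally show ?thesis .
  qed
  ultimately show ?thesis by blast
qed

end

section \<open>Dominated extension along finitely many functionals\<close>

text \<open>
  Linear spaces appear as sets of functions, because the space of test functions varies with a parameter
  and so is not a type.
\<close>

definition lin_closed :: "('a \<Rightarrow> real) set \<Rightarrow> bool" where
  "lin_closed V \<longleftrightarrow> (\<forall>f\<in>V. \<forall>g\<in>V. \<forall>a b. (\<lambda>x. a * f x + b * g x) \<in> V)"

definition lin_on :: "('a \<Rightarrow> real) set \<Rightarrow> (('a \<Rightarrow> real) \<Rightarrow> real) \<Rightarrow> bool" where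
  "lin_on V \<phi> \<longleftrightarrow> (\<forall>f\<in>V. \<forall>g\<in>V. \<forall>a b. \<phi> (\<lambda>x. a * f x + b * g x) = a * \<phi> f + b * \<phi> g)"

definition seminorm_on :: "('a \<Rightarrow> real) set \<Rightarrow> (('a \<Rightarrow> real) \<Rightarrow> real) \<Rightarrow> bool" where
  "seminorm_on V n \<longleftrightarrow> (\<forall>f\<in>V. \<forall>g\<in>V. \<forall>a b. n (\<lambda>x. a * f x + b * g x) \<le> \<bar>a\<bar> * n f + \<bar>b\<bar> * n g)"

text \<open>
  The one-dimensional step of the Hahn-Banach theorem. By homogeneity it suffices to treat \<open>M k = 1\<close>,
  where \<open>c\<close> must lie between all \<open>\<phi> k - n k\<close> and all \<open>\<phi> k + n k\<close>; that every lower bound is below every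
  upper bound is the hypothesis applied to differences, which lie in the kernel of \<open>M\<close>.
\<close>

lemma dominated_extension_step:
  assumes V: "lin_closed V" and n: "seminorm_on V n" and \<phi>: "lin_on V \<phi>" and M: "lin_on V M"
    and le: "\<And>f. f \<in> V \<Longrightarrow> M f = 0 \<Longrightarrow> \<bar>\<phi> f\<bar> \<le> n f"
  obtains c where "\<And>f. f \<in> V \<Longrightarrow> \<bar>\<phi> f - c * M f\<bar> \<le> n f"
proof (cases "\<exists>f\<in>V. M f \<noteq> 0")
  case False
  then show thesis using le that[of 0] by simp
next
  case True
  then obtain g where g: "g \<in> V" "M g \<noteq> 0" by blast
  define P where "P = {k \<in> V. M k = 1}"
  have scale: "(\<lambda>x. (1 / M f) * f x + 0 * f x) \<in> P" if "f \<in> V" "M f \<noteq> 0" for f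
  proof -
    have "(\<lambda>x. (1 / M f) * f x + 0 * f x) \<in> V"
      using that(1) V unfolding lin_closed_def by blast
    moreover have "M (\<lambda>x. (1 / M f) * f x + 0 * f x) = (1 / M f) * M f + 0 * M f"
      using that(1) M unfolding lin_on_def by blast
    ultimately show ?thesis using that(2) by (simp add: P_def)
  qed
  then have P_ne: "P \<noteq> {}" using g by blast
  have cross: "\<phi> k - n k \<le> \<phi> k' + n k'" if "k \<in> P" "k' \<in> P" for k k'
  proof -
    have kV: "k \<in> V" "k' \<in> V" "M k = 1" "M k' = 1" using that by (auto simp: P_def)
    let ?d = "\<lambda>x. 1 * k x + (-1) * k' x"
    have dV: "?d \<in> V" using kV V unfolding lin_closed_def by blast
    have "M ?d = 0" using M kV unfolding lin_on_def by (metis add.right_inverse mult.right_neutral)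
    then have "\<bar>\<phi> ?d\<bar> \<le> n ?d" using le dV by blast
    moreover have "\<phi> ?d = 1 * \<phi> k + (-1) * \<phi> k'" using \<phi> kV unfolding lin_on_def by blast
    moreover have "n ?d \<le> \<bar>1\<bar> * n k + \<bar>-1\<bar> * n k'" using n kV unfolding seminorm_on_def by blast
    ultimately show ?thesis by simp
  qed
  define c where "c = (SUP k\<in>P. \<phi> k - n k)"
  obtain k0 where k0: "k0 \<in> P" using P_ne by blast
  have bdd: "bdd_above ((\<lambda>k. \<phi> k - n k) ` P)"
    by (rule bdd_aboveI2[of _ _ "\<phi> k0 + n k0"]) (use cross k0 in blast)
  have c_P: "\<bar>\<phi> k - c\<bar> \<le> n k" if "k \<in> P" for k
  proof -
    have "\<phi> k - n k \<le> c" unfolding c_def by (intro cSUP_upper that bdd)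
    moreover have "c \<le> \<phi> k + n k" unfolding c_def using P_ne cross that by (intro cSUP_least) auto
    ultimately show ?thesis by simp
  qed
  show thesis
  proof (rule that[of c])
    fix f assume f: "f \<in> V"
    show "\<bar>\<phi> f - c * M f\<bar> \<le> n f"
    proof (cases "M f = 0")
      case True
      then show ?thesis using le f by simp
    next
      case False
      let ?k = "\<lambda>x. (1 / M f) * f x + 0 * f x"
      have "\<bar>\<phi> ?k - c\<bar> \<le> n ?k" by (intro c_P scale f False)
      moreover have "\<phi> ?k = (1 / M f) * \<phi> f + 0 * \<phi> f" using \<phi> f unfolding lin_on_def by blast
      moreover have "n ?k \<le> \<bar>1 / M f\<bar> * n f + \<bar>0\<bar> * n f" using n f unfolding seminorm_on_def by blast
      ultimately have "\<bar>\<phi> f / M f - c\<bar> \<le> n f / \<bar>M f\<bar>" by simp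
      then have "\<bar>\<phi> f / M f - c\<bar> * \<bar>M f\<bar> \<le> n f" using False by (simp add: field_simps)
      then show ?thesis using False by (simp add: abs_mult[symmetric] left_diff_distrib)
    qed
  qed
qed

text \<open>
  Apply the step on the common kernel of the remaining functionals, then continue with the functional
  diminished by the multiple that was found.
\<close>

theorem dominated_extension_finite:
  assumes "finite J" and V: "lin_closed V" and n: "seminorm_on V n" and \<phi>: "lin_on V \<phi>"
    and M: "\<And>j. j \<in> J \<Longrightarrow> lin_on V (M j)"
    and le: "\<And>f. f \<in> V \<Longrightarrow> (\<And>j. j \<in> J \<Longrightarrow> M j f = 0) \<Longrightarrow> \<bar>\<phi> f\<bar> \<le> n f"
  shows "\<exists>c. \<forall>f\<in>V. \<bar>\<phi> f - (\<Sum>j\<in>J. c j * M j f)\<bar> \<le> n f"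
  using assms(1) \<phi> M le
proof (induction arbitrary: \<phi> rule: finite_induct)
  case (insert i J)
  let ?V = "{f \<in> V. \<forall>j\<in>J. M j f = 0}"
  have sub: "lin_on ?V \<psi>" if "lin_on V \<psi>" for \<psi> using that unfolding lin_on_def by blast
  have lin0: "M j (\<lambda>x. a * f x + b * g x) = 0" if "j \<in> J" "f \<in> ?V" "g \<in> ?V" for j f g a b
  proof -
    have "M j (\<lambda>x. a * f x + b * g x) = a * M j f + b * M j g"
      using insert.prems(2)[of j] that unfolding lin_on_def by blast
    then show ?thesis using that by simp
  qed
  have V': "lin_closed ?V"
    unfolding lin_closed_def using V lin0 unfolding lin_closed_def by blast
  have n': "seminorm_on ?V n" using n unfolding seminorm_on_def by blast
  have "\<bar>\<phi> f\<bar> \<le> n f" if "f \<in> ?V" "M i f = 0" for f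
    using insert.prems(3)[of f] that by auto
  then obtain ci where ci: "\<And>f. f \<in> ?V \<Longrightarrow> \<bar>\<phi> f - ci * M i f\<bar> \<le> n f"
    using dominated_extension_step[OF V' n' sub[OF insert.prems(1)] sub[of "M i"]] insert.prems(2)[of i] by blast
  let ?\<psi> = "\<lambda>f. \<phi> f - ci * M i f"
  have lin\<psi>: "lin_on V ?\<psi>"
    using insert.prems(1) insert.prems(2)[of i] unfolding lin_on_def by (simp add: algebra_simps)
  have "\<exists>c. \<forall>f\<in>V. \<bar>?\<psi> f - (\<Sum>j\<in>J. c j * M j f)\<bar> \<le> n f"
  proof (rule insert.IH[OF lin\<psi>])
    show "lin_on V (M j)" if "j \<in> J" for j using insert.prems(2)[of j] that by simp
    show "\<bar>?\<psi> f\<bar> \<le> n f" if "f \<in> V" "\<And>j. j \<in> J \<Longrightarrow> M j f = 0" for f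
      using ci[of f] that by simp
  qed
  then obtain c where c: "\<And>f. f \<in> V \<Longrightarrow> \<bar>?\<psi> f - (\<Sum>j\<in>J. c j * M j f)\<bar> \<le> n f" by blast
  have "\<bar>\<phi> f - (\<Sum>j\<in>insert i J. (c(i := ci)) j * M j f)\<bar> \<le> n f" if "f \<in> V" for f
  proof -
    have "(\<Sum>j\<in>J. (c(i := ci)) j * M j f) = (\<Sum>j\<in>J. c j * M j f)"
      using insert.hyps by (intro sum.cong) auto
    then show ?thesis using c[OF that] insert.hyps by (simp add: algebra_simps)
  qed
  then show ?case by blast
qed simp

section \<open>Hardy's inequality by dyadic decomposition\<close>

lemma dyadic_interval_ex:
  fixes y :: real
  assumes "0 < y"
  shows "\<exists>k::int. 2 powr k < y \<and> y \<le> 2 powr (k + 1)"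
proof -
  define k where "k = \<lceil>log 2 y\<rceil> - 1"
  have "of_int k < log 2 y" "log 2 y \<le> of_int k + 1" unfolding k_def by linarith+
  then have "2 powr k < 2 powr log 2 y" "2 powr log 2 y \<le> 2 powr (k + 1)" by auto
  then show ?thesis using assms by auto
qed

lemma first_hitting_point:
  fixes H :: "real \<Rightarrow> real"
  assumes cont: "continuous_on UNIV H" and H0: "\<And>x. x \<le> 0 \<Longrightarrow> H x = 0" and y: "0 < y" "y < H x"
  obtains z where "0 < z" "z < x" "H z = y" "\<And>t. t < z \<Longrightarrow> H t < y"
proof -
  have "0 < x" using H0[of x] y by (cases "x \<le> 0") auto
  define T where "T = {t. 0 \<le> t \<and> t \<le> x \<and> y \<le> H t}"
  have T: "closed T" unfolding T_def
    by (intro closed_Collect_conj closed_Collect_le continuous_intros cont)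
  have xT: "x \<in> T" using y \<open>0 < x\<close> by (simp add: T_def)
  have bdd: "bdd_below T" unfolding T_def by (rule bdd_belowI[of _ 0]) auto
  define z where "z = Inf T"
  have zT: "z \<in> T" unfolding z_def using closed_contains_Inf[OF _ bdd T] xT by blast
  have less: "H t < y" if "t < z" for t
  proof (cases "t \<le> 0")
    case False
    then have "t \<notin> T" using that cInf_lower[OF _ bdd, of t] unfolding z_def by auto
    then show ?thesis using False that zT by (auto simp: T_def)
  qed (use H0 y in auto)
  have z0: "0 < z" using zT H0[of z] y by (cases "z \<le> 0") (auto simp: T_def)
  have "H z \<le> y"
  proof (rule ccontr)
    assume "\<not> H z \<le> y"
    then have "\<exists>s\<ge>0. s \<le> z \<and> H s = y"
      using IVT'[of H 0 y z] H0[of 0] y z0 continuous_on_subset[OF cont] by auto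
    then obtain s where "s \<le> z" "H s = y" by blast
    then show False using less[of s] \<open>\<not> H z \<le> y\<close> by (cases "s = z") auto
  qed
  then have Hz: "H z = y" using zT by (simp add: T_def)
  have "z < x" using zT y Hz by (cases "z = x") (auto simp: T_def)
  then show thesis using that z0 Hz less by blast
qed

text \<open>
  Here \<open>H\<close> plays the role of \<open>\<integral>\<^sub>0\<^sup>x t\<^sup>k |g(t)| dt\<close>, \<open>n\<close> that of \<open>|u g|\<^sup>P\<close>, \<open>\<phi>\<close> that of \<open>|d v|\<close>, and \<open>K r\<close> is the
  factor in Hoelder's inequality for the integral of \<open>t\<^sup>k g\<close> over subintervals of \<open>(0, r)\<close>. The half-line
  is cut into the sets \<open>E k = {2\<^sup>k < H \<le> 2\<^sup>k\<^sup>+\<^sup>1}\<close>. If \<open>z\<close> is the first point with \<open>H z = 2\<^sup>k\<close>, then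
  \<open>E k\<close> lies to the right of \<open>z\<close>, where the tail condition bounds \<open>\<phi>\<close> in terms of \<open>1 / K z\<close>. On the other hand
  \<open>2\<^sup>k\<^sup>-\<^sup>1\<close> is the increment of \<open>H\<close> up to \<open>z\<close> over the part of \<open>S k = {2\<^sup>k\<^sup>-\<^sup>1 \<le> H < 2\<^sup>k}\<close>, which Hoelder's
  inequality bounds by \<open>K z\<close>. The factors \<open>K z\<close> cancel, and the pieces sum up because the \<open>S k\<close> are disjoint.
\<close>

theorem dyadic_Hardy:
  fixes H K \<phi> n :: "real \<Rightarrow> real" and P Q A N :: real
  assumes PQ: "1 \<le> P" "P \<le> Q" and A: "0 < A" and N: "0 \<le> N"
    and cont: "continuous_on UNIV H" and H0: "\<And>x. x \<le> 0 \<Longrightarrow> H x = 0" and mono: "mono H"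
    and K: "\<And>r. 0 < r \<Longrightarrow> 0 < K r"
    and \<phi> [measurable]: "\<phi> \<in> borel_measurable lebesgue" and \<phi>0: "\<And>x. 0 \<le> \<phi> x"
    and n [measurable]: "n \<in> borel_measurable lebesgue" and n0: "\<And>x. 0 \<le> n x"
    and nN: "(\<integral>\<^sup>+x. ennreal (n x) * indicator {0<..} x \<partial>lebesgue) \<le> ennreal N"
    and hoelder: "\<And>a b. 0 \<le> a \<Longrightarrow> a < b \<Longrightarrow>
       H b - H a \<le> enn2real (\<integral>\<^sup>+x. ennreal (n x) * indicator {a<..<b} x \<partial>lebesgue) powr (1 / P) * K b"
    and tail: "\<And>r. 0 < r \<Longrightarrow> (\<integral>\<^sup>+x. ennreal (\<phi> x powr Q) * indicator {r<..} x \<partial>lebesgue) \<le> ennreal ((A / K r) powr Q)"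
  shows "(\<integral>\<^sup>+x. ennreal ((\<phi> x * H x) powr Q) * indicator {0<..} x \<partial>lebesgue) \<le> ennreal ((4 * A) powr Q * N powr (Q / P))"
proof -
  have Hm [measurable]: "H \<in> borel_measurable lebesgue"
    by (rule measurable_completion) (use borel_measurable_continuous_onI[OF cont] in simp)
  have Hnn: "0 \<le> H x" for x using H0[of "min x 0"] monoD[OF mono, of "min x 0" x] by simp
  have H_pos: "0 < x" if "0 < H x" for x using H0[of x] that by (cases "x \<le> 0") auto
  define E where "E k = {x. 2 powr real_of_int k < H x \<and> H x \<le> 2 powr (real_of_int k + 1)}" for k :: int
  define S where "S k = {x. 2 powr (real_of_int k - 1) \<le> H x \<and> H x < 2 powr real_of_int k}" for k :: int
  have ES [measurable]: "E k \<in> sets lebesgue" "S k \<in> sets lebesgue" for k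
  proof -
    have *: "E k = H -` {2 powr real_of_int k<..2 powr (real_of_int k + 1)} \<inter> space lebesgue"
      "S k = H -` {2 powr (real_of_int k - 1)..<2 powr real_of_int k} \<inter> space lebesgue"
      by (auto simp: E_def S_def)
    show "E k \<in> sets lebesgue" unfolding *(1) by (rule measurable_sets[OF Hm]) simp
    show "S k \<in> sets lebesgue" unfolding *(2) by (rule measurable_sets[OF Hm]) simp
  qed
  define m where "m B = (\<integral>\<^sup>+x. ennreal (n x) * indicator B x \<partial>lebesgue)" for B :: "real set"
  have m_mono: "m B \<le> m B'" if "B \<subseteq> B'" for B B'
    unfolding m_def using that by (intro nn_integral_mono) (auto simp: indicator_def)
  have S_sub: "S k \<subseteq> {0<..}" for k
  proof
    fix x assume "x \<in> S k"
    moreover have "(0::real) < 2 powr (real_of_int k - 1)" by simp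
    ultimately have "0 < H x" unfolding S_def mem_Collect_eq by linarith
    then show "x \<in> {0<..}" using H_pos by simp
  qed
  \<comment> \<open>The factor \<open>4\<close> is the ratio of the top \<open>2\<^sup>k\<^sup>+\<^sup>1\<close> of \<open>H\<close> on \<open>E k\<close> to its increment \<open>2\<^sup>k\<^sup>-\<^sup>1\<close> over \<open>S k\<close>.\<close>
  define C where "C = (4 * A) powr Q * N powr (Q / P - 1)"
  have piece: "(\<integral>\<^sup>+x. ennreal ((\<phi> x * H x) powr Q) * indicator (E k) x \<partial>lebesgue) \<le> ennreal C * m (S k)" for k
  proof (cases "E k = {}")
    case False
    then obtain x where x: "2 powr real_of_int k < H x" by (auto simp: E_def)
    obtain z where z: "0 < z" "z < x" "H z = 2 powr real_of_int k" "\<And>t. t < z \<Longrightarrow> H t < 2 powr real_of_int k"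
      using first_hitting_point[OF cont H0 _ x] by auto
    have "2 powr (real_of_int k - 1) < H z" unfolding z(3) by (intro powr_less_mono) auto
    then obtain y where y: "0 < y" "y < z" "H y = 2 powr (real_of_int k - 1)"
      using first_hitting_point[OF cont H0, of "2 powr (real_of_int k - 1)" z] by auto
    define a where "a = enn2real (m {y<..<z})"
    have sub: "{y<..<z} \<subseteq> S k"
      using monoD[OF mono, of y] y z(4) by (auto simp: S_def)
    have mN: "m (S k) \<le> ennreal N" "m {y<..<z} \<le> ennreal N"
      using m_mono[OF S_sub[of k]] m_mono[OF order_trans[OF sub S_sub]] nN unfolding m_def by (auto intro: order_trans)
    have a_eq: "m {y<..<z} = ennreal a"
      unfolding a_def using mN(2) by (metis ennreal_enn2real ennreal_less_top le_less_trans)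
    have a0: "0 \<le> a" by (simp add: a_def)
    have aN: "a \<le> N" using mN(2) a_eq N by (simp add: ennreal_le_iff)
    have "2 powr real_of_int k = 2 * 2 powr (real_of_int k - 1)" by (simp add: powr_diff)
    then have "2 powr (real_of_int k - 1) = H z - H y" using z y by simp
    also have "\<dots> \<le> a powr (1 / P) * K z"
      unfolding a_def m_def using y by (intro hoelder) auto
    finally have hold: "2 powr (real_of_int k - 1) \<le> a powr (1 / P) * K z" .
    have Kz: "0 < K z" using K z by simp
    have a_pos: "0 < a"
    proof (rule ccontr)
      assume "\<not> 0 < a"
      then have "a = 0" using a0 by simp
      then have "2 powr (real_of_int k - 1) \<le> (0::real)" using hold by simp
      then show False using powr_gt_zero[of 2 "real_of_int k - 1"] by simp
    qed
    have E_sub: "E k \<subseteq> {z<..}"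
    proof
      fix t assume "t \<in> E k"
      then have "H z < H t" using z by (auto simp: E_def)
      then show "t \<in> {z<..}" using monoD[OF mono, of t z] by (auto simp: not_less[symmetric])
    qed
    have "(\<integral>\<^sup>+x. ennreal ((\<phi> x * H x) powr Q) * indicator (E k) x \<partial>lebesgue)
      \<le> (\<integral>\<^sup>+x. ennreal ((2 powr (real_of_int k + 1)) powr Q) * (ennreal (\<phi> x powr Q) * indicator {z<..} x) \<partial>lebesgue)"
    proof (rule nn_integral_mono)
      fix x
      show "ennreal ((\<phi> x * H x) powr Q) * indicator (E k) x
        \<le> ennreal ((2 powr (real_of_int k + 1)) powr Q) * (ennreal (\<phi> x powr Q) * indicator {z<..} x)"
      proof (cases "x \<in> E k")
        case True
        then have "\<phi> x * H x \<le> \<phi> x * 2 powr (real_of_int k + 1)"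
          using \<phi>0[of x] by (intro mult_left_mono) (auto simp: E_def)
        then have "(\<phi> x * H x) powr Q \<le> (2 powr (real_of_int k + 1) * \<phi> x) powr Q"
          using PQ \<phi>0[of x] Hnn[of x] by (intro powr_mono2) (auto simp: mult.commute)
        then show ?thesis using True E_sub \<phi>0[of x]
          by (auto simp: powr_mult ennreal_mult[symmetric] intro!: ennreal_leI)
      qed simp
    qed
    also have "\<dots> = ennreal ((2 powr (real_of_int k + 1)) powr Q) * (\<integral>\<^sup>+x. ennreal (\<phi> x powr Q) * indicator {z<..} x \<partial>lebesgue)"
      by (intro nn_integral_cmult) (auto intro!: borel_measurable_times_ennreal borel_measurable_indicator)
    also have "\<dots> \<le> ennreal ((2 powr (real_of_int k + 1)) powr Q) * ennreal ((A / K z) powr Q)"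
      by (intro mult_left_mono tail z) simp
    also have "\<dots> = ennreal ((2 powr (real_of_int k + 1) * (A / K z)) powr Q)"
    proof -
      have "(2 powr (real_of_int k + 1) * (A / K z)) powr Q = (2 powr (real_of_int k + 1)) powr Q * (A / K z) powr Q"
        by (rule powr_mult)
      then show ?thesis by (simp only: ennreal_mult powr_ge_zero)
    qed
    also have "\<dots> \<le> ennreal ((4 * A * a powr (1 / P)) powr Q)"
    proof (intro ennreal_leI powr_mono2)
      have "2 powr (real_of_int k + 1) = 4 * 2 powr (real_of_int k - 1)" by (simp add: powr_diff powr_add)
      also have "\<dots> \<le> 4 * (a powr (1 / P) * K z)" using hold by simp
      finally have "2 powr (real_of_int k + 1) * (A / K z) \<le> 4 * (a powr (1 / P) * K z) * (A / K z)"
        using A Kz by (intro mult_right_mono) auto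
      then show "2 powr (real_of_int k + 1) * (A / K z) \<le> 4 * A * a powr (1 / P)" using Kz by (simp add: mult_ac)
    qed (use PQ A Kz in auto)
    \<comment> \<open>As \<open>Q / P \<ge> 1\<close>, one factor \<open>a\<close> may be split off for summation over \<open>k\<close>; the remaining power
      of \<open>a\<close> is bounded by that of \<open>N\<close>.\<close>
    also have "(4 * A * a powr (1 / P)) powr Q = (4 * A) powr Q * (a powr (Q / P - 1) * a)"
    proof -
      have "a powr (Q / P) = a powr (Q / P - 1 + 1)" by simp
      also have "\<dots> = a powr (Q / P - 1) * a" using a_pos by (subst powr_add) simp
      finally show ?thesis using A a0 by (simp add: powr_mult powr_powr)
    qed
    also have "ennreal ((4 * A) powr Q * (a powr (Q / P - 1) * a)) \<le> ennreal (C * a)"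
      unfolding C_def using PQ aN a_pos by (intro ennreal_leI) (auto intro!: mult_right_mono mult_left_mono powr_mono2 simp: mult.assoc)
    also have "\<dots> = ennreal C * m {y<..<z}" using a_eq a0 by (simp add: C_def ennreal_mult)
    also have "\<dots> \<le> ennreal C * m (S k)" by (intro mult_left_mono m_mono sub) simp
    finally show ?thesis .
  qed simp
  have cover: "ennreal ((\<phi> x * H x) powr Q) * indicator {0<..} x = (\<Sum>i. ennreal ((\<phi> x * H x) powr Q) * indicator (E (int_decode i)) x)" for x
  proof (cases "0 < H x")
    case True
    then obtain k where k: "x \<in> E k" using dyadic_interval_ex[OF True] by (auto simp: E_def)
    have uniq: "j = k" if "x \<in> E j" for j
    proof -
      have "2 powr real_of_int k < 2 powr (real_of_int j + 1)" "2 powr real_of_int j < 2 powr (real_of_int k + 1)"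
        using that k unfolding E_def mem_Collect_eq by linarith+
      then have "real_of_int k < real_of_int j + 1" "real_of_int j < real_of_int k + 1" by simp_all
      then show ?thesis by linarith
    qed
    have ind: "indicator (E (int_decode i)) x = (if i = int_encode k then 1 else 0 :: ennreal)" for i
    proof (cases "i = int_encode k")
      case False
      then have "int_decode i \<noteq> k" by (metis int_decode_inverse)
      then have "x \<notin> E (int_decode i)" using uniq by blast
      then show ?thesis using False by simp
    qed (use k in simp)
    have "(\<Sum>i. ennreal ((\<phi> x * H x) powr Q) * indicator (E (int_decode i)) x)
       = (\<Sum>i\<in>{int_encode k}. ennreal ((\<phi> x * H x) powr Q) * indicator (E (int_decode i)) x)"
      by (intro suminf_finite) (auto simp: ind)
    then show ?thesis using H_pos[OF True] k by (simp add: ind)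
  next
    case False
    then have "H x = 0" using Hnn[of x] by simp
    then show ?thesis by simp
  qed
  have disjS: "disjoint_family (\<lambda>i. S (int_decode i))"
  proof (unfold disjoint_family_on_def, intro ballI impI)
    fix i j :: nat assume ij: "i \<noteq> j"
    have "k = k'" if "x \<in> S k" "x \<in> S k'" for x k k'
    proof -
      have "2 powr (real_of_int k - 1) < 2 powr real_of_int k'" "2 powr (real_of_int k' - 1) < 2 powr real_of_int k"
        using that unfolding S_def mem_Collect_eq by linarith+
      then have "real_of_int k - 1 < real_of_int k'" "real_of_int k' - 1 < real_of_int k" by simp_all
      then show ?thesis by linarith
    qed
    then show "S (int_decode i) \<inter> S (int_decode j) = {}"
      using ij by (metis disjoint_iff int_decode_inverse)
  qed
  have "(\<integral>\<^sup>+x. ennreal ((\<phi> x * H x) powr Q) * indicator {0<..} x \<partial>lebesgue)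
    = (\<Sum>i. \<integral>\<^sup>+x. ennreal ((\<phi> x * H x) powr Q) * indicator (E (int_decode i)) x \<partial>lebesgue)"
    unfolding cover by (intro nn_integral_suminf borel_measurable_times_ennreal borel_measurable_indicator) auto
  also have "\<dots> \<le> (\<Sum>i. ennreal C * m (S (int_decode i)))"
    by (intro suminf_le piece) auto
  also have "\<dots> = ennreal C * (\<Sum>i. m (S (int_decode i)))" by simp
  also have "(\<Sum>i. m (S (int_decode i))) = (\<integral>\<^sup>+x. ennreal (n x) * (\<Sum>i. indicator (S (int_decode i)) x) \<partial>lebesgue)"
    unfolding m_def by (subst nn_integral_suminf[symmetric]) (auto intro!: borel_measurable_times_ennreal borel_measurable_indicator)
  also have "\<dots> = m (\<Union>i. S (int_decode i))"
    unfolding m_def by (simp add: suminf_indicator[OF disjS])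
  also have "\<dots> \<le> m {0<..}" using S_sub by (intro m_mono) blast
  also have "\<dots> \<le> ennreal N" using nN by (simp add: m_def)
  also have "ennreal C * ennreal N = ennreal ((4 * A) powr Q * N powr (Q / P))"
  proof (cases "N = 0")
    case False
    then have "N powr (Q / P - 1) * N = N powr (Q / P - 1 + 1)" using N by (subst powr_add) simp
    then show ?thesis using N by (simp add: C_def ennreal_mult[symmetric] mult.assoc)
  qed simp
  finally show ?thesis by (simp add: mult_left_mono)
qed

section \<open>Moments against a weight\<close>

text \<open>
  Extension by zero moves questions on the half-line to Lebesgue measure on the whole line.
\<close>

lemma lebesgue_on_extend_measurable:
  fixes f :: "real \<Rightarrow> 'b::euclidean_space"
  assumes "f \<in> borel_measurable (lebesgue_on {0<..})"
  shows "(\<lambda>x. if 0 < x then f x else 0) \<in> borel_measurable lebesgue"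
  using borel_measurable_if[of "{0<..}" f] assms by simp

lemma borel_measurable_lebesgue_on_subset:
  assumes "f \<in> borel_measurable (lebesgue_on T)" "S \<subseteq> T"
  shows "f \<in> borel_measurable (lebesgue_on S)"
  using assms by (rule measurable_restrict_mono)

lemma nn_integral_lebesgue_on:
  "S \<in> sets lebesgue \<Longrightarrow> (\<integral>\<^sup>+x. f x \<partial>lebesgue_on S) = (\<integral>\<^sup>+x. f x * indicator S x \<partial>lebesgue)"
  by (rule nn_integral_restrict_space) simp

lemma AE_lebesgue_on_iff: "S \<in> sets lebesgue \<Longrightarrow> (AE x in lebesgue_on S. P x) \<longleftrightarrow> (AE x in lebesgue. x \<in> S \<longrightarrow> P x)"
  by (rule AE_restrict_space_iff) simp

lemma Lp_norm_lebesgue_on_mono: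
  assumes p: "1 < p" and h: "h \<in> borel_measurable (lebesgue_on T)" and "\<And>x. x \<in> T \<Longrightarrow> 0 \<le> h x"
    and S: "S \<in> sets lebesgue" "T \<in> sets lebesgue" "S \<subseteq> T"
  shows "Lp_norm (lebesgue_on S) p h \<le> Lp_norm (lebesgue_on T) p h"
proof (cases "Lp_norm (lebesgue_on T) p h")
  case (real C)
  show ?thesis
  proof (cases "p = \<infinity>")
    case True
    have hS: "h \<in> borel_measurable (lebesgue_on S)" using h S(3) by (rule borel_measurable_lebesgue_on_subset)
    have "AE x in lebesgue_on T. h x \<le> C"
      using real True h by (subst Lp_norm_le_iff_infinite[symmetric]) auto
    then have "AE x in lebesgue_on S. h x \<le> C"
      using S by (auto simp: AE_lebesgue_on_iff elim!: eventually_mono)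
    then have "Lp_norm (lebesgue_on S) \<infinity> h \<le> ennreal C" using hS real by (subst Lp_norm_le_iff_infinite) auto
    then show ?thesis using real True by simp
  next
    case False
    have "(\<integral>\<^sup>+x. ennreal (h x powr enn2real p) \<partial>lebesgue_on S) \<le> (\<integral>\<^sup>+x. ennreal (h x powr enn2real p) \<partial>lebesgue_on T)"
      using S by (simp add: nn_integral_lebesgue_on) (intro nn_integral_mono, auto simp: indicator_def)
    also have "\<dots> \<le> ennreal (C powr enn2real p)"
      using real Lp_norm_le_iff_finite[OF p False, of C "lebesgue_on T" h] by simp
    finally show ?thesis unfolding real using real by (subst Lp_norm_le_iff_finite[OF p False]) auto
  qed
qed simp

lemma absolutely_integrable_of_nn_integral:
  fixes h :: "real \<Rightarrow> 'b::euclidean_space"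
  assumes h: "h \<in> borel_measurable lebesgue"
    and fin: "(\<integral>\<^sup>+x. ennreal (norm (h x)) * indicator {a<..<b} x \<partial>lebesgue) < \<infinity>"
  shows "h absolutely_integrable_on {a..b}"
proof -
  have ae: "AE x in lebesgue. x \<noteq> a \<and> x \<noteq> b"
    using AE_lborel_singleton[of a] AE_lborel_singleton[of b] by (intro AE_conjI AE_completion) auto
  have "(\<integral>\<^sup>+x. ennreal (norm (indicator {a..b} x *\<^sub>R h x)) \<partial>lebesgue)
    = (\<integral>\<^sup>+x. ennreal (norm (h x)) * indicator {a<..<b} x \<partial>lebesgue)"
  proof (rule nn_integral_cong_AE)
    show "AE x in lebesgue. ennreal (norm (indicator {a..b} x *\<^sub>R h x)) = ennreal (norm (h x)) * indicator {a<..<b} x"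
      using ae by eventually_elim (auto simp: indicator_def)
  qed
  then show ?thesis
    unfolding set_integrable_def using fin h by (intro integrableI_bounded) (auto intro!: borel_measurable_scaleR borel_measurable_indicator)
qed

lemma integral_eq_nn_integral_open:
  fixes h :: "real \<Rightarrow> real"
  assumes h: "h \<in> borel_measurable lebesgue" and nn: "\<And>x. 0 \<le> h x"
    and ai: "h absolutely_integrable_on {a..b}"
  shows "ennreal (integral {a..b} h) = (\<integral>\<^sup>+x. ennreal (h x) * indicator {a<..<b} x \<partial>lebesgue)"
proof -
  have ae: "AE x in lebesgue. x \<noteq> a \<and> x \<noteq> b"
    using AE_lborel_singleton[of a] AE_lborel_singleton[of b] by (intro AE_conjI AE_completion) auto
  have "integral {a..b} h = (LINT x|lebesgue. indicator {a..b} x *\<^sub>R h x)"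
    using set_lebesgue_integral_eq_integral(2)[OF ai] by (simp add: set_lebesgue_integral_def)
  also have "ennreal \<dots> = (\<integral>\<^sup>+x. ennreal (indicator {a..b} x *\<^sub>R h x) \<partial>lebesgue)"
    using ai nn unfolding set_integrable_def by (intro nn_integral_eq_integral[symmetric]) auto
  also have "\<dots> = (\<integral>\<^sup>+x. ennreal (h x) * indicator {a<..<b} x \<partial>lebesgue)"
  proof (rule nn_integral_cong_AE)
    show "AE x in lebesgue. ennreal (indicator {a..b} x *\<^sub>R h x) = ennreal (h x) * indicator {a<..<b} x"
      using ae by eventually_elim (auto simp: indicator_def)
  qed
  finally show ?thesis .
qed

definition moment :: "(real \<Rightarrow> complex) \<Rightarrow> nat \<Rightarrow> real \<Rightarrow> complex" where
  "moment g k x = integral {0..x} (\<lambda>t. of_real (t ^ k) * g t)"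

locale weight =
  fixes p :: ennreal and u :: "real \<Rightarrow> real"
  assumes p: "1 < p"
    and u_meas: "u \<in> borel_measurable (lebesgue_on {0<..})" and u_nonneg: "\<forall>x>0. 0 \<le> u x"
    and u_int: "\<forall>r>0. (\<integral>\<^sup>+x. neg_conj_pow u p x \<partial>lebesgue_on {0<..<r}) < \<infinity>"
begin

abbreviation "c \<equiv> conj_exp p"

lemma c_ge_1: "1 \<le> c" using p by (rule conj_exp_ge_1)

text \<open>
  The value on the left half-line is arbitrary; a positive one makes the weight positive almost
  everywhere on the whole line.
\<close>

definition u_ext :: "real \<Rightarrow> real" where "u_ext x = (if 0 < x then u x else 1)"

text \<open>
  The density \<open>u\<^sup>-\<^sup>p\<^sup>'\<close>, as a real number. On the open half-line it differs from \<open>neg_conj_pow\<close> only where \<open>u\<close>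
  vanishes, which is a null set because \<open>neg_conj_pow\<close> is locally integrable.
\<close>

definition W :: "real \<Rightarrow> real" where "W x = u_ext x powr (- c)"

lemma u_ext_measurable [measurable]: "u_ext \<in> borel_measurable lebesgue"
proof -
  have "(\<lambda>x. (if 0 < x then u x else 0) + indicator {..0} x) \<in> borel_measurable lebesgue"
    using lebesgue_on_extend_measurable[OF u_meas] by (intro borel_measurable_add borel_measurable_indicator) auto
  also have "(\<lambda>x. (if 0 < x then u x else 0) + indicator {..0} x) = u_ext"
    by (auto simp: u_ext_def fun_eq_iff indicator_def)
  finally show ?thesis .
qed

lemma W_measurable [measurable]: "W \<in> borel_measurable lebesgue"
  unfolding W_def[abs_def] by measurable

lemma u_ext_nonneg: "0 \<le> u_ext x" using u_nonneg by (simp add: u_ext_def)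

lemma W_nonneg: "0 \<le> W x" by (simp add: W_def)

lemma neg_conj_pow_measurable: "neg_conj_pow u p \<in> borel_measurable (lebesgue_on {0<..})"
proof -
  have [measurable]: "u \<in> borel_measurable (lebesgue_on {0<..})" by (rule u_meas)
  show ?thesis unfolding neg_conj_pow_def[abs_def] by measurable
qed

lemma AE_u_ext_pos: "AE x in lebesgue. 0 < u_ext x"
proof -
  have "AE x in lebesgue. 0 < x \<and> x < real (Suc n) \<longrightarrow> 0 < u_ext x" for n
  proof -
    have "AE x in lebesgue_on {0<..<real (Suc n)}. neg_conj_pow u p x \<noteq> \<infinity>"
      using u_int[rule_format, of "real (Suc n)"]
      by (intro nn_integral_noteq_infinite borel_measurable_lebesgue_on_subset[OF neg_conj_pow_measurable]) auto
    then have "AE x in lebesgue. x \<in> {0<..<real (Suc n)} \<longrightarrow> neg_conj_pow u p x \<noteq> \<infinity>"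
      by (subst (asm) AE_lebesgue_on_iff) auto
    then show ?thesis
    proof eventually_elim
      case (elim x)
      show ?case
      proof
        assume x: "0 < x \<and> x < real (Suc n)"
        then have "u x \<noteq> 0" using elim by (auto simp: neg_conj_pow_def)
        then show "0 < u_ext x" using u_nonneg x by (auto simp: u_ext_def less_le)
      qed
    qed
  qed
  then have "AE x in lebesgue. \<forall>n. 0 < x \<and> x < real (Suc n) \<longrightarrow> 0 < u_ext x" by (simp only: AE_all_countable) blast
  then show ?thesis
  proof eventually_elim
    case (elim x)
    obtain n where "x < real n" using reals_Archimedean2 by blast
    then have "x < real (Suc n)" by simp
    then show ?case using elim by (cases "0 < x") (auto simp: u_ext_def)
  qed
qed

lemma neg_conj_pow_eq: "0 < x \<Longrightarrow> 0 < u_ext x \<Longrightarrow> neg_conj_pow u p x = ennreal (W x)"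
  by (simp add: neg_conj_pow_def W_def u_ext_def inverse_ennreal powr_minus)

lemma wint_eq: "(\<integral>\<^sup>+x. ennreal (f x) * neg_conj_pow u p x \<partial>lebesgue_on {0<..<r}) = wint W f {0<..<r}"
  unfolding wint_def
  by (subst nn_integral_lebesgue_on, simp, intro nn_integral_cong_AE)
    (use AE_u_ext_pos in \<open>auto elim!: eventually_mono simp: neg_conj_pow_eq ennreal_mult'' W_nonneg indicator_def\<close>)

definition \<Phi> :: "nat \<Rightarrow> real \<Rightarrow> ennreal" where
  "\<Phi> k r = wint W (\<lambda>t. t powr (real k * c)) {0<..<r}"

text \<open>
  The second factor in condition (A), that is the norm of \<open>t\<^sup>k / u\<close> on \<open>(0, r)\<close> for the conjugate exponent.
  It is finite and positive, so division by it is harmless.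
\<close>

definition K :: "nat \<Rightarrow> real \<Rightarrow> real" where
  "K k r = enn2real (\<Phi> k r) powr (1 / c)"

lemma \<Phi>_finite: "0 < r \<Longrightarrow> \<Phi> k r < \<infinity>"
proof -
  assume r: "0 < r"
  have "\<Phi> k r \<le> (\<integral>\<^sup>+x. ennreal (r powr (real k * c)) * (ennreal (W x) * indicator {0<..<r} x) \<partial>lebesgue)"
    unfolding \<Phi>_def wint_def
  proof (rule nn_integral_mono)
    fix x
    have "x powr (real k * c) * W x \<le> r powr (real k * c) * W x" if "0 < x" "x < r"
      using that c_ge_1 W_nonneg by (intro mult_right_mono powr_mono2) auto
    then show "ennreal (x powr (real k * c) * W x) * indicator {0<..<r} x \<le> ennreal (r powr (real k * c)) * (ennreal (W x) * indicator {0<..<r} x)"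
      by (auto simp: indicator_def ennreal_mult[symmetric] W_nonneg intro!: ennreal_leI)
  qed
  also have "\<dots> = ennreal (r powr (real k * c)) * (\<integral>\<^sup>+x. ennreal (W x) * indicator {0<..<r} x \<partial>lebesgue)"
    by (intro nn_integral_cmult borel_measurable_times_ennreal borel_measurable_indicator) auto
  finally have le: "\<Phi> k r \<le> \<dots>" .
  have "(\<integral>\<^sup>+x. ennreal (W x) * indicator {0<..<r} x \<partial>lebesgue) = (\<integral>\<^sup>+x. ennreal 1 * neg_conj_pow u p x \<partial>lebesgue_on {0<..<r})"
    by (subst wint_eq) (simp add: wint_def)
  also have "\<dots> < \<infinity>" using u_int r by simp
  finally have "ennreal (r powr (real k * c)) * (\<integral>\<^sup>+x. ennreal (W x) * indicator {0<..<r} x \<partial>lebesgue) < \<infinity>"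
    by (simp add: ennreal_mult_less_top)
  then show ?thesis using le by (rule le_less_trans[rotated])
qed

lemma \<Phi>_pos: "0 < r \<Longrightarrow> 0 < \<Phi> k r"
proof (rule ccontr)
  assume r: "0 < r" and "\<not> 0 < \<Phi> k r"
  then have "\<Phi> k r = 0" by simp
  have pm0 [measurable]: "(\<lambda>t::real. t powr (real k * c)) \<in> borel_measurable lebesgue"
    by (rule measurable_completion) simp
  have pm: "(\<lambda>x. ennreal (x powr (real k * c) * W x)) \<in> borel_measurable lebesgue" by measurable
  from \<open>\<Phi> k r = 0\<close> have "AE x in lebesgue. ennreal (x powr (real k * c) * W x) * indicator {0<..<r} x = 0"
    unfolding \<Phi>_def wint_def
    by (subst (asm) nn_integral_0_iff_AE) (auto intro!: borel_measurable_times_ennreal borel_measurable_indicator pm)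
  then have "AE x in lebesgue. x \<notin> {0<..<r}"
    using AE_u_ext_pos
  proof eventually_elim
    case (elim x)
    show ?case
    proof
      assume x: "x \<in> {0<..<r}"
      then have "0 < x powr (real k * c) * W x" using elim(2) by (simp add: W_def)
      then show False using elim(1) x by simp
    qed
  qed
  then have "{0<..<r} \<in> null_sets lebesgue" by (subst (asm) AE_iff_null_sets[symmetric]) auto
  then show False using r by (simp add: null_sets_def)
qed

lemma K_pos: "0 < r \<Longrightarrow> 0 < K k r"
  unfolding K_def using \<Phi>_finite[of r k] \<Phi>_pos[of r k] by (subst powr_gt_zero) (auto simp: enn2real_positive_iff less_top intro!: less_imp_neq[symmetric])

lemma \<Phi>_eq: "0 < r \<Longrightarrow> \<Phi> k r = ennreal (K k r powr c)"
  using \<Phi>_finite[of r k] c_ge_1 by (simp add: K_def powr_powr less_top)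

lemma epow_\<Phi>: "0 < r \<Longrightarrow> epow (\<Phi> k r) (1 / c) = ennreal (K k r)"
  using \<Phi>_finite[of r k] by (simp add: K_def epow_def)

lemma cond_A_iff:
  "cond_A l p q u v b \<longleftrightarrow> (\<forall>k<l. \<exists>A>0. \<forall>r>0. Lnorm_on {r<..} q v (d_coeff l b k) * ennreal (K k r) \<le> ennreal A)"
proof -
  have eq: "Lnorm_on {r<..} q v (d_coeff l b k) *
        epow (\<integral>\<^sup>+x. ennreal (x powr (real k * conj_exp p)) * neg_conj_pow u p x \<partial>lebesgue_on {0<..<r}) (1 / conj_exp p)
    = Lnorm_on {r<..} q v (d_coeff l b k) * ennreal (K k r)" if "0 < r" for r k
    using epow_\<Phi>[OF that, of k] by (simp add: wint_eq \<Phi>_def)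
  have "(SUP r\<in>{0<..}. F r) < \<infinity> \<longleftrightarrow> (\<exists>A>0. \<forall>r>0. F r \<le> ennreal A)" for F :: "real \<Rightarrow> ennreal"
  proof
    assume *: "(SUP r\<in>{0<..}. F r) < \<infinity>"
    define A where "A = enn2real (SUP r\<in>{0<..}. F r) + 1"
    have "F r \<le> ennreal A" if "0 < r" for r
    proof -
      have "F r \<le> (SUP r\<in>{0<..}. F r)" using that by (intro SUP_upper) auto
      also have "\<dots> = ennreal (enn2real (SUP r\<in>{0<..}. F r))" using * by simp
      also have "\<dots> \<le> ennreal A" unfolding A_def by (intro ennreal_leI) simp
      finally show ?thesis .
    qed
    moreover have "0 < A" unfolding A_def by (simp add: add_nonneg_pos)
    ultimately show "\<exists>A>0. \<forall>r>0. F r \<le> ennreal A" by blast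
  next
    assume "\<exists>A>0. \<forall>r>0. F r \<le> ennreal A"
    then obtain A where "(SUP r\<in>{0<..}. F r) \<le> ennreal A" by (auto intro!: SUP_least)
    then show "(SUP r\<in>{0<..}. F r) < \<infinity>" by (simp add: le_less_trans)
  qed
  then show ?thesis unfolding cond_A_def using eq by (simp cong: SUP_cong)
qed

text \<open>
  Hoelder's inequality for \<open>t\<^sup>k g = (u g) (t\<^sup>k / u)\<close>.
\<close>

lemma hoelder_weight:
  assumes g: "g \<in> borel_measurable (lebesgue_on {0<..})" and ab: "0 \<le> a" "a < b"
    and A: "Lnorm_on {a<..<b} p u g \<le> ennreal A" "0 < A"
  shows "(\<integral>\<^sup>+x. ennreal (x ^ k * cmod (g x)) * indicator {a<..<b} x \<partial>lebesgue) \<le> ennreal (A * K k b)"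
proof -
  let ?M = "lebesgue_on {a<..<b}"
  have gm [measurable]: "g \<in> borel_measurable ?M" by (rule borel_measurable_lebesgue_on_subset[OF g]) (use ab in auto)
  have um [measurable]: "u \<in> borel_measurable ?M" by (rule borel_measurable_lebesgue_on_subset[OF u_meas]) (use ab in auto)
  have u_ext_m [measurable]: "u_ext \<in> borel_measurable ?M" by (rule measurable_restrict_space1) measurable
  have idm [measurable]: "(\<lambda>x. x) \<in> borel_measurable ?M" by (rule measurable_restrict_space1, rule measurable_completion) simp
  let ?h = "\<lambda>x. cmod (of_real (u x) * g x)" and ?k = "\<lambda>x. \<bar>x\<bar> ^ k * u_ext x powr (-1)"
  have hm: "?h \<in> borel_measurable ?M" "?k \<in> borel_measurable ?M"
    by measurable
  have "(\<integral>\<^sup>+x. ennreal (?h x * ?k x) \<partial>?M) \<le> ennreal (A * K k b)"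
  proof (rule Hoelder_le[OF p hm])
    show "Lp_norm ?M p ?h \<le> ennreal A" using A(1) by (simp add: Lnorm_on_eq_Lp_norm)
    have "(\<integral>\<^sup>+x. ennreal (?k x powr c) \<partial>?M) = (\<integral>\<^sup>+x. ennreal (?k x powr c) * indicator {a<..<b} x \<partial>lebesgue)"
      by (rule nn_integral_lebesgue_on) simp
    also have "\<dots> \<le> \<Phi> k b"
      unfolding \<Phi>_def wint_def
    proof (rule nn_integral_mono)
      fix x
      show "ennreal (?k x powr c) * indicator {a<..<b} x \<le> ennreal (x powr (real k * c) * W x) * indicator {0<..<b} x"
      proof (cases "x \<in> {a<..<b}")
        case True
        then have x: "0 < x" using ab by simp
        have "?k x powr c = x powr (real k * c) * W x"
        proof -
          have "?k x = x powr real k * u_ext x powr (-1)" using x by (simp only: abs_of_pos powr_realpow)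
          then have "?k x powr c = (x powr real k) powr c * (u_ext x powr (-1)) powr c" by (simp only: powr_mult)
          then show ?thesis by (simp only: powr_powr W_def mult_minus1)
        qed
        then show ?thesis using True x by simp
      qed simp
    qed
    also have "\<dots> = ennreal (K k b powr c)" using ab by (intro \<Phi>_eq) simp
    finally show "(\<integral>\<^sup>+x. ennreal (?k x powr c) \<partial>?M) \<le> ennreal (K k b powr c)" .
    show "0 < K k b" using ab by (intro K_pos) simp
  qed (use A u_ext_nonneg in auto)
  also have "(\<integral>\<^sup>+x. ennreal (?h x * ?k x) \<partial>?M) = (\<integral>\<^sup>+x. ennreal (?h x * ?k x) * indicator {a<..<b} x \<partial>lebesgue)"
    by (rule nn_integral_lebesgue_on) simp
  also have "\<dots> = (\<integral>\<^sup>+x. ennreal (x ^ k * cmod (g x)) * indicator {a<..<b} x \<partial>lebesgue)"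
  proof (rule nn_integral_cong_AE)
    show "AE x in lebesgue. ennreal (?h x * ?k x) * indicator {a<..<b} x = ennreal (x ^ k * cmod (g x)) * indicator {a<..<b} x"
      using AE_u_ext_pos
    proof eventually_elim
      case (elim x)
      show ?case
      proof (cases "x \<in> {a<..<b}")
        case True
        then have x: "0 < x" using ab by simp
        have "?h x * ?k x = x ^ k * cmod (g x)"
          using x elim by (simp add: u_ext_def norm_mult powr_minus powr_one)
        then show ?thesis by simp
      qed simp
    qed
  qed
  finally show ?thesis .
qed

lemma hoelder_weight_fin:
  assumes g: "g \<in> borel_measurable (lebesgue_on {0<..})" and fin: "Lnorm p u g < \<infinity>" and ab: "0 \<le> a" "a < b"
  obtains A where "0 < A" "Lnorm_on {a<..<b} p u g \<le> ennreal A"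
proof -
  have [measurable]: "g \<in> borel_measurable (lebesgue_on {0<..})" "u \<in> borel_measurable (lebesgue_on {0<..})" by (fact g, fact u_meas)
  have "Lnorm_on {a<..<b} p u g \<le> Lnorm p u g"
    unfolding Lnorm_on_eq_Lp_norm using ab by (intro Lp_norm_lebesgue_on_mono p) auto
  also have "\<dots> \<le> ennreal (enn2real (Lnorm p u g) + 1)"
    using fin by (metis ennreal_enn2real ennreal_leI less_add_one less_imp_le infinity_ennreal_def)
  finally show thesis using that[of "enn2real (Lnorm p u g) + 1"] by (simp add: add_nonneg_pos)
qed

lemma moment_integrable:
  assumes g: "g \<in> borel_measurable (lebesgue_on {0<..})" and fin: "Lnorm p u g < \<infinity>" and ab: "0 \<le> a"
  shows "(\<lambda>t. of_real (t ^ k) * g t) absolutely_integrable_on {a..b}"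
proof (cases "a < b")
  case True
  obtain A where A: "0 < A" "Lnorm_on {a<..<b} p u g \<le> ennreal A" using hoelder_weight_fin[OF g fin ab True] .
  define h where "h t = (if 0 < t then of_real (t ^ k) * g t else 0)" for t
  have "(\<lambda>t. (of_real (t ^ k) :: complex)) \<in> borel_measurable (lebesgue_on {0<..})"
    by (rule measurable_restrict_space1, rule measurable_completion) simp
  then have hm: "h \<in> borel_measurable lebesgue"
    unfolding h_def[abs_def] using g by (intro lebesgue_on_extend_measurable borel_measurable_times)
  have "(\<integral>\<^sup>+x. ennreal (norm (h x)) * indicator {a<..<b} x \<partial>lebesgue) = (\<integral>\<^sup>+x. ennreal (x ^ k * cmod (g x)) * indicator {a<..<b} x \<partial>lebesgue)"
    using ab by (intro nn_integral_cong) (auto simp: h_def indicator_def norm_mult norm_power)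
  also have "\<dots> \<le> ennreal (A * K k b)" by (rule hoelder_weight[OF g ab True A(2,1)])
  finally have "h absolutely_integrable_on {a..b}"
    using hm by (intro absolutely_integrable_of_nn_integral) (auto simp: le_less_trans)
  moreover have "negligible {0::real}" by simp
  ultimately show ?thesis
    by (rule absolutely_integrable_spike) (use ab in \<open>auto simp: h_def\<close>)
next
  case False
  then have "{a..b} \<subseteq> {a}" by auto
  then have "negligible {a..b}" using negligible_subset[of "{a}"] by simp
  then show ?thesis by (rule absolutely_integrable_negligible)
qed

text \<open>
  The increasing majorant of the moment. The cut-off for \<open>t \<le> 0\<close> makes it vanish on the left half-line,
  so that it is continuous and monotone on the whole line.
\<close>

definition abs_moment :: "(real \<Rightarrow> complex) \<Rightarrow> nat \<Rightarrow> real \<Rightarrow> real" where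
  "abs_moment g k x = integral {0..x} (\<lambda>t. if 0 < t then t ^ k * cmod (g t) else 0)"

context
  fixes g :: "real \<Rightarrow> complex" and k :: nat
  assumes g: "g \<in> borel_measurable (lebesgue_on {0<..})" and fin: "Lnorm p u g < \<infinity>"
begin

definition "abs_integrand t = (if 0 < t then t ^ k * cmod (g t) else 0)"

lemma abs_integrand_measurable [measurable]: "abs_integrand \<in> borel_measurable lebesgue"
proof -
  have [measurable]: "(\<lambda>t. t ^ k :: real) \<in> borel_measurable (lebesgue_on {0<..})"
    by (rule measurable_restrict_space1, rule measurable_completion) simp
  have [measurable]: "g \<in> borel_measurable (lebesgue_on {0<..})" by (rule g)
  show ?thesis
    unfolding abs_integrand_def[abs_def] by (rule lebesgue_on_extend_measurable) measurable
qed

lemma abs_integrand_nonneg: "0 \<le> abs_integrand t" by (simp add: abs_integrand_def)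

lemma abs_integrand_integrable: "abs_integrand absolutely_integrable_on {a..b}"
proof -
  have "abs_integrand absolutely_integrable_on {0..max 1 b}"
  proof (rule absolutely_integrable_of_nn_integral)
    have b: "(0::real) < max 1 b" by simp
    obtain A where A: "0 < A" "Lnorm_on {0<..<max 1 b} p u g \<le> ennreal A" using hoelder_weight_fin[OF g fin order_refl b] .
    have "(\<integral>\<^sup>+x. ennreal (norm (abs_integrand x)) * indicator {0<..<max 1 b} x \<partial>lebesgue) = (\<integral>\<^sup>+x. ennreal (x ^ k * cmod (g x)) * indicator {0<..<max 1 b} x \<partial>lebesgue)"
      by (intro nn_integral_cong) (auto simp: abs_integrand_def indicator_def)
    also have "\<dots> \<le> ennreal (A * K k (max 1 b))" by (rule hoelder_weight[OF g order_refl b A(2,1)])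
    finally show "(\<integral>\<^sup>+x. ennreal (norm (abs_integrand x)) * indicator {0<..<max 1 b} x \<partial>lebesgue) < \<infinity>"
      by (simp add: le_less_trans)
  qed measurable
  then have "integrable lebesgue (\<lambda>x. indicator {0..max 1 b} x *\<^sub>R abs_integrand x)" unfolding set_integrable_def .
  then have "integrable lebesgue (\<lambda>x. indicator {a..b} x *\<^sub>R (indicator {0..max 1 b} x *\<^sub>R abs_integrand x))"
    by (rule integrable_mult_indicator[rotated]) simp
  also have "(\<lambda>x. indicator {a..b} x *\<^sub>R (indicator {0..max 1 b} x *\<^sub>R abs_integrand x)) = (\<lambda>x. indicator {a..b} x *\<^sub>R abs_integrand x)"
    by (auto simp: fun_eq_iff indicator_def abs_integrand_def)
  finally show ?thesis unfolding set_integrable_def .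
qed

lemma abs_integrand_integrable_on: "abs_integrand integrable_on {a..b}"
  using abs_integrand_integrable by (rule set_lebesgue_integral_eq_integral(1))

lemma abs_moment_eq: "abs_moment g k x = integral {0..x} abs_integrand"
  by (simp add: abs_moment_def abs_integrand_def[abs_def])

lemma abs_moment_diff: "0 \<le> a \<Longrightarrow> a \<le> b \<Longrightarrow> abs_moment g k b - abs_moment g k a = integral {a..b} abs_integrand"
  using Henstock_Kurzweil_Integration.integral_combine[of 0 a b abs_integrand] abs_integrand_integrable_on
  by (simp add: abs_moment_eq)

lemma abs_moment_nonpos: "x \<le> 0 \<Longrightarrow> abs_moment g k x = 0"
  by (cases "x = 0") (auto simp: abs_moment_def)

lemma abs_moment_mono: "mono (abs_moment g k)"
proof (rule monoI)
  fix x y :: real assume xy: "x \<le> y"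
  have 1: "0 \<le> integral {a..b} abs_integrand" for a b
    by (intro Henstock_Kurzweil_Integration.integral_nonneg abs_integrand_integrable_on abs_integrand_nonneg)
  show "abs_moment g k x \<le> abs_moment g k y"
  proof (cases "x \<le> 0")
    case True
    then show ?thesis using 1[of 0 y] abs_moment_eq[of y] abs_moment_nonpos[OF True] by simp
  next
    case False
    then show ?thesis using abs_moment_diff[of x y] 1[of x y] xy by simp
  qed
qed

lemma abs_moment_continuous: "continuous_on UNIV (abs_moment g k)"
proof -
  have eq: "abs_moment g k y = integral {-N..y} abs_integrand" if "- N \<le> y" "0 \<le> N" for N y
  proof (cases "0 \<le> y")
    case True
    have "integral {-N..0} abs_integrand = 0"
      by (rule integral_unique, rule has_integral_is_0) (auto simp: abs_integrand_def)
    then show ?thesis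
      using Henstock_Kurzweil_Integration.integral_combine[of "-N" 0 y abs_integrand] True that abs_integrand_integrable_on
      by (simp add: abs_moment_eq)
  next
    case False
    have "integral {-N..y} abs_integrand = 0"
      by (rule integral_unique, rule has_integral_is_0) (use False in \<open>auto simp: abs_integrand_def\<close>)
    then show ?thesis using False by (simp add: abs_moment_nonpos)
  qed
  have "isCont (abs_moment g k) x" for x
  proof -
    define N where "N = \<bar>x\<bar> + 1"
    have N: "0 \<le> N" "x \<in> {-N<..<N}" by (auto simp: N_def abs_less_iff)
    have "continuous_on {-N..N} (\<lambda>y. integral {-N..y} abs_integrand)"
      by (rule indefinite_integral_continuous_1[OF abs_integrand_integrable_on])
    then have "continuous_on {-N..N} (abs_moment g k)"
      by (rule continuous_on_eq) (use eq N in auto)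
    then show ?thesis
      using N continuous_on_interior[of "{-N..N}" "abs_moment g k" x] by (simp add: interior_atLeastAtMost_real)
  qed
  then show ?thesis by (simp add: continuous_at_imp_continuous_on)
qed

lemma abs_moment_diff_le:
  assumes ab: "0 \<le> a" "a < b" and A: "Lnorm_on {a<..<b} p u g \<le> ennreal A" "0 < A"
  shows "abs_moment g k b - abs_moment g k a \<le> A * K k b"
proof -
  have "ennreal (abs_moment g k b - abs_moment g k a) = (\<integral>\<^sup>+x. ennreal (abs_integrand x) * indicator {a<..<b} x \<partial>lebesgue)"
    using ab by (subst abs_moment_diff) (auto intro!: integral_eq_nn_integral_open abs_integrand_nonneg abs_integrand_integrable)
  also have "\<dots> = (\<integral>\<^sup>+x. ennreal (x ^ k * cmod (g x)) * indicator {a<..<b} x \<partial>lebesgue)"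
    using ab by (intro nn_integral_cong) (auto simp: abs_integrand_def indicator_def)
  also have "\<dots> \<le> ennreal (A * K k b)" by (rule hoelder_weight[OF g ab A])
  finally show ?thesis
    using A(2) K_pos[of b k] ab by (subst (asm) ennreal_le_iff) auto
qed

lemma cmod_moment_le: "cmod (moment g k x) \<le> abs_moment g k x"
proof (cases "0 \<le> x")
  case True
  have ai: "(\<lambda>t. of_real (t ^ k) * g t) absolutely_integrable_on {0..x}"
    by (rule moment_integrable[OF g fin order_refl])
  have "cmod (moment g k x) \<le> integral {0..x} (\<lambda>t. if t = 0 then cmod (of_real (t ^ k) * g t) else abs_integrand t)"
    unfolding moment_def
  proof (rule integral_norm_bound_integral)
    show "(\<lambda>t. of_real (t ^ k) * g t) integrable_on {0..x}" using ai by (rule set_lebesgue_integral_eq_integral(1))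
    show "(\<lambda>t. if t = 0 then cmod (of_real (t ^ k) * g t) else abs_integrand t) integrable_on {0..x}"
      by (rule integrable_spike[OF abs_integrand_integrable_on negligible_sing[of 0]]) auto
  qed (auto simp: abs_integrand_def norm_mult norm_power)
  also have "\<dots> = abs_moment g k x"
    unfolding abs_moment_eq by (rule integral_spike[OF negligible_sing[of 0]]) auto
  finally show ?thesis .
qed (simp add: moment_def abs_moment_nonpos)

end

end

context weight
begin

lemma moment_continuous:
  assumes g: "g \<in> borel_measurable (lebesgue_on {0<..})" and fin: "Lnorm p u g < \<infinity>"
  shows "continuous_on {0<..} (moment g k)"
proof -
  have "isCont (moment g k) x" if "0 < x" for x
  proof -
    have "continuous_on {0..x + 1} (moment g k)"
      unfolding moment_def[abs_def]
      by (intro indefinite_integral_continuous_1 set_lebesgue_integral_eq_integral(1) moment_integrable[OF g fin]) simp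
    then show ?thesis
      using that continuous_on_interior[of "{0..x + 1}" "moment g k" x] by (simp add: interior_atLeastAtMost_real)
  qed
  then show ?thesis by (simp add: continuous_at_imp_continuous_on)
qed

lemma moment_measurable:
  assumes g: "g \<in> borel_measurable (lebesgue_on {0<..})" and fin: "Lnorm p u g < \<infinity>"
  shows "moment g k \<in> borel_measurable (lebesgue_on {0<..})"
  by (intro continuous_imp_measurable_on_sets_lebesgue moment_continuous[OF g fin]) simp

lemma Lnorm_on_mono_set:
  assumes w: "w \<in> borel_measurable (lebesgue_on {0<..})" and g: "g \<in> borel_measurable (lebesgue_on {0<..})"
    and q: "1 < q" and S: "S \<in> sets lebesgue" "S \<subseteq> {0<..}"
  shows "Lnorm_on S q w g \<le> Lnorm q w g"
proof -
  have [measurable]: "g \<in> borel_measurable (lebesgue_on {0<..})" "w \<in> borel_measurable (lebesgue_on {0<..})" by fact+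
  show ?thesis unfolding Lnorm_on_eq_Lp_norm using S by (intro Lp_norm_lebesgue_on_mono q) auto
qed

text \<open>
  The modulus of the moment is at most \<open>abs_moment\<close>, which has the properties of \<open>H\<close> in \<open>dyadic_Hardy\<close>;
  Hoelder's inequality on subintervals supplies its increment condition. For \<open>q = \<infinity>\<close> no decomposition is
  needed: the two estimates at a common point \<open>r\<close> slightly to the left of \<open>x\<close> are multiplied.
\<close>

theorem weighted_Hardy:
  assumes g: "g \<in> borel_measurable (lebesgue_on {0<..})" and N: "Lnorm p u g \<le> ennreal N" "0 < N"
    and q: "p \<le> q" and v: "v \<in> borel_measurable (lebesgue_on {0<..})" and d: "d \<in> borel_measurable (lebesgue_on {0<..})"
    and A: "0 < A" "\<And>r. 0 < r \<Longrightarrow> Lnorm_on {r<..} q v d * ennreal (K k r) \<le> ennreal A"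
  shows "Lnorm q v (\<lambda>x. d x * moment g k x) \<le> ennreal (4 * A * N)"
proof -
  have q1: "1 < q" using p q by simp
  have fin: "Lnorm p u g < \<infinity>" using N by (simp add: le_less_trans)
  have [measurable]: "g \<in> borel_measurable (lebesgue_on {0<..})" "v \<in> borel_measurable (lebesgue_on {0<..})"
    "d \<in> borel_measurable (lebesgue_on {0<..})" "moment g k \<in> borel_measurable (lebesgue_on {0<..})"
    "u \<in> borel_measurable (lebesgue_on {0<..})"
    using g v d moment_measurable[OF g fin] u_meas by auto
  define H where "H = abs_moment g k"
  have H: "mono H" "continuous_on UNIV H" "\<And>x. x \<le> 0 \<Longrightarrow> H x = 0" "\<And>x. cmod (moment g k x) \<le> H x"
    unfolding H_def using abs_moment_mono[OF g fin] abs_moment_continuous[OF g fin] abs_moment_nonpos[OF g fin] cmod_moment_le[OF g fin] by auto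
  have H0: "0 \<le> H x" for x using H(4)[of x] norm_ge_zero order_trans by blast
  define \<phi> where "\<phi> x = (if 0 < x then cmod (of_real (v x) * d x) else 0)" for x
  have \<phi>m: "\<phi> \<in> borel_measurable lebesgue"
    unfolding \<phi>_def[abs_def] by (rule lebesgue_on_extend_measurable) measurable
  have \<phi>m': "\<phi> \<in> borel_measurable (lebesgue_on S)" for S
    using \<phi>m by (rule measurable_restrict_space1)
  have tail: "Lp_norm (lebesgue_on {r<..}) q \<phi> \<le> ennreal (A / K k r)" if r: "0 < r" for r
  proof -
    have "Lnorm_on {r<..} q v d = Lp_norm (lebesgue_on {r<..}) q \<phi>"
      unfolding Lnorm_on_eq_Lp_norm
    proof (rule Lp_norm_cong_AE[OF q1])
      show "(\<lambda>x. cmod (of_real (v x) * d x)) \<in> borel_measurable (lebesgue_on {r<..})"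
        by (rule borel_measurable_lebesgue_on_subset[of _ "{0<..}"]) (measurable, use r in auto)
      show "AE x in lebesgue_on {r<..}. 0 \<le> cmod (of_real (v x) * d x) \<and> cmod (of_real (v x) * d x) = \<phi> x"
        using r by (intro AE_I2) (auto simp: \<phi>_def)
    qed (rule \<phi>m')
    moreover have "Lnorm_on {r<..} q v d \<le> ennreal (A / K k r)"
      using A(2)[OF r] K_pos[OF r, of k] A(1)
      by (cases "Lnorm_on {r<..} q v d") (auto simp: ennreal_mult[symmetric] ennreal_le_iff ennreal_top_mult pos_le_divide_eq top_unique)
    ultimately show ?thesis by simp
  qed
  have Hle: "H b - H a \<le> A' * K k b" if "0 \<le> a" "a < b" "Lnorm_on {a<..<b} p u g \<le> ennreal A'" "0 < A'" for a b A'
    unfolding H_def using abs_moment_diff_le[OF g fin that] .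
  show ?thesis
  proof (cases "q = \<infinity>")
    case True
    have "AE x in lebesgue. r < x \<longrightarrow> \<phi> x \<le> A / K k r" if "0 < r" for r
    proof -
      have "AE x in lebesgue_on {r<..}. \<phi> x \<le> A / K k r"
        using tail[OF that] True A(1) K_pos[OF that, of k] \<phi>m' by (subst Lp_norm_le_iff_infinite[symmetric]) auto
      then show ?thesis by (subst (asm) AE_lebesgue_on_iff) auto
    qed
    \<comment> \<open>The exceptional null set of the tail bound depends on \<open>r\<close>; rational \<open>r\<close> are enough because \<open>H\<close> is
      continuous.\<close>
    then have "AE x in lebesgue. \<forall>r\<in>\<rat> \<inter> {0<..}. r < x \<longrightarrow> \<phi> x \<le> A / K k r"
      by (subst AE_ball_countable) (auto intro: countable_subset[OF _ countable_rat])
    then have ae: "AE x in lebesgue. 0 < x \<longrightarrow> \<phi> x * H x \<le> A * N"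
    proof eventually_elim
      case (elim x)
      show ?case
      proof (intro impI, rule ccontr)
        assume x: "0 < x" and nle: "\<not> \<phi> x * H x \<le> A * N"
        have "isCont H x" using H(2) by (simp add: continuous_on_eq_continuous_at)
        then have "((\<lambda>y. \<phi> x * H y) \<longlongrightarrow> \<phi> x * H x) (at_left x)"
          by (intro tendsto_intros) (simp add: isCont_def filterlim_at_split)
        then have "\<forall>\<^sub>F y in at_left x. A * N < \<phi> x * H y" using nle by (intro order_tendstoD(1)) auto
        then obtain y where y: "y < x" "\<And>z. y < z \<Longrightarrow> z < x \<Longrightarrow> A * N < \<phi> x * H z"
          by (auto simp: eventually_at_left_field)
        obtain r where r: "r \<in> \<rat>" "max y 0 < r" "r < x" using Rats_dense_in_real[of "max y 0" x] x y(1) by auto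
        then have "\<phi> x \<le> A / K k r" using elim by auto
        moreover have "H r \<le> N * K k r"
        proof -
          have "Lnorm_on {0<..<r} p u g \<le> ennreal N"
            by (rule order_trans[OF Lnorm_on_mono_set[OF u_meas g p] N(1)]) auto
          then show ?thesis using Hle[of 0 r N] r N(2) H(3)[of 0] by simp
        qed
        ultimately have "\<phi> x * H r \<le> A / K k r * (N * K k r)"
          using H0[of r] A(1) K_pos[of r k] r by (intro mult_mono) auto
        also have "\<dots> = A * N" using K_pos[of r k] r by simp
        finally show False using y(2)[of r] r by simp
      qed
    qed
    have "AE x in lebesgue_on {0<..}. cmod (of_real (v x) * (d x * moment g k x)) \<le> 4 * A * N"
    proof (subst AE_lebesgue_on_iff)
      show "AE x in lebesgue. x \<in> {0<..} \<longrightarrow> cmod (of_real (v x) * (d x * moment g k x)) \<le> 4 * A * N"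
        using ae
      proof eventually_elim
        case (elim x)
        show ?case
        proof
          assume x: "x \<in> {0<..}"
          then have "cmod (of_real (v x) * (d x * moment g k x)) = \<phi> x * cmod (moment g k x)"
            by (simp add: \<phi>_def norm_mult)
          also have "\<dots> \<le> \<phi> x * H x" using H(4) by (intro mult_left_mono) (auto simp: \<phi>_def)
          also have "\<dots> \<le> A * N" using elim x by simp
          also have "\<dots> \<le> 4 * A * N" using A N by simp
          finally show "cmod (of_real (v x) * (d x * moment g k x)) \<le> 4 * A * N" .
        qed
      qed
    qed simp
    then show ?thesis
      unfolding Lnorm_on_eq_Lp_norm True using A N
      by (subst Lp_norm_le_iff_infinite) auto
  next
    case qf: False
    have pf: "p \<noteq> \<infinity>" using q qf by (auto simp: top_unique)
    define P Q where "P = enn2real p" and "Q = enn2real q"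
    have PQ: "1 < P" "P \<le> Q"
      using exponent_real(1)[OF p pf] enn2real_mono[OF q] qf unfolding P_def Q_def
      by (auto simp: less_top[symmetric])
    define n where "n x = (if 0 < x then cmod (of_real (u x) * g x) powr P else 0)" for x
    have nm: "n \<in> borel_measurable lebesgue"
      unfolding n_def[abs_def] by (rule lebesgue_on_extend_measurable) measurable
    have n_int: "(\<integral>\<^sup>+x. ennreal (n x) * indicator S x \<partial>lebesgue) = (\<integral>\<^sup>+x. ennreal (cmod (of_real (u x) * g x) powr P) \<partial>lebesgue_on S)"
      if "S \<in> sets lebesgue" "S \<subseteq> {0<..}" for S
      using that by (subst nn_integral_lebesgue_on) (auto intro!: nn_integral_cong simp: n_def indicator_def)
    have nN: "(\<integral>\<^sup>+x. ennreal (n x) * indicator {0<..} x \<partial>lebesgue) \<le> ennreal (N powr P)"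
    proof -
      have "Lp_norm (lebesgue_on {0<..}) p (\<lambda>x. cmod (of_real (u x) * g x)) \<le> ennreal N"
        using N(1) by (simp only: Lnorm_on_eq_Lp_norm)
      then have "(\<integral>\<^sup>+x. ennreal (cmod (of_real (u x) * g x) powr P) \<partial>lebesgue_on {0<..}) \<le> ennreal (N powr P)"
        unfolding P_def using N(2) by (subst (asm) Lp_norm_le_iff_finite[OF p pf]) simp_all
      then show ?thesis by (subst n_int) simp_all
    qed
    have "(\<integral>\<^sup>+x. ennreal ((\<phi> x * H x) powr Q) * indicator {0<..} x \<partial>lebesgue) \<le> ennreal ((4 * A) powr Q * (N powr P) powr (Q / P))"
    proof (rule dyadic_Hardy[where n = n and K = "K k"])
      show "1 \<le> P" "P \<le> Q" using PQ by auto
      show "H b - H a \<le> enn2real (\<integral>\<^sup>+x. ennreal (n x) * indicator {a<..<b} x \<partial>lebesgue) powr (1 / P) * K k b"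
        if ab: "0 \<le> a" "a < b" for a b
      proof -
        have Kb: "0 < K k b" using ab by (intro K_pos) simp
        define \<nu> where "\<nu> = enn2real (\<integral>\<^sup>+x. ennreal (n x) * indicator {a<..<b} x \<partial>lebesgue)"
        have "(\<integral>\<^sup>+x. ennreal (n x) * indicator {a<..<b} x \<partial>lebesgue) \<le> (\<integral>\<^sup>+x. ennreal (n x) * indicator {0<..} x \<partial>lebesgue)"
          using ab by (intro nn_integral_mono) (auto simp: indicator_def)
        also have "\<dots> < \<infinity>" using nN by (simp add: le_less_trans)
        finally have \<nu>: "(\<integral>\<^sup>+x. ennreal (n x) * indicator {a<..<b} x \<partial>lebesgue) = ennreal \<nu>" by (simp add: \<nu>_def less_top)
        have \<nu>0: "0 \<le> \<nu>" by (simp add: \<nu>_def)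
        have "(H b - H a) / K k b \<le> \<nu> powr (1 / P)"
        \<comment> \<open>Strictly larger bounds \<open>A'\<close> on the norm are used because \<open>\<nu>\<close> may vanish, while Hoelder's inequality takes positive bounds.\<close>
        proof (rule dense_ge)
          fix A' assume A': "\<nu> powr (1 / P) < A'"
          have A'0: "0 < A'" using A' by (rule le_less_trans[rotated]) simp
          have "\<nu> = (\<nu> powr (1 / P)) powr P" using \<nu>0 PQ by (simp add: powr_powr)
          also have "\<dots> \<le> A' powr P" using A' PQ by (intro powr_mono2) auto
          finally have \<nu>_le: "ennreal \<nu> \<le> ennreal (A' powr P)" by (rule ennreal_leI)
          have sub: "{a<..<b} \<subseteq> {0<..}" using ab by auto
          have "(\<integral>\<^sup>+x. ennreal (cmod (of_real (u x) * g x) powr P) \<partial>lebesgue_on {a<..<b}) = ennreal \<nu>"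
            using n_int[OF _ sub] \<nu> by simp
          then have "Lnorm_on {a<..<b} p u g \<le> ennreal A'"
            unfolding Lnorm_on_eq_Lp_norm using A'0 \<nu>_le
            by (subst Lp_norm_le_iff_finite[OF p pf]) (simp_all add: P_def)
          then have "H b - H a \<le> A' * K k b" using Hle ab A'0 by blast
          then show "(H b - H a) / K k b \<le> A'" using Kb by (simp add: pos_divide_le_eq)
        qed
        then show ?thesis using Kb by (simp add: pos_divide_le_eq \<nu>_def)
      qed
      show "(\<integral>\<^sup>+x. ennreal (\<phi> x powr Q) * indicator {r<..} x \<partial>lebesgue) \<le> ennreal ((A / K k r) powr Q)" if "0 < r" for r
        using tail[OF that] A(1) K_pos[OF that, of k] Lp_norm_le_iff_finite[OF q1 qf, of "A / K k r" "lebesgue_on {r<..}" \<phi>]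
        by (simp add: nn_integral_lebesgue_on Q_def)
      show "0 \<le> \<phi> x" "0 \<le> n x" for x by (simp_all add: \<phi>_def n_def)
    qed (use A N H \<phi>m nm nN K_pos in auto)
    also have "(4 * A) powr Q * (N powr P) powr (Q / P) = (4 * A * N) powr Q"
      using PQ A N by (simp add: powr_powr powr_mult)
    finally have le: "(\<integral>\<^sup>+x. ennreal ((\<phi> x * H x) powr Q) * indicator {0<..} x \<partial>lebesgue) \<le> ennreal ((4 * A * N) powr Q)" .
    have "(\<integral>\<^sup>+x. ennreal (cmod (of_real (v x) * (d x * moment g k x)) powr Q) \<partial>lebesgue_on {0<..})
      \<le> (\<integral>\<^sup>+x. ennreal ((\<phi> x * H x) powr Q) * indicator {0<..} x \<partial>lebesgue)"
    proof (subst nn_integral_lebesgue_on, simp, rule nn_integral_mono)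
      fix x
      have "cmod (of_real (v x) * (d x * moment g k x)) powr Q \<le> (\<phi> x * H x) powr Q" if "0 < x"
        using that H(4)[of x] PQ by (intro powr_mono2) (auto simp: \<phi>_def norm_mult mult.assoc[symmetric] intro!: mult_left_mono)
      then show "ennreal (cmod (of_real (v x) * (d x * moment g k x)) powr Q) * indicator {0<..} x \<le> ennreal ((\<phi> x * H x) powr Q) * indicator {0<..} x"
        by (auto simp: indicator_def intro!: ennreal_leI)
    qed
    then show ?thesis
      unfolding Lnorm_on_eq_Lp_norm using le A N
      by (subst Lp_norm_le_iff_finite[OF q1 qf]) (auto simp: Q_def)
  qed
qed

end

section \<open>Iterated primitives\<close>

text \<open>
  This is \<open>\<integral>\<^sub>0\<^sup>z (x - t)\<^sup>n / n! g(t) dt\<close>, written through the moments of \<open>g\<close>. For \<open>z = x\<close> it is the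
  \<open>(n + 1)\<close>-fold primitive of \<open>g\<close>; the separate arguments allow the kernel and the upper limit to be varied
  one at a time when it is differentiated.
\<close>

definition volterra_poly :: "(real \<Rightarrow> complex) \<Rightarrow> nat \<Rightarrow> real \<Rightarrow> real \<Rightarrow> complex" where
  "volterra_poly g n x z = (\<Sum>j\<le>n. of_real ((-1) ^ j * x ^ (n - j) / (fact j * fact (n - j))) * moment g j z)"

definition volterra :: "(real \<Rightarrow> complex) \<Rightarrow> nat \<Rightarrow> real \<Rightarrow> complex" where
  "volterra g n x = volterra_poly g n x x"

text \<open>
  The binomial theorem, which turns the integral with kernel \<open>(x - t)\<^sup>n / n!\<close> into a combination of moments.
\<close>

lemma volterra_kernel:
  "(\<Sum>j\<le>n. ((-1) ^ j * x ^ (n - j) / (fact j * fact (n - j))) * t ^ j) = (x - t) ^ n / (fact n :: real)"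
proof -
  have "(x - t) ^ n = (\<Sum>j\<le>n. real (n choose j) * (- t) ^ j * x ^ (n - j))"
    using binomial_ring[of "- t" x n] by (simp add: algebra_simps)
  also have "\<dots> / fact n = (\<Sum>j\<le>n. ((-1) ^ j * x ^ (n - j) / (fact j * fact (n - j))) * t ^ j)"
    unfolding sum_divide_distrib
  proof (rule sum.cong[OF refl])
    fix j assume "j \<in> {..n}"
    then have "real (n choose j) = fact n / (fact j * fact (n - j))" by (intro binomial_fact) simp
    then show "real (n choose j) * (- t) ^ j * x ^ (n - j) / fact n = (-1) ^ j * x ^ (n - j) / (fact j * fact (n - j)) * t ^ j"
      by (simp add: power_minus[of t j])
  qed
  finally show ?thesis by simp
qed

context weight
begin

lemma volterra_poly_diff:
  assumes g: "g \<in> borel_measurable (lebesgue_on {0<..})" and fin: "Lnorm p u g < \<infinity>" and z: "0 \<le> z" "z \<le> z'"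
  shows "(\<lambda>t. of_real ((y - t) ^ n / fact n) * g t) integrable_on {z..z'}"
    and "volterra_poly g n y z' - volterra_poly g n y z = integral {z..z'} (\<lambda>t. of_real ((y - t) ^ n / fact n) * g t)"
proof -
  have int: "(\<lambda>t. of_real (t ^ j) * g t) integrable_on {a..b}" if "0 \<le> a" for j a b
    using moment_integrable[OF g fin that] by (rule set_lebesgue_integral_eq_integral(1))
  define cf where "cf j = (of_real ((-1) ^ j * y ^ (n - j) / (fact j * fact (n - j))) :: complex)" for j
  have ker: "(\<Sum>j\<le>n. cf j * (of_real (t ^ j) * g t)) = of_real ((y - t) ^ n / fact n) * g t" for t
  proof -
    have "(\<Sum>j\<le>n. cf j * (of_real (t ^ j) * g t)) = of_real (\<Sum>j\<le>n. ((-1) ^ j * y ^ (n - j) / (fact j * fact (n - j))) * t ^ j) * g t"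
      by (simp add: cf_def sum_distrib_right mult.assoc)
    then show ?thesis by (simp only: volterra_kernel)
  qed
  have "(\<lambda>t. \<Sum>j\<le>n. cf j * (of_real (t ^ j) * g t)) integrable_on {z..z'}"
    using z int by (intro integrable_sum integrable_on_mult_right) auto
  then show "(\<lambda>t. of_real ((y - t) ^ n / fact n) * g t) integrable_on {z..z'}" by (simp only: ker)
  have md: "moment g j z' - moment g j z = integral {z..z'} (\<lambda>t. of_real (t ^ j) * g t)" for j
    unfolding moment_def
    by (simp only: Henstock_Kurzweil_Integration.integral_combine[OF z int[OF order_refl], symmetric] add_diff_cancel_left')
  have "volterra_poly g n y z' - volterra_poly g n y z = (\<Sum>j\<le>n. cf j * (moment g j z' - moment g j z))"
    by (simp add: volterra_poly_def cf_def sum_subtractf right_diff_distrib)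
  also have "\<dots> = (\<Sum>j\<le>n. integral {z..z'} (\<lambda>t. cf j * (of_real (t ^ j) * g t)))"
    by (simp add: md)
  also have "\<dots> = integral {z..z'} (\<lambda>t. \<Sum>j\<le>n. cf j * (of_real (t ^ j) * g t))"
    using z int by (intro integral_sum[symmetric] integrable_on_mult_right) auto
  finally show "volterra_poly g n y z' - volterra_poly g n y z = integral {z..z'} (\<lambda>t. of_real ((y - t) ^ n / fact n) * g t)"
    by (simp only: ker)
qed

text \<open>
  Between \<open>x\<close> and \<open>y\<close> the kernel \<open>(y - t)\<^sup>n\<^sup>+\<^sup>1\<close> is at most \<open>|y - x|\<close>.
\<close>

lemma volterra_poly_increment_le:
  assumes g: "g \<in> borel_measurable (lebesgue_on {0<..})" and fin: "Lnorm p u g < \<infinity>"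
    and xy: "0 < x" "0 < y" "\<bar>y - x\<bar> \<le> 1"
  shows "cmod (volterra_poly g (Suc n) y y - volterra_poly g (Suc n) y x) \<le> \<bar>y - x\<bar> * \<bar>abs_moment g 0 y - abs_moment g 0 x\<bar>"
proof -
  have main: "cmod (volterra_poly g (Suc n) y z' - volterra_poly g (Suc n) y z) \<le> \<bar>y - x\<bar> * (abs_moment g 0 z' - abs_moment g 0 z)"
    if z: "0 < z" "z \<le> z'" and le: "\<And>t. t \<in> {z..z'} \<Longrightarrow> \<bar>y - t\<bar> \<le> \<bar>y - x\<bar>" for z z'
  proof -
    have "cmod (volterra_poly g (Suc n) y z' - volterra_poly g (Suc n) y z) = cmod (integral {z..z'} (\<lambda>t. of_real ((y - t) ^ Suc n / fact (Suc n)) * g t))"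
      using z volterra_poly_diff(2)[OF g fin, of z z' "Suc n" y] by simp
    also have "\<dots> \<le> integral {z..z'} (\<lambda>t. \<bar>y - x\<bar> * abs_integrand g 0 t)"
    proof (rule integral_norm_bound_integral)
      show "(\<lambda>t. of_real ((y - t) ^ Suc n / fact (Suc n)) * g t) integrable_on {z..z'}"
        using z by (intro volterra_poly_diff(1)[OF g fin]) auto
      show "(\<lambda>t. \<bar>y - x\<bar> * abs_integrand g 0 t) integrable_on {z..z'}"
        using abs_integrand_integrable_on[OF g fin] by (rule integrable_on_mult_right)
      fix t assume t: "t \<in> {z..z'}"
      have "\<bar>y - t\<bar> ^ Suc n / fact (Suc n) \<le> \<bar>y - t\<bar> ^ Suc n / 1"
        by (intro divide_left_mono) (auto simp del: fact_Suc)
      also have "\<dots> \<le> \<bar>y - x\<bar> ^ Suc n" using le[OF t] by (simp add: power_mono del: power_Suc)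
      also have "\<dots> \<le> \<bar>y - x\<bar> ^ 1" using xy by (intro power_decreasing) auto
      finally have "\<bar>(y - t) ^ Suc n / fact (Suc n)\<bar> \<le> \<bar>y - x\<bar>" by (simp add: abs_divide power_abs del: power_Suc fact_Suc)
      then show "cmod (of_real ((y - t) ^ Suc n / fact (Suc n)) * g t) \<le> \<bar>y - x\<bar> * abs_integrand g 0 t"
        using t z unfolding norm_mult norm_of_real by (intro mult_mono) (auto simp: abs_integrand_def[OF g fin])
    qed
    also have "\<dots> = \<bar>y - x\<bar> * (abs_moment g 0 z' - abs_moment g 0 z)"
      using z by (subst abs_moment_diff[OF g fin]) auto
    finally show ?thesis .
  qed
  show ?thesis
  proof (cases "x \<le> y")
    case True
    then show ?thesis using main[of x y] xy monoD[OF abs_moment_mono[OF g fin, of 0] True] by simp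
  next
    case False
    have "cmod (volterra_poly g (Suc n) y x - volterra_poly g (Suc n) y y) \<le> \<bar>y - x\<bar> * (abs_moment g 0 x - abs_moment g 0 y)"
      using main[of y x] xy False by simp
    then show ?thesis
      using False monoD[OF abs_moment_mono[OF g fin, of 0], of y x] by (simp add: norm_minus_commute)
  qed
qed

text \<open>
  Only the kernel contributes: the change of the upper limit is of smaller order than \<open>|y - x|\<close>, as
  the kernel vanishes on the diagonal and \<open>abs_moment\<close> is continuous.
\<close>

theorem volterra_has_derivative:
  assumes g: "g \<in> borel_measurable (lebesgue_on {0<..})" and fin: "Lnorm p u g < \<infinity>" and x: "0 < x"
  shows "(volterra g (Suc n) has_vector_derivative volterra g n x) (at x)"
proof -
  define e where "e y = volterra_poly g (Suc n) y y - volterra_poly g (Suc n) y x" for y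
  have "((\<lambda>y. volterra_poly g (Suc n) y x) has_vector_derivative volterra g n x) (at x)"
  proof -
    define cf where "cf j = (of_real ((-1) ^ j / (fact j * fact (Suc n - j))) * moment g j x :: complex)" for j
    have eq: "volterra_poly g (Suc n) y x = (\<Sum>j\<le>Suc n. of_real (y ^ (Suc n - j)) * cf j)" for y
      unfolding volterra_poly_def cf_def by (intro sum.cong) auto
    have "((\<lambda>y. \<Sum>j\<le>Suc n. of_real (y ^ (Suc n - j)) * cf j) has_vector_derivative
        (\<Sum>j\<le>Suc n. of_real (real (Suc n - j) * x ^ (Suc n - j - 1)) * cf j)) (at x)"
      by (rule has_vector_derivative_sum, rule has_vector_derivative_mult_left, rule has_vector_derivative_of_real)
        (auto intro!: derivative_eq_intros)
    also have "(\<Sum>j\<le>Suc n. of_real (real (Suc n - j) * x ^ (Suc n - j - 1)) * cf j) = (\<Sum>j\<le>n. of_real (real (Suc n - j) * x ^ (Suc n - j - 1)) * cf j)"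
      by simp
    also have "\<dots> = volterra g n x"
      unfolding volterra_def volterra_poly_def cf_def
    proof (rule sum.cong[OF refl])
      fix j assume j: "j \<in> {..n}"
      then have s: "Suc n - j = Suc (n - j)" by auto
      have "real (Suc n - j) * x ^ (Suc n - j - 1) * ((-1) ^ j / (fact j * fact (Suc n - j))) = (-1) ^ j * x ^ (n - j) / (fact j * fact (n - j))"
        unfolding s fact_Suc by (simp del: of_nat_Suc)
      then show "of_real (real (Suc n - j) * x ^ (Suc n - j - 1)) * (of_real ((-1) ^ j / (fact j * fact (Suc n - j))) * moment g j x)
        = of_real ((-1) ^ j * x ^ (n - j) / (fact j * fact (n - j))) * moment g j x"
        unfolding mult.assoc[symmetric] of_real_mult[symmetric] by simp
    qed
    finally show ?thesis unfolding eq .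
  qed
  moreover have "(e has_vector_derivative 0) (at x)"
    unfolding has_vector_derivative_def
  proof (rule has_derivativeI_sandwich[where e = "min 1 x" and H = "\<lambda>y. \<bar>abs_moment g 0 y - abs_moment g 0 x\<bar>"])
    show "0 < min 1 x" using x by simp
    have "isCont (abs_moment g 0) x"
      using abs_moment_continuous[OF g fin, of 0] by (simp add: continuous_on_eq_continuous_at)
    then have "((\<lambda>y. \<bar>abs_moment g 0 y - abs_moment g 0 x\<bar>) \<longlongrightarrow> \<bar>abs_moment g 0 x - abs_moment g 0 x\<bar>) (at x)"
      unfolding isCont_def by (intro tendsto_intros)
    then show "((\<lambda>y. \<bar>abs_moment g 0 y - abs_moment g 0 x\<bar>) \<longlongrightarrow> 0) (at x)" by simp
    fix y assume y: "y \<noteq> x" "dist y x < min 1 x"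
    then have "0 < y" "\<bar>y - x\<bar> \<le> 1" by (auto simp: dist_real_def)
    then have "norm (e y) \<le> \<bar>y - x\<bar> * \<bar>abs_moment g 0 y - abs_moment g 0 x\<bar>"
      unfolding e_def using x by (intro volterra_poly_increment_le[OF g fin]) auto
    then show "norm (e y - e x - (y - x) *\<^sub>R 0) / norm (y - x) \<le> \<bar>abs_moment g 0 y - abs_moment g 0 x\<bar>"
      using y by (simp add: e_def pos_divide_le_eq mult.commute)
  qed (auto intro: bounded_linear_zero)
  ultimately have "((\<lambda>y. volterra_poly g (Suc n) y x + e y) has_vector_derivative volterra g n x + 0) (at x)"
    by (rule has_vector_derivative_add)
  then show ?thesis by (simp add: e_def volterra_def[abs_def])
qed

lemma volterra_tendsto_0:
  assumes g: "g \<in> borel_measurable (lebesgue_on {0<..})" and fin: "Lnorm p u g < \<infinity>"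
  shows "(volterra g n \<longlongrightarrow> 0) (at_right 0)"
proof -
  have m0: "(moment g j \<longlongrightarrow> 0) (at_right 0)" for j
  proof (rule Lim_null_comparison)
    show "\<forall>\<^sub>F x in at_right 0. norm (moment g j x) \<le> abs_moment g j x"
      using cmod_moment_le[OF g fin] by (intro always_eventually) auto
    have "isCont (abs_moment g j) 0"
      using abs_moment_continuous[OF g fin, of j] by (simp add: continuous_on_eq_continuous_at)
    then show "(abs_moment g j \<longlongrightarrow> 0) (at_right 0)"
      using abs_moment_nonpos[OF g fin, of 0 j] by (simp add: isCont_def filterlim_at_split)
  qed
  have "((\<lambda>x. \<Sum>j\<le>n. of_real ((-1) ^ j * x ^ (n - j) / (fact j * fact (n - j))) * moment g j x) \<longlongrightarrow>
    (\<Sum>j\<le>n. of_real ((-1) ^ j * 0 ^ (n - j) / (fact j * fact (n - j))) * 0)) (at_right 0)"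
    by (intro tendsto_intros m0) auto
  then show ?thesis by (simp add: volterra_def[abs_def] volterra_poly_def)
qed

lemma volterra_0: "volterra g 0 x = moment g 0 x"
  by (simp add: volterra_def volterra_poly_def)

lemma AE_volterra_0_has_derivative:
  assumes g: "g \<in> borel_measurable (lebesgue_on {0<..})" and fin: "Lnorm p u g < \<infinity>"
  shows "negligible {x \<in> {0<..}. \<not> (volterra g 0 has_vector_derivative g x) (at x)}"
proof -
  have eq: "volterra g 0 = (\<lambda>x. integral {0..x} g)" by (auto simp: fun_eq_iff volterra_0 moment_def)
  have "negligible {x \<in> {0<..<real n}. \<not> (volterra g 0 has_vector_derivative g x) (at x)}" for n
    unfolding eq using moment_integrable[OF g fin order_refl, where k = 0 and b = "real n"]
    by (intro negligible_not_has_derivative_indefinite_integral) simp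
  then have "negligible (\<Union>n. {x \<in> {0<..<real n}. \<not> (volterra g 0 has_vector_derivative g x) (at x)})"
    by (intro negligible_Union_nat)
  then show ?thesis
    by (rule negligible_subset) (auto intro: reals_Archimedean2)
qed

end

section \<open>Taylor's formula for the operator\<close>

lemma abs_cont_on_cong:
  assumes "abs_cont_on S f" "\<And>x. x \<in> S \<Longrightarrow> g x = f x"
  shows "abs_cont_on S g"
  unfolding abs_cont_on_def
proof (intro allI impI)
  fix e :: real assume "e > 0"
  obtain d where d: "0 < d"
    "\<And>I. \<lbrakk>finite I; \<And>s t. (s, t) \<in> I \<Longrightarrow> s < t \<and> {s..t} \<subseteq> S; disjoint_family_on (\<lambda>(s, t). {s<..<t}) I;
       (\<Sum>(s, t)\<in>I. t - s) < d\<rbrakk> \<Longrightarrow> (\<Sum>(s, t)\<in>I. cmod (f t - f s)) < e"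
    using abs_cont_onD[OF assms(1) \<open>e > 0\<close>] by metis
  have "(\<Sum>(s, t)\<in>I. cmod (g t - g s)) < e"
    if I: "finite I" "\<forall>(s, t)\<in>I. s < t \<and> {s..t} \<subseteq> S" "disjoint_family_on (\<lambda>(s, t). {s<..<t}) I"
      "(\<Sum>(s, t)\<in>I. t - s) < d" for I
  proof -
    have st: "s < t \<and> {s..t} \<subseteq> S" if "(s, t) \<in> I" for s t using I(2) that by blast
    have "cmod (g (snd i) - g (fst i)) = cmod (f (snd i) - f (fst i))" if "i \<in> I" for i
    proof -
      have "fst i \<in> {fst i..snd i}" "snd i \<in> {fst i..snd i}" "{fst i..snd i} \<subseteq> S" using st[of "fst i" "snd i"] that by auto
      then have "fst i \<in> S" "snd i \<in> S" by blast+
      then show ?thesis using assms(2) by simp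
    qed
    then have "(\<Sum>(s, t)\<in>I. cmod (g t - g s)) = (\<Sum>(s, t)\<in>I. cmod (f t - f s))"
      unfolding case_prod_unfold by (intro sum.cong) auto
    then show ?thesis using d(2)[OF I(1) st I(3,4)] by simp
  qed
  then show "\<exists>\<delta>>0. \<forall>I. finite I \<longrightarrow> (\<forall>(a, b)\<in>I. a < b \<and> {a..b} \<subseteq> S) \<longrightarrow>
        disjoint_family_on (\<lambda>(a, b). {a<..<b}) I \<longrightarrow>
        (\<Sum>(a, b)\<in>I. b - a) < \<delta> \<longrightarrow> (\<Sum>(a, b)\<in>I. cmod (g b - g a)) < e"
    using d(1) by blast
qed

lemma nth_deriv_Suc: "nth_deriv (Suc k) f x = vector_derivative (nth_deriv k f) (at x)"
  by (simp add: nth_deriv_def)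

lemma has_vector_derivative_cong_open:
  assumes "open S" "x \<in> S" "\<And>y. y \<in> S \<Longrightarrow> f y = g y"
  shows "(f has_vector_derivative D) (at x) \<longleftrightarrow> (g has_vector_derivative D) (at x)"
  using has_vector_derivative_transform_within_open[of f D x S g]
    has_vector_derivative_transform_within_open[of g D x S f] assms by auto

text \<open>
  Derivatives at points of the open half-line depend only on the values there, so a chain of functions
  each of which differentiates to the next computes \<open>nth_deriv\<close> even if \<open>f\<close> is different elsewhere.
\<close>

lemma nth_deriv_chain:
  assumes f: "\<And>x. 0 < x \<Longrightarrow> f x = F 0 x"
    and F: "\<And>m x. m < n \<Longrightarrow> 0 < x \<Longrightarrow> (F m has_vector_derivative F (Suc m) x) (at x)"
    and "m \<le> n" "0 < x"
  shows "nth_deriv m f x = F m x"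
  using assms(3,4)
proof (induction m arbitrary: x)
  case 0
  then show ?case using f by (simp add: nth_deriv_def)
next
  case (Suc m)
  have "(nth_deriv m f has_vector_derivative F (Suc m) x) (at x)"
    using Suc F[of m x] by (subst has_vector_derivative_cong_open[of "{0<..}" x _ "F m"]) auto
  then show ?case unfolding nth_deriv_Suc by (rule vector_derivative_at)
qed

lemma nth_deriv_monomial:
  assumes "0 < x"
  shows "nth_deriv m (\<lambda>x. of_real x ^ k) x = (if m \<le> k then of_real (fact k / fact (k - m) * x ^ (k - m)) else 0)"
proof -
  define F where "F m x = (if m \<le> k then of_real (fact k / fact (k - m) * x ^ (k - m)) else 0 :: complex)" for m and x :: real
  have "nth_deriv m (\<lambda>x. of_real x ^ k) x = F m x"
  proof (rule nth_deriv_chain[where n = m])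
    show "of_real x ^ k = F 0 x" for x by (simp add: F_def)
    fix j and x :: real assume "0 < x"
    show "(F j has_vector_derivative F (Suc j) x) (at x)"
    proof (cases "j < k")
      case True
      then have s: "k - j = Suc (k - Suc j)" by simp
      have Fj: "F j = (\<lambda>y. of_real (fact k / fact (k - j) * y ^ (k - j)))"
        using True by (intro ext) (simp add: F_def)
      have FS: "F (Suc j) x = of_real (fact k / fact (k - Suc j) * x ^ (k - Suc j))"
        using True by (simp add: F_def)
      have "((\<lambda>y. of_real (fact k / fact (k - j) * y ^ (k - j)) :: complex) has_vector_derivative of_real (fact k / fact (k - j) * (real (k - j) * x ^ (k - j - 1)))) (at x)"
        by (rule has_vector_derivative_of_real) (auto intro!: derivative_eq_intros)
      also have "fact k / fact (k - j) * (real (k - j) * x ^ (k - j - 1)) = fact k / fact (k - Suc j) * x ^ (k - Suc j)"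
        unfolding s fact_Suc by (simp del: of_nat_Suc)
      finally show ?thesis unfolding Fj FS .
    next
      case False
      then have "F j = (\<lambda>x. if j = k then of_real (fact k) else 0)" "F (Suc j) x = 0" by (auto simp: F_def fun_eq_iff)
      then show ?thesis by (simp add: has_vector_derivative_const)
    qed
  qed (use assms in auto)
  then show ?thesis by (simp add: F_def)
qed

lemma negligible_half_line:
  assumes "\<And>n::nat. negligible {x \<in> {1 / real (Suc n)<..<real (Suc n)}. P x}"
  shows "negligible {x \<in> {0<..}. P x}"
proof -
  have "negligible (\<Union>n. {x \<in> {1 / real (Suc n)<..<real (Suc n)}. P x})"
    using assms by (intro negligible_Union_nat)
  moreover have "{x \<in> {0<..}. P x} \<subseteq> (\<Union>n. {x \<in> {1 / real (Suc n)<..<real (Suc n)}. P x})"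
  proof
    fix x assume x: "x \<in> {x \<in> {0<..}. P x}"
    obtain n :: nat where n: "max x (1 / x) < real n" using reals_Archimedean2 by blast
    then have "x < real (Suc n)" "1 / x < real (Suc n)" by auto
    then have "1 / real (Suc n) < x" using x by (simp add: field_simps)
    then show "x \<in> (\<Union>n. {x \<in> {1 / real (Suc n)<..<real (Suc n)}. P x})" using x \<open>x < real (Suc n)\<close>
      by (intro UN_I[of n]) simp_all
  qed
  ultimately show ?thesis by (rule negligible_subset)
qed

text \<open>
  Although \<open>nth_deriv l f\<close> has arbitrary values where \<open>nth_deriv (l - 1) f\<close> is not differentiable, this is
  a null set; integrability over compact intervals then yields measurability.
\<close>

lemma has_ac_deriv_top:
  assumes l: "l \<ge> 1" and f: "has_ac_deriv l f"
  shows has_ac_deriv_has_integral: "0 < a \<Longrightarrow> a \<le> b \<Longrightarrow> (nth_deriv l f has_integral (nth_deriv (l - 1) f b - nth_deriv (l - 1) f a)) {a..b}"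
    and has_ac_deriv_measurable: "nth_deriv l f \<in> borel_measurable (lebesgue_on {0<..})"
proof -
  define \<phi> where "\<phi> = nth_deriv (l - 1) f"
  define g where "g = nth_deriv l f"
  have g_eq: "g x = vector_derivative \<phi> (at x)" for x
    using nth_deriv_Suc[of "l - 1" f x] l by (simp add: g_def \<phi>_def)
  have ac: "abs_cont_on {a..b} \<phi>" if "0 < a" "a < b" for a b
    using f that unfolding has_ac_deriv_def \<phi>_def by blast
  let ?N = "{x \<in> {0<..}. \<not> (\<phi> has_vector_derivative g x) (at x)}"
  have neg: "negligible ?N"
  proof (rule negligible_half_line)
    fix n :: nat
    show "negligible {x \<in> {1 / real (Suc n)<..<real (Suc n)}. \<not> (\<phi> has_vector_derivative g x) (at x)}"
    proof (cases "n = 0")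
      case False
      then have "1 < real (Suc n)" by simp
      then have "1 / real (Suc n) < 1" "1 < real (Suc n)" by (simp_all only: divide_less_eq_1_pos zero_less_one order_less_trans[OF zero_less_one])
      then have "1 / real (Suc n) < real (Suc n)" by (rule order_less_trans)
      then have "negligible {x \<in> {1 / real (Suc n)<..<real (Suc n)}. \<not> \<phi> differentiable (at x)}"
        by (intro negligible_not_differentiable_abs_cont ac) auto
      then show ?thesis
        by (rule negligible_subset) (auto simp: g_eq vector_derivative_works)
    qed simp
  qed
  have int: "(g has_integral (\<phi> b - \<phi> a)) {a..b}" if ab: "0 < a" "a \<le> b" for a b
  proof (cases "a = b")
    case False
    show ?thesis
    proof (rule has_integral_abs_cont_derivative[OF ab(2) _ neg])
      show "abs_cont_on {a..b} \<phi>" using ac ab False by simp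
      show "(\<phi> has_vector_derivative g x) (at x within {a..b})" if "x \<in> {a..b} - ?N" for x
      proof (rule has_vector_derivative_at_within)
        have "x \<in> {0<..}" using that ab by auto
        then show "(\<phi> has_vector_derivative g x) (at x)" using that by blast
      qed
    qed
  qed (simp add: has_integral_refl)
  then show "0 < a \<Longrightarrow> a \<le> b \<Longrightarrow> (nth_deriv l f has_integral (nth_deriv (l - 1) f b - nth_deriv (l - 1) f a)) {a..b}"
    by (simp add: \<phi>_def g_def)
  define G where "G n x = (if x \<in> {1 / real (Suc n)..real (Suc n)} then g x else 0)" for n x
  have Gm: "G n \<in> borel_measurable lebesgue" for n
  proof -
    have "1 / real (Suc n) \<le> 1" "1 \<le> real (Suc n)" by simp_all
    then have "1 / real (Suc n) \<le> real (Suc n)" by (rule order_trans)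
    moreover have "0 < 1 / real (Suc n)" by simp
    ultimately have "g integrable_on {1 / real (Suc n)..real (Suc n)}" using int has_integral_integrable by blast
    then have "g \<in> borel_measurable (lebesgue_on {1 / real (Suc n)..real (Suc n)})"
      by (rule integrable_imp_measurable)
    then show ?thesis
      unfolding G_def[abs_def] by (subst borel_measurable_if) auto
  qed
  have Glim: "(\<lambda>n. G n x) \<longlonglongrightarrow> (if x \<in> {0<..} then g x else 0)" for x
  proof (rule tendsto_eventually)
    show "\<forall>\<^sub>F n in sequentially. G n x = (if x \<in> {0<..} then g x else 0)"
    proof (cases "0 < x")
      case True
      obtain N :: nat where N: "max x (1 / x) < real N" using reals_Archimedean2 by blast
      show ?thesis
        unfolding eventually_sequentially
      proof (intro exI[of _ N] allI impI)
        fix n assume "N \<le> n"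
        then have "x < real (Suc n)" "1 / x < real (Suc n)" using N by auto
        then have "1 / real (Suc n) < x" using True by (simp add: field_simps)
        then show "G n x = (if x \<in> {0<..} then g x else 0)" using True \<open>x < real (Suc n)\<close> by (simp add: G_def del: of_nat_Suc)
      qed
    next
      case False
      have "G n x = 0" for n
      proof -
        have "0 < 1 / real (Suc n)" by simp
        then have "x < 1 / real (Suc n)" using False by linarith
        then show ?thesis by (simp add: G_def)
      qed
      then show ?thesis using False by simp
    qed
  qed
  have "(\<lambda>x. if x \<in> {0<..} then g x else 0) \<in> borel_measurable lebesgue"
    by (rule borel_measurable_LIMSEQ_metric[OF Gm Glim])
  then have "g \<in> borel_measurable (lebesgue_on {0<..})"
    by (rule iffD1[OF borel_measurable_if, rotated]) simp
  then show "nth_deriv l f \<in> borel_measurable (lebesgue_on {0<..})"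
    by (simp add: g_def)
qed

definition taylor_poly :: "(nat \<Rightarrow> complex) \<Rightarrow> nat \<Rightarrow> nat \<Rightarrow> real \<Rightarrow> complex" where
  "taylor_poly a l m x = (\<Sum>k\<in>{m..<l}. of_real (x ^ (k - m) / fact (k - m)) * a k)"

lemma taylor_poly_has_derivative:
  assumes "m < l"
  shows "(taylor_poly a l m has_vector_derivative taylor_poly a l (Suc m) x) (at x)"
proof -
  have "(taylor_poly a l m has_vector_derivative (\<Sum>k\<in>{m..<l}. of_real (real (k - m) * x ^ (k - m - 1) / fact (k - m)) * a k)) (at x)"
    unfolding taylor_poly_def[abs_def]
    by (rule has_vector_derivative_sum, rule has_vector_derivative_mult_left, rule has_vector_derivative_of_real)
      (auto intro!: derivative_eq_intros)
  also have "(\<Sum>k\<in>{m..<l}. of_real (real (k - m) * x ^ (k - m - 1) / fact (k - m)) * a k) = (\<Sum>k\<in>{Suc m..<l}. of_real (real (k - m) * x ^ (k - m - 1) / fact (k - m)) * a k)"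
    using assms by (subst sum.atLeast_Suc_lessThan) auto
  also have "\<dots> = taylor_poly a l (Suc m) x"
    unfolding taylor_poly_def
  proof (rule sum.cong[OF refl])
    fix k assume k: "k \<in> {Suc m..<l}"
    then have s: "k - m = Suc (k - Suc m)" by auto
    have "real (k - m) * x ^ (k - m - 1) / fact (k - m) = x ^ (k - Suc m) / fact (k - Suc m)"
      unfolding s fact_Suc by (simp del: of_nat_Suc)
    then show "of_real (real (k - m) * x ^ (k - m - 1) / fact (k - m)) * a k = of_real (x ^ (k - Suc m) / fact (k - Suc m)) * a k"
      by simp
  qed
  finally show ?thesis .
qed

lemma taylor_poly_tendsto:
  assumes "m < l"
  shows "(taylor_poly a l m \<longlongrightarrow> a m) (at_right 0)"
proof -
  have "(taylor_poly a l m \<longlongrightarrow> (\<Sum>k\<in>{m..<l}. of_real (0 ^ (k - m) / fact (k - m)) * a k)) (at_right 0)"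
    unfolding taylor_poly_def[abs_def] by (intro tendsto_intros) auto
  also have "(\<Sum>k\<in>{m..<l}. of_real (0 ^ (k - m) / fact (k - m)) * a k) = a m + (\<Sum>k\<in>{Suc m..<l}. of_real (0 ^ (k - m) / fact (k - m)) * a k)"
    using assms by (subst sum.atLeast_Suc_lessThan) auto
  also have "(\<Sum>k\<in>{Suc m..<l}. of_real (0 ^ (k - m) / fact (k - m)) * a k) = 0"
    by (intro sum.neutral) auto
  finally show ?thesis by simp
qed

text \<open>
  The operator applied to the function with \<open>l\<close>-th derivative \<open>g\<close> and vanishing initial values, as a
  function of \<open>g\<close>.
\<close>

definition reduced_op :: "nat \<Rightarrow> (nat \<Rightarrow> real \<Rightarrow> complex) \<Rightarrow> (real \<Rightarrow> complex) \<Rightarrow> real \<Rightarrow> complex" where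
  "reduced_op l b g x = (\<Sum>j<l. of_real ((-1) ^ j / fact j) * (d_coeff l b j x * moment g j x)) + b l x * g x"

lemma triangle_sum_swap:
  fixes t :: "nat \<Rightarrow> nat \<Rightarrow> complex"
  shows "(\<Sum>m<l. \<Sum>j\<le>l - 1 - m. t m j) = (\<Sum>j<l. \<Sum>m\<le>l - 1 - j. t m j)"
proof -
  have *: "(\<Sum>j\<le>l - 1 - m. s j) = (\<Sum>j<l. if m + j < l then s j else 0)" if "m < l" for m and s :: "nat \<Rightarrow> complex"
  proof -
    have "{..l - 1 - m} = {j \<in> {..<l}. m + j < l}" using that by auto
    then show ?thesis by (simp only: sum.inter_filter[OF finite_lessThan])
  qed
  have "(\<Sum>m<l. \<Sum>j\<le>l - 1 - m. t m j) = (\<Sum>m<l. \<Sum>j<l. if m + j < l then t m j else 0)"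
    by (rule sum.cong[OF refl]) (simp only: lessThan_iff *)
  also have "\<dots> = (\<Sum>j<l. \<Sum>m<l. if m + j < l then t m j else 0)" by (rule sum.swap)
  also have "\<dots> = (\<Sum>j<l. \<Sum>m\<le>l - 1 - j. t m j)"
  proof (rule sum.cong[OF refl])
    fix j assume "j \<in> {..<l}"
    then have "j < l" by simp
    from *[OF this, of "\<lambda>m. t m j"]
    show "(\<Sum>m<l. if m + j < l then t m j else 0) = (\<Sum>m\<le>l - 1 - j. t m j)"
      by (simp only: add.commute[of j])
  qed
  finally show ?thesis .
qed

text \<open>
  Both sides are double sums over \<open>m + j < l\<close>; the inner sum over \<open>m\<close> is the coefficient \<open>d\<^sub>j\<close>.
\<close>

lemma volterra_part_eq:
  "(\<Sum>m<l. b m x * volterra g (l - 1 - m) x) = (\<Sum>j<l. of_real ((-1) ^ j / fact j) * (d_coeff l b j x * moment g j x))"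
proof -
  have "(\<Sum>m<l. b m x * volterra g (l - 1 - m) x)
    = (\<Sum>m<l. \<Sum>j\<le>l - 1 - m. b m x * of_real ((-1) ^ j * x ^ (l - 1 - m - j) / (fact j * fact (l - 1 - m - j))) * moment g j x)"
    by (simp add: volterra_def volterra_poly_def sum_distrib_left mult.assoc)
  also have "\<dots> = (\<Sum>j<l. \<Sum>m\<le>l - 1 - j. b m x * of_real ((-1) ^ j * x ^ (l - 1 - m - j) / (fact j * fact (l - 1 - m - j))) * moment g j x)"
    by (rule triangle_sum_swap)
  also have "\<dots> = (\<Sum>j<l. of_real ((-1) ^ j / fact j) * (d_coeff l b j x * moment g j x))"
  proof (rule sum.cong[OF refl])
    fix j
    show "(\<Sum>m\<le>l - 1 - j. b m x * of_real ((-1) ^ j * x ^ (l - 1 - m - j) / (fact j * fact (l - 1 - m - j))) * moment g j x)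
      = of_real ((-1) ^ j / fact j) * (d_coeff l b j x * moment g j x)"
      unfolding d_coeff_def sum_distrib_left sum_distrib_right
      by (intro sum.cong) (auto simp: add.commute mult_ac)
  qed
  finally show ?thesis .
qed

lemma taylor_part_eq:
  assumes "0 < x"
  shows "(\<Sum>m<l. b m x * taylor_poly a l m x) = (\<Sum>k<l. a k / fact k * diff_op l b (\<lambda>x. of_real x ^ k) x)"
proof -
  define s where "s m k = b m x * (of_real (x ^ (k - m) / fact (k - m)) * a k)" for m k
  have "(\<Sum>m<l. b m x * taylor_poly a l m x) = (\<Sum>m<l. \<Sum>k<l. if m \<le> k then s m k else 0)"
    unfolding taylor_poly_def sum_distrib_left s_def[symmetric]
  proof (rule sum.cong[OF refl])
    fix m
    have "{m..<l} = {k \<in> {..<l}. m \<le> k}" by auto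
    then show "sum (s m) {m..<l} = (\<Sum>k<l. if m \<le> k then s m k else 0)"
      by (simp only: sum.inter_filter[OF finite_lessThan])
  qed
  also have "\<dots> = (\<Sum>k<l. \<Sum>m<l. if m \<le> k then s m k else 0)" by (rule sum.swap)
  also have "\<dots> = (\<Sum>k<l. a k / fact k * diff_op l b (\<lambda>x. of_real x ^ k) x)"
  proof (rule sum.cong[OF refl])
    fix k assume k: "k \<in> {..<l}"
    have "diff_op l b (\<lambda>x. of_real x ^ k) x = (\<Sum>m\<le>l. if m \<le> k then b m x * of_real (fact k / fact (k - m) * x ^ (k - m)) else 0)"
      unfolding diff_op_def using assms by (intro sum.cong) (auto simp: nth_deriv_monomial)
    also have "\<dots> = (\<Sum>m<l. if m \<le> k then b m x * of_real (fact k / fact (k - m) * x ^ (k - m)) else 0)"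
      using k by (simp add: lessThan_Suc_atMost[symmetric])
    finally have "a k / fact k * diff_op l b (\<lambda>x. of_real x ^ k) x = (\<Sum>m<l. if m \<le> k then a k / fact k * (b m x * of_real (fact k / fact (k - m) * x ^ (k - m))) else 0)"
      by (simp only: sum_distrib_left if_distrib[of "\<lambda>z. a k / fact k * z"] mult_zero_right)
    also have "\<dots> = (\<Sum>m<l. if m \<le> k then s m k else 0)"
      by (intro sum.cong) (auto simp: s_def)
    finally show "(\<Sum>m<l. if m \<le> k then s m k else 0) = a k / fact k * diff_op l b (\<lambda>x. of_real x ^ k) x" by simp
  qed
  finally show ?thesis .
qed

context weight
begin

text \<open>
  Descending induction on \<open>m\<close>: the difference of the two sides has derivative \<open>0\<close> and tends to \<open>0\<close> at \<open>0\<close>.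
  For \<open>m = l - 1\<close>, \<open>f\<^sup>(\<^sup>m\<^sup>)\<close> is the integral of its derivative on \<open>[y, x]\<close>, and \<open>y\<close> tends to \<open>0\<close>.
\<close>

theorem taylor_representation:
  assumes f: "has_ac_deriv l f" and lim: "\<And>k. k < l \<Longrightarrow> (nth_deriv k f \<longlongrightarrow> a k) (at_right 0)"
    and fin: "Lnorm p u (nth_deriv l f) < \<infinity>" and "m < l" "0 < x"
  shows "nth_deriv m f x = taylor_poly a l m x + volterra (nth_deriv l f) (l - 1 - m) x"
proof -
  define g where "g = nth_deriv l f"
  have l: "l \<ge> 1" using \<open>m < l\<close> by simp
  have g: "g \<in> borel_measurable (lebesgue_on {0<..})" unfolding g_def by (rule has_ac_deriv_measurable[OF l f])
  have fin: "Lnorm p u g < \<infinity>" using fin by (simp add: g_def)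
  have "n < l \<Longrightarrow> 0 < x \<Longrightarrow> nth_deriv (l - 1 - n) f x = taylor_poly a l (l - 1 - n) x + volterra g n x" for n x
  proof (induction n arbitrary: x)
    case 0
    have "(nth_deriv (l - 1) f \<longlongrightarrow> nth_deriv (l - 1) f x - volterra g 0 x + 0) (at_right 0)"
    proof (rule Lim_transform_eventually)
      show "((\<lambda>y. nth_deriv (l - 1) f x - volterra g 0 x + volterra g 0 y) \<longlongrightarrow> nth_deriv (l - 1) f x - volterra g 0 x + 0) (at_right 0)"
        by (intro tendsto_intros volterra_tendsto_0[OF g fin])
      have "\<forall>\<^sub>F y in at_right 0. y \<in> {0<..<x}" using 0 by (intro eventually_at_right_real)
      then show "\<forall>\<^sub>F y in at_right 0. nth_deriv (l - 1) f x - volterra g 0 x + volterra g 0 y = nth_deriv (l - 1) f y"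
      proof eventually_elim
        case (elim y)
        have i0: "g integrable_on {0..x}"
          using moment_integrable[OF g fin order_refl, where k = 0 and b = x] set_lebesgue_integral_eq_integral(1) by simp
        have "(g has_integral (nth_deriv (l - 1) f x - nth_deriv (l - 1) f y)) {y..x}"
          unfolding g_def using elim by (intro has_ac_deriv_has_integral[OF l f]) auto
        then have "integral {y..x} g = nth_deriv (l - 1) f x - nth_deriv (l - 1) f y" by (rule integral_unique)
        moreover have "integral {0..y} g + integral {y..x} g = integral {0..x} g"
          using elim i0 by (intro Henstock_Kurzweil_Integration.integral_combine) auto
        ultimately have "integral {0..x} g = integral {0..y} g + (nth_deriv (l - 1) f x - nth_deriv (l - 1) f y)" by simp
        then show ?case by (simp add: volterra_0 moment_def)
      qed
    qed
    then have "nth_deriv (l - 1) f x - volterra g 0 x + 0 = a (l - 1)"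
      using lim[of "l - 1"] l by (intro tendsto_unique[OF trivial_limit_at_right_real]) auto
    moreover have "{l - 1..<l} = {l - 1}" using l by auto
    ultimately show ?case by (simp add: taylor_poly_def algebra_simps)
  next
    case (Suc n)
    define m where "m = l - 1 - Suc n"
    have m: "Suc m = l - 1 - n" "m < l - 1" "m < l" using Suc.prems by (auto simp: m_def)
    define d where "d y = nth_deriv m f y - taylor_poly a l m y - volterra g (Suc n) y" for y
    have "(d has_vector_derivative 0) (at y within {0<..})" if "y \<in> {0<..}" for y
    proof (rule has_vector_derivative_at_within)
      have y: "0 < y" using that by simp
      have "nth_deriv m f differentiable (at y)" using f m(2) y unfolding has_ac_deriv_def by blast
      then have "(nth_deriv m f has_vector_derivative nth_deriv (Suc m) f y) (at y)"
        unfolding nth_deriv_Suc by (simp add: vector_derivative_works)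
      then have "(d has_vector_derivative (nth_deriv (Suc m) f y - taylor_poly a l (Suc m) y - volterra g n y)) (at y)"
        unfolding d_def[abs_def] using m(3) y
        by (intro has_vector_derivative_diff taylor_poly_has_derivative volterra_has_derivative[OF g fin])
      also have "nth_deriv (Suc m) f y - taylor_poly a l (Suc m) y - volterra g n y = 0"
        using Suc.IH[of y] Suc.prems y m by simp
      finally show "(d has_vector_derivative 0) (at y)" .
    qed
    then obtain C where C: "\<And>y. y \<in> {0<..} \<Longrightarrow> d y = C"
      using has_vector_derivative_zero_constant[of "{0<..}" d] convex_real_interval by blast
    have "(d \<longlongrightarrow> a m - a m - 0) (at_right 0)"
      unfolding d_def[abs_def] by (intro tendsto_diff lim taylor_poly_tendsto volterra_tendsto_0[OF g fin] m(3))
    moreover have "(d \<longlongrightarrow> C) (at_right 0)"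
      using C by (intro tendsto_eventually) (auto simp: eventually_at_right_less eventually_at_filter)
    ultimately have "C = 0" using tendsto_unique[OF trivial_limit_at_right_real] by fastforce
    then show ?case using C[of x] Suc.prems by (simp add: d_def m_def diff_eq_eq add.commute)
  qed
  from this[of "l - 1 - m" x] show ?thesis using assms(4,5) by (simp add: g_def)
qed

theorem diff_op_representation:
  assumes f: "has_ac_deriv l f" and lim: "\<And>k. k < l \<Longrightarrow> (nth_deriv k f \<longlongrightarrow> a k) (at_right 0)"
    and fin: "Lnorm p u (nth_deriv l f) < \<infinity>" and x: "0 < x"
  shows "diff_op l b f x = (\<Sum>k<l. a k / fact k * diff_op l b (\<lambda>x. of_real x ^ k) x) + reduced_op l b (nth_deriv l f) x"
proof -
  have "diff_op l b f x = (\<Sum>m<l. b m x * nth_deriv m f x) + b l x * nth_deriv l f x"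
    unfolding diff_op_def by (simp add: lessThan_Suc_atMost[symmetric])
  also have "(\<Sum>m<l. b m x * nth_deriv m f x) = (\<Sum>m<l. b m x * taylor_poly a l m x) + (\<Sum>m<l. b m x * volterra (nth_deriv l f) (l - 1 - m) x)"
    unfolding sum.distrib[symmetric] distrib_left[symmetric]
    using taylor_representation[OF f lim fin _ x] by (intro sum.cong) auto
  finally show ?thesis
    by (simp only: taylor_part_eq[OF x] volterra_part_eq reduced_op_def add.assoc)
qed

text \<open>
  Every \<open>g\<close> of finite norm is the \<open>l\<close>-th derivative, almost everywhere, of a function with vanishing
  initial values; so estimates for the operator transfer to \<open>reduced_op\<close> without loss.
\<close>

lemma volterra_sobolev0:
  assumes l: "l \<ge> 1" and g: "g \<in> borel_measurable (lebesgue_on {0<..})" and fin: "Lnorm p u g < \<infinity>"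
  defines "f \<equiv> volterra g (l - 1)"
  shows "f \<in> sobolev0 l p u" and "sobolev0_norm l p u f = Lnorm p u g"
    and "\<And>j x. moment (nth_deriv l f) j x = moment g j x"
    and "AE x in lebesgue_on {0<..}. nth_deriv l f x = g x"
proof -
  have nd: "nth_deriv m f x = volterra g (l - 1 - m) x" if "m \<le> l - 1" "0 < x" for m x
  proof (rule nth_deriv_chain[where n = "l - 1"])
    show "f x = volterra g (l - 1 - 0) x" for x by (simp add: f_def)
    fix m and x :: real assume m: "m < l - 1" "0 < x"
    then have "l - 1 - m = Suc (l - 1 - Suc m)" by simp
    then show "(volterra g (l - 1 - m) has_vector_derivative volterra g (l - 1 - Suc m) x) (at x)"
      using volterra_has_derivative[OF g fin m(2)] by simp
  qed (use that in auto)
  have ac: "has_ac_deriv l f"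
    unfolding has_ac_deriv_def
  proof (intro conjI allI impI)
    fix k and x :: real assume k: "k < l - 1" and x: "0 < x"
    then have "l - 1 - k = Suc (l - 1 - Suc k)" by simp
    then have "(volterra g (l - 1 - k) has_vector_derivative volterra g (l - 1 - Suc k) x) (at x)"
      using volterra_has_derivative[OF g fin x] by simp
    then have "(nth_deriv k f has_vector_derivative volterra g (l - 1 - Suc k) x) (at x)"
      using nd[of k] k x by (subst has_vector_derivative_cong_open[of "{0<..}" x _ "volterra g (l - 1 - k)"]) auto
    then show "nth_deriv k f differentiable (at x)"
      by (auto simp: has_vector_derivative_def intro: differentiableI)
  next
    fix a b :: real assume ab: "0 < a" "a < b"
    have "abs_cont_on {0..b} (\<lambda>x. integral {0..x} g)"
      using moment_integrable[OF g fin order_refl, where k = 0 and b = b] by (intro abs_cont_on_indefinite_integral) simp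
    then have "abs_cont_on {a..b} (\<lambda>x. integral {0..x} g)"
      by (rule abs_cont_on_subset) (use ab in auto)
    moreover have "nth_deriv (l - 1) f x = integral {0..x} g" if "x \<in> {a..b}" for x
      using nd[of "l - 1" x] that ab by (simp add: volterra_0 moment_def)
    ultimately show "abs_cont_on {a..b} (nth_deriv (l - 1) f)"
      by (rule abs_cont_on_cong)
  qed
  have gm: "nth_deriv l f \<in> borel_measurable (lebesgue_on {0<..})" by (rule has_ac_deriv_measurable[OF l ac])
  have neg: "negligible {x \<in> {0<..}. nth_deriv l f x \<noteq> g x}"
  proof (rule negligible_subset[OF AE_volterra_0_has_derivative[OF g fin]], intro subsetI, rule ccontr)
    fix x assume x: "x \<in> {x \<in> {0<..}. nth_deriv l f x \<noteq> g x}"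
      and nx: "x \<notin> {x \<in> {0<..}. \<not> (volterra g 0 has_vector_derivative g x) (at x)}"
    then have "(volterra g 0 has_vector_derivative g x) (at x)" by auto
    then have "(nth_deriv (l - 1) f has_vector_derivative g x) (at x)"
      using nd[of "l - 1"] x by (subst has_vector_derivative_cong_open[of "{0<..}" x _ "volterra g 0"]) auto
    then have "nth_deriv (Suc (l - 1)) f x = g x" unfolding nth_deriv_Suc by (rule vector_derivative_at)
    then show False using x l by simp
  qed
  then have "AE x in lebesgue. x \<notin> {x \<in> {0<..}. nth_deriv l f x \<noteq> g x}"
    by (intro AE_not_in) (simp add: negligible_iff_null_sets)
  then show ae: "AE x in lebesgue_on {0<..}. nth_deriv l f x = g x"
    by (subst AE_lebesgue_on_iff) (auto elim!: eventually_mono)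
  have [measurable]: "g \<in> borel_measurable (lebesgue_on {0<..})" "nth_deriv l f \<in> borel_measurable (lebesgue_on {0<..})"
    "u \<in> borel_measurable (lebesgue_on {0<..})" using g gm u_meas by auto
  show norm: "sobolev0_norm l p u f = Lnorm p u g"
    unfolding sobolev0_norm_def Lnorm_on_eq_Lp_norm
    by (rule Lp_norm_cong_AE[OF p]) (measurable, use ae in \<open>auto elim!: eventually_mono\<close>)
  show "f \<in> sobolev0 l p u"
    unfolding sobolev0_def mem_Collect_eq
  proof (intro conjI allI impI ac)
    show "sobolev0_norm l p u f < \<infinity>" using norm fin by simp
    fix k assume "k < l"
    then have "\<forall>\<^sub>F x in at_right 0. volterra g (l - 1 - k) x = nth_deriv k f x"
      using nd[of k] by (auto simp: eventually_at_filter)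
    then show "(nth_deriv k f \<longlongrightarrow> 0) (at_right 0)"
      by (rule Lim_transform_eventually[OF volterra_tendsto_0[OF g fin]])
  qed
  show "moment (nth_deriv l f) j x = moment g j x" for j x
    unfolding moment_def
  proof (rule integral_spike)
    show "negligible ({x \<in> {0<..}. nth_deriv l f x \<noteq> g x} \<union> {0})" using neg by simp
  qed auto
qed

end

section \<open>Hardy terms and the multiplication term\<close>

lemma Lnorm_on_add_le:
  assumes q: "1 < q" and [measurable]: "w \<in> borel_measurable (lebesgue_on S)"
    "f \<in> borel_measurable (lebesgue_on S)" "g \<in> borel_measurable (lebesgue_on S)"
  shows "Lnorm_on S q w (\<lambda>x. f x + g x) \<le> Lnorm_on S q w f + Lnorm_on S q w g"
proof -
  have m: "(\<lambda>x. cmod (of_real (w x) * f x)) \<in> borel_measurable (lebesgue_on S)"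
    "(\<lambda>x. cmod (of_real (w x) * g x)) \<in> borel_measurable (lebesgue_on S)"
    by measurable
  have "Lnorm_on S q w (\<lambda>x. f x + g x) \<le> Lp_norm (lebesgue_on S) q (\<lambda>x. cmod (of_real (w x) * f x) + cmod (of_real (w x) * g x))"
    unfolding Lnorm_on_eq_Lp_norm
    by (rule Lp_norm_mono_AE[OF q]) (measurable, auto simp: distrib_left norm_triangle_ineq)
  also have "\<dots> \<le> Lnorm_on S q w f + Lnorm_on S q w g"
    unfolding Lnorm_on_eq_Lp_norm by (rule Lp_norm_add_le[OF q m]) auto
  finally show ?thesis .
qed

lemma Lnorm_on_cmult:
  assumes q: "1 < q" and [measurable]: "w \<in> borel_measurable (lebesgue_on S)"
    "f \<in> borel_measurable (lebesgue_on S)"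
  shows "Lnorm_on S q w (\<lambda>x. a * f x) = ennreal (cmod a) * Lnorm_on S q w f"
proof -
  have "Lnorm_on S q w (\<lambda>x. a * f x) = Lp_norm (lebesgue_on S) q (\<lambda>x. cmod a * cmod (of_real (w x) * f x))"
    by (simp add: Lnorm_on_eq_Lp_norm norm_mult mult_ac)
  also have "\<dots> = ennreal (cmod a) * Lnorm_on S q w f"
  proof -
    have m: "(\<lambda>x. cmod (of_real (w x) * f x)) \<in> borel_measurable (lebesgue_on S)" by measurable
    show ?thesis unfolding Lnorm_on_eq_Lp_norm by (rule Lp_norm_cmult[OF q m]) auto
  qed
  finally show ?thesis .
qed

lemma Lnorm_on_cong_AE:
  assumes q: "1 < q" and [measurable]: "w \<in> borel_measurable (lebesgue_on S)"
    "f \<in> borel_measurable (lebesgue_on S)" "g \<in> borel_measurable (lebesgue_on S)"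
    and eq: "AE x in lebesgue_on S. f x = g x"
  shows "Lnorm_on S q w f = Lnorm_on S q w g"
  unfolding Lnorm_on_eq_Lp_norm
proof (rule Lp_norm_cong_AE[OF q])
  show "AE x in lebesgue_on S. 0 \<le> cmod (of_real (w x) * f x) \<and> cmod (of_real (w x) * f x) = cmod (of_real (w x) * g x)"
    using eq by eventually_elim simp
qed measurable

lemma Lnorm_on_0: "1 < q \<Longrightarrow> Lnorm_on S q w (\<lambda>x. 0) = 0"
  by (simp add: Lnorm_on_eq_Lp_norm Lp_norm_zero)

lemma Lnorm_on_sum_le:
  assumes q: "1 < q" and w: "w \<in> borel_measurable (lebesgue_on S)" and "finite I"
    and "\<And>i. i \<in> I \<Longrightarrow> f i \<in> borel_measurable (lebesgue_on S)"
  shows "Lnorm_on S q w (\<lambda>x. \<Sum>i\<in>I. f i x) \<le> (\<Sum>i\<in>I. Lnorm_on S q w (f i))"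
  using assms(3,4)
proof (induction rule: finite_induct)
  case empty
  then show ?case using Lnorm_on_0[OF q] by simp
next
  case (insert i I)
  have "Lnorm_on S q w (\<lambda>x. f i x + (\<Sum>i\<in>I. f i x)) \<le> Lnorm_on S q w (f i) + Lnorm_on S q w (\<lambda>x. \<Sum>i\<in>I. f i x)"
    using insert.prems w by (intro Lnorm_on_add_le[OF q]) (auto intro!: borel_measurable_sum)
  also have "\<dots> \<le> Lnorm_on S q w (f i) + (\<Sum>i\<in>I. Lnorm_on S q w (f i))"
    using insert.prems by (intro add_left_mono insert.IH) auto
  finally show ?case using insert.hyps by simp
qed

text \<open>
  Replaces a norm that may be zero by strictly larger positive bounds.
\<close>

lemma ennreal_le_mult_of_upper:
  assumes "0 < a" "0 \<le> n" "\<And>N. n < N \<Longrightarrow> 0 < N \<Longrightarrow> X \<le> ennreal (a * N)"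
  shows "X \<le> ennreal a * ennreal n"
proof (rule ennreal_le_epsilon)
  fix e :: real assume "0 < e"
  then have "X \<le> ennreal (a * (n + e / a))" using assms by (intro assms(3)) (auto intro: add_nonneg_pos)
  also have "a * (n + e / a) = a * n + e" using assms(1) by (simp add: distrib_left)
  finally show "X \<le> ennreal a * ennreal n + ennreal e" using assms \<open>0 < e\<close> by (simp add: ennreal_mult)
qed

text \<open>
  The real number \<open>1 / q\<close>, with \<open>1 / \<infinity> = 0\<close>; in this notation indicators have the norm \<open>|S|\<^sup>1\<^sup>/\<^sup>q\<close> for all
  exponents.
\<close>

definition inverse_exponent :: "ennreal \<Rightarrow> real" where
  "inverse_exponent q = (if q = \<infinity> then 0 else 1 / enn2real q)"

lemma inverse_exponent_less:
  assumes "1 < p" "p < q"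
  shows "inverse_exponent q < inverse_exponent p"
proof -
  have pf: "p \<noteq> \<infinity>" using assms by (auto simp: less_top[symmetric])
  have p1: "1 < enn2real p" using exponent_real[OF assms(1) pf] by simp
  show ?thesis
  proof (cases "q = \<infinity>")
    case False
    have "enn2real p < enn2real q"
      using assms exponent_real(2)[OF assms(1) pf] exponent_real(2)[of q] False
      by (metis ennreal_less_iff enn2real_nonneg less_trans)
    then show ?thesis using False pf p1 by (simp add: inverse_exponent_def frac_less2)
  qed (use pf p1 in \<open>simp add: inverse_exponent_def\<close>)
qed

lemma Lp_norm_indicator:
  fixes S T :: "real set"
  assumes q: "1 < q" and S: "S \<in> lmeasurable" "S \<subseteq> T" "T \<in> sets lebesgue" and pos: "0 < measure lebesgue S"
  shows "Lp_norm (lebesgue_on T) q (indicator S) = ennreal (measure lebesgue S powr inverse_exponent q)"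
proof -
  have Sm: "S \<in> sets (lebesgue_on T)" using S by (auto simp: sets_restrict_space_iff dest: fmeasurableD)
  then have m: "(indicator S :: real \<Rightarrow> real) \<in> borel_measurable (lebesgue_on T)" by simp
  show ?thesis
  proof (cases "q = \<infinity>")
    case True
    have le: "Lp_norm (lebesgue_on T) \<infinity> (indicator S) \<le> ennreal 1"
      using m by (subst Lp_norm_le_iff_infinite) (auto simp: indicator_def)
    obtain r where r: "Lp_norm (lebesgue_on T) \<infinity> (indicator S) = ennreal r" "0 \<le> r" "r \<le> 1"
      using le by (cases "Lp_norm (lebesgue_on T) \<infinity> (indicator S :: real \<Rightarrow> real)") (auto simp: top_unique)
    have "AE x in lebesgue_on T. indicator S x \<le> r"
      using r m by (subst Lp_norm_le_iff_infinite[symmetric]) auto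
    then have ae: "AE x in lebesgue. x \<in> T \<longrightarrow> indicator S x \<le> r"
      using S by (subst (asm) AE_lebesgue_on_iff) auto
    have "1 \<le> r"
    proof (rule ccontr)
      assume "\<not> 1 \<le> r"
      then have "AE x in lebesgue. x \<notin> S" using ae S(2) by (auto elim!: eventually_mono simp: indicator_def split: if_splits)
      then have "S \<in> null_sets lebesgue" using S(1) by (subst (asm) AE_iff_null_sets[symmetric]) (auto dest: fmeasurableD)
      then show False using pos by (simp add: measure_eq_0_null_sets)
    qed
    then show ?thesis using True r pos by (simp add: inverse_exponent_def)
  next
    case False
    have s: "1 < enn2real q" using exponent_real[OF q False] by simp
    have "(\<integral>\<^sup>+x. ennreal (indicator S x powr enn2real q) \<partial>lebesgue_on T) = (\<integral>\<^sup>+x. indicator S x \<partial>lebesgue_on T)"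
      using s by (intro nn_integral_cong) (auto simp: indicator_def)
    also have "\<dots> = emeasure lebesgue S"
      using Sm S by (simp add: emeasure_restrict_space)
    also have "\<dots> = ennreal (measure lebesgue S)" using S(1) by (rule emeasure_eq_measure2)
    finally show ?thesis
      unfolding Lp_norm_def using False by (simp add: epow_def inverse_exponent_def)
  qed
qed

context weight
begin

lemma d_coeff_measurable:
  assumes b: "\<forall>m\<le>l. b m \<in> borel_measurable (lebesgue_on {0<..})"
  shows "d_coeff l b k \<in> borel_measurable (lebesgue_on {0<..})"
proof -
  have m: "(\<lambda>x. of_real (x ^ j / a) :: complex) \<in> borel_measurable (lebesgue_on {0<..})" for j and a :: real
    by (rule measurable_restrict_space1, rule measurable_completion) simp
  show ?thesis
    unfolding d_coeff_def[abs_def] by (intro borel_measurable_sum borel_measurable_times m) (use b in auto)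
qed

lemma reduced_op_measurable:
  assumes b: "\<forall>m\<le>l. b m \<in> borel_measurable (lebesgue_on {0<..})"
    and g: "g \<in> borel_measurable (lebesgue_on {0<..})" and fin: "Lnorm p u g < \<infinity>"
  shows "reduced_op l b g \<in> borel_measurable (lebesgue_on {0<..})"
proof -
  have [measurable]: "d_coeff l b j \<in> borel_measurable (lebesgue_on {0<..})" for j by (rule d_coeff_measurable[OF b])
  have [measurable]: "moment g j \<in> borel_measurable (lebesgue_on {0<..})" for j by (rule moment_measurable[OF g fin])
  have [measurable]: "g \<in> borel_measurable (lebesgue_on {0<..})" "b l \<in> borel_measurable (lebesgue_on {0<..})" using g b by auto
  show ?thesis unfolding reduced_op_def[abs_def] by measurable
qed

lemma Hardy_norm_le:
  assumes g: "g \<in> borel_measurable (lebesgue_on {0<..})" and fin: "Lnorm p u g < \<infinity>"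
    and q: "p \<le> q" and v: "v \<in> borel_measurable (lebesgue_on {0<..})" and d: "d \<in> borel_measurable (lebesgue_on {0<..})"
    and A: "0 < A" "\<And>r. 0 < r \<Longrightarrow> Lnorm_on {r<..} q v d * ennreal (K k r) \<le> ennreal A"
  shows "Lnorm q v (\<lambda>x. d x * moment g k x) \<le> ennreal (4 * A) * Lnorm p u g"
proof -
  define n where "n = enn2real (Lnorm p u g)"
  have n: "Lnorm p u g = ennreal n" "0 \<le> n" using fin by (auto simp: n_def less_top)
  show ?thesis
    unfolding n(1)
  proof (rule ennreal_le_mult_of_upper)
    show "Lnorm q v (\<lambda>x. d x * moment g k x) \<le> ennreal (4 * A * N)" if "n < N" "0 < N" for N
      using that n by (intro weighted_Hardy[OF g _ _ q v d A]) (auto intro: ennreal_leI)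
  qed (use A n in auto)
qed

lemma Volterra_part_bounded:
  assumes A: "cond_A l p q u v b" and q: "p \<le> q" and v: "v \<in> borel_measurable (lebesgue_on {0<..})"
    and b: "\<forall>m\<le>l. b m \<in> borel_measurable (lebesgue_on {0<..})"
  shows "\<exists>C\<ge>0. \<forall>g. g \<in> borel_measurable (lebesgue_on {0<..}) \<longrightarrow> Lnorm p u g < \<infinity> \<longrightarrow>
    Lnorm q v (\<lambda>x. \<Sum>j<l. of_real ((-1) ^ j / fact j) * (d_coeff l b j x * moment g j x)) \<le> ennreal C * Lnorm p u g"
proof -
  have q1: "1 < q" using p q by simp
  obtain A' where A': "\<And>k. k < l \<Longrightarrow> 0 < A' k"
    "\<And>k r. k < l \<Longrightarrow> 0 < r \<Longrightarrow> Lnorm_on {r<..} q v (d_coeff l b k) * ennreal (K k r) \<le> ennreal (A' k)"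
    using A unfolding cond_A_iff by metis
  have "Lnorm q v (\<lambda>x. \<Sum>j<l. of_real ((-1) ^ j / fact j) * (d_coeff l b j x * moment g j x)) \<le> ennreal (\<Sum>j<l. 1 / fact j * (4 * A' j)) * Lnorm p u g"
    if g: "g \<in> borel_measurable (lebesgue_on {0<..})" and fin: "Lnorm p u g < \<infinity>" for g
  proof -
    have m: "(\<lambda>x. d_coeff l b j x * moment g j x) \<in> borel_measurable (lebesgue_on {0<..})" for j
      by (intro borel_measurable_times d_coeff_measurable[OF b] moment_measurable[OF g fin])
    have "Lnorm q v (\<lambda>x. \<Sum>j<l. of_real ((-1) ^ j / fact j) * (d_coeff l b j x * moment g j x))
      \<le> (\<Sum>j<l. Lnorm q v (\<lambda>x. of_real ((-1) ^ j / fact j) * (d_coeff l b j x * moment g j x)))"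
      using m by (intro Lnorm_on_sum_le[OF q1 v]) (auto intro!: borel_measurable_times)
    also have "\<dots> = (\<Sum>j<l. ennreal (1 / fact j) * Lnorm q v (\<lambda>x. d_coeff l b j x * moment g j x))"
    proof (rule sum.cong[OF refl])
      fix j
      have "\<bar>(-1) ^ j / fact j :: real\<bar> = 1 / fact j" by (simp add: abs_divide power_abs)
      then show "Lnorm q v (\<lambda>x. of_real ((-1) ^ j / fact j) * (d_coeff l b j x * moment g j x)) = ennreal (1 / fact j) * Lnorm q v (\<lambda>x. d_coeff l b j x * moment g j x)"
        by (simp only: Lnorm_on_cmult[OF q1 v m] norm_of_real)
    qed
    also have "\<dots> \<le> (\<Sum>j<l. ennreal (1 / fact j) * (ennreal (4 * A' j) * Lnorm p u g))"
      by (intro sum_mono mult_left_mono Hardy_norm_le[OF g fin q v d_coeff_measurable[OF b]] A') auto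
    also have "\<dots> = (\<Sum>j<l. ennreal (1 / fact j * (4 * A' j))) * Lnorm p u g"
      unfolding sum_distrib_right
    proof (rule sum.cong[OF refl])
      fix j assume "j \<in> {..<l}"
      then have "ennreal (1 / fact j * (4 * A' j)) = ennreal (1 / fact j) * ennreal (4 * A' j)"
        using A'(1)[of j] by (intro ennreal_mult) auto
      then show "ennreal (1 / fact j) * (ennreal (4 * A' j) * Lnorm p u g) = ennreal (1 / fact j * (4 * A' j)) * Lnorm p u g"
        by (simp only: mult.assoc)
    qed
    also have "(\<Sum>j<l. ennreal (1 / fact j * (4 * A' j))) = ennreal (\<Sum>j<l. 1 / fact j * (4 * A' j))"
      using A'(1) by (intro sum_ennreal) (auto intro!: divide_nonneg_nonneg less_imp_le)
    finally show ?thesis .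
  qed
  moreover have "0 \<le> (\<Sum>j<l. 1 / fact j * (4 * A' j))"
    using A'(1) by (intro sum_nonneg) (auto intro!: divide_nonneg_nonneg less_imp_le)
  ultimately show ?thesis by blast
qed

lemma AE_weight_pos: "AE x in lebesgue_on {0<..}. 0 < u x"
  using AE_u_ext_pos by (subst AE_lebesgue_on_iff) (auto elim!: eventually_mono simp: u_ext_def)

lemma multiplication_bounded:
  assumes B: "cond_B l p q u v b" and q: "p \<le> q" and v: "v \<in> borel_measurable (lebesgue_on {0<..})"
    and b: "b l \<in> borel_measurable (lebesgue_on {0<..})"
  shows "\<exists>C\<ge>0. \<forall>g. g \<in> borel_measurable (lebesgue_on {0<..}) \<longrightarrow> Lnorm p u g < \<infinity> \<longrightarrow>
    Lnorm q v (\<lambda>x. b l x * g x) \<le> ennreal C * Lnorm p u g"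
proof -
  have q1: "1 < q" using p q by simp
  have [measurable]: "v \<in> borel_measurable (lebesgue_on {0<..})" "b l \<in> borel_measurable (lebesgue_on {0<..})"
    "u \<in> borel_measurable (lebesgue_on {0<..})" using v b u_meas by auto
  show ?thesis
  proof (cases "p = q")
    case False
    then have ae: "AE x in lebesgue_on {0<..}. v x \<noteq> 0 \<longrightarrow> b l x = 0" using B q by (simp add: cond_B_def)
    have "Lnorm q v (\<lambda>x. b l x * g x) \<le> ennreal 0 * Lnorm p u g"
      if [measurable]: "g \<in> borel_measurable (lebesgue_on {0<..})" for g
    proof -
      have "Lnorm q v (\<lambda>x. b l x * g x) = Lp_norm (lebesgue_on {0<..}) q (\<lambda>x::real. 0)"
        unfolding Lnorm_on_eq_Lp_norm
      proof (rule Lp_norm_cong_AE[OF q1])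
        show "AE x in lebesgue_on {0<..}. 0 \<le> cmod (of_real (v x) * (b l x * g x)) \<and> cmod (of_real (v x) * (b l x * g x)) = 0"
          using ae by eventually_elim auto
      qed measurable
      then show ?thesis by (simp add: Lp_norm_zero[OF q1])
    qed
    then show ?thesis by blast
  next
    case True
    define B where "B = enn2real (Lnorm \<infinity> (\<lambda>x. v x / u x) (b l))"
    have BB: "Lnorm \<infinity> (\<lambda>x. v x / u x) (b l) = ennreal B" "0 \<le> B"
      using assms(1) True by (auto simp: cond_B_def B_def less_top)
    have "AE x in lebesgue_on {0<..}. cmod (of_real (v x / u x) * b l x) \<le> B"
      using BB unfolding Lnorm_on_eq_Lp_norm by (subst Lp_norm_le_iff_infinite[symmetric]) auto
    then have ae: "AE x in lebesgue_on {0<..}. cmod (of_real (v x) * b l x) \<le> B * \<bar>u x\<bar>"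
      using AE_weight_pos
    proof eventually_elim
      case (elim x)
      have "cmod (of_real (v x) * b l x) = cmod (of_real (v x / u x) * b l x) * \<bar>u x\<bar>"
        using elim(2) by (simp add: norm_mult norm_divide)
      also have "\<dots> \<le> B * \<bar>u x\<bar>" using elim by (intro mult_right_mono) auto
      finally show ?case .
    qed
    have "Lnorm q v (\<lambda>x. b l x * g x) \<le> ennreal B * Lnorm p u g"
      if [measurable]: "g \<in> borel_measurable (lebesgue_on {0<..})" for g
    proof -
      have "Lnorm q v (\<lambda>x. b l x * g x) \<le> Lp_norm (lebesgue_on {0<..}) q (\<lambda>x. B * cmod (of_real (u x) * g x))"
        unfolding Lnorm_on_eq_Lp_norm
      proof (rule Lp_norm_mono_AE[OF q1])
        show "AE x in lebesgue_on {0<..}. 0 \<le> cmod (of_real (v x) * (b l x * g x)) \<and> cmod (of_real (v x) * (b l x * g x)) \<le> B * cmod (of_real (u x) * g x)"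
          using ae
        proof eventually_elim
          case (elim x)
          have "cmod (of_real (v x) * (b l x * g x)) = cmod (of_real (v x) * b l x) * cmod (g x)" by (simp add: norm_mult)
          also have "\<dots> \<le> B * \<bar>u x\<bar> * cmod (g x)" using elim by (rule mult_right_mono) simp
          also have "\<dots> = B * cmod (of_real (u x) * g x)" by (simp add: norm_mult)
          finally show ?case by simp
        qed
      qed measurable
      also have "\<dots> \<le> ennreal B * Lnorm p u g"
      proof -
        have m: "(\<lambda>x. cmod (of_real (u x) * g x)) \<in> borel_measurable (lebesgue_on {0<..})" by measurable
        show ?thesis unfolding Lnorm_on_eq_Lp_norm True by (rule Lp_norm_cmult_le[OF q1 m]) (use BB in auto)
      qed
      finally show ?thesis .
    qed
    then show ?thesis using BB(2) by blast
  qed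
qed

text \<open>
  Apply the multiplication operator to \<open>1\<^sub>S / u\<close>: its source norm is that of \<open>1\<^sub>S\<close>, and its image is at
  least \<open>\<epsilon>\<close> on \<open>S\<close> after weighting.
\<close>

lemma indicator_test:
  assumes mult: "\<And>g. g \<in> borel_measurable (lebesgue_on {0<..}) \<Longrightarrow> Lnorm p u g < \<infinity> \<Longrightarrow>
      Lnorm q v (\<lambda>x. \<beta> x * g x) \<le> ennreal C * Lnorm p u g" and C: "0 \<le> C"
    and q: "1 < q" and v: "v \<in> borel_measurable (lebesgue_on {0<..})" and \<beta>: "\<beta> \<in> borel_measurable (lebesgue_on {0<..})"
    and S: "S \<in> lmeasurable" "S \<subseteq> {0<..}" "0 < measure lebesgue S"
    and ge: "\<And>x. x \<in> S \<Longrightarrow> \<epsilon> \<le> cmod (of_real (v x / u x) * \<beta> x)" and \<epsilon>: "0 \<le> \<epsilon>"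
  shows "\<epsilon> * measure lebesgue S powr inverse_exponent q \<le> C * measure lebesgue S powr inverse_exponent p"
proof -
  have Sm [measurable]: "S \<in> sets (lebesgue_on {0<..})" using S by (auto simp: sets_restrict_space_iff dest: fmeasurableD)
  have [measurable]: "v \<in> borel_measurable (lebesgue_on {0<..})" "\<beta> \<in> borel_measurable (lebesgue_on {0<..})"
    "u \<in> borel_measurable (lebesgue_on {0<..})" using v \<beta> u_meas by auto
  define g where "g x = (of_real (indicator S x / u x) :: complex)" for x
  have gm [measurable]: "g \<in> borel_measurable (lebesgue_on {0<..})" unfolding g_def[abs_def] by measurable
  have "Lnorm p u g = Lp_norm (lebesgue_on {0<..}) p (indicator S)"
    unfolding Lnorm_on_eq_Lp_norm
  proof (rule Lp_norm_cong_AE[OF p])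
    show "AE x in lebesgue_on {0<..}. 0 \<le> cmod (of_real (u x) * g x) \<and> cmod (of_real (u x) * g x) = indicator S x"
      using AE_weight_pos by eventually_elim (auto simp: g_def indicator_def)
  qed measurable
  then have ng: "Lnorm p u g = ennreal (measure lebesgue S powr inverse_exponent p)"
    using Lp_norm_indicator[OF p S(1,2) _ S(3)] by simp
  have "ennreal \<epsilon> * ennreal (measure lebesgue S powr inverse_exponent q) = ennreal \<epsilon> * Lp_norm (lebesgue_on {0<..}) q (indicator S)"
    using Lp_norm_indicator[OF q S(1,2) _ S(3)] by simp
  also have "\<dots> = Lp_norm (lebesgue_on {0<..}) q (\<lambda>x. \<epsilon> * indicator S x)"
    using \<epsilon> by (intro Lp_norm_cmult[OF q, symmetric]) auto
  also have "\<dots> \<le> Lnorm q v (\<lambda>x. \<beta> x * g x)"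
    unfolding Lnorm_on_eq_Lp_norm
  proof (rule Lp_norm_mono_AE[OF q])
    show "AE x in lebesgue_on {0<..}. 0 \<le> \<epsilon> * indicator S x \<and> \<epsilon> * indicator S x \<le> cmod (of_real (v x) * (\<beta> x * g x))"
    proof (rule AE_I2)
      fix x
      have "cmod (of_real (v x) * (\<beta> x * g x)) = cmod (of_real (v x / u x) * \<beta> x) * indicator S x"
        by (simp add: g_def norm_mult norm_divide indicator_def)
      then show "0 \<le> \<epsilon> * indicator S x \<and> \<epsilon> * indicator S x \<le> cmod (of_real (v x) * (\<beta> x * g x))"
        using ge[of x] \<epsilon> by (cases "x \<in> S") auto
    qed
  qed measurable
  also have "\<dots> \<le> ennreal C * Lnorm p u g" using ng by (intro mult gm) simp
  finally show ?thesis
    unfolding ng using \<epsilon> C by (simp add: ennreal_mult[symmetric] ennreal_le_iff)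
qed

text \<open>
  Let \<open>h = |v b\<^sub>l / u|\<close> and test on bounded pieces \<open>S\<close> of the level sets \<open>{h \<ge> t}\<close>. For \<open>p = q\<close> the powers of
  \<open>|S|\<close> cancel and \<open>|S| > 0\<close> is impossible for \<open>t > C\<close>. For \<open>p < q\<close> a positive power of \<open>|S|\<close> remains and
  gives \<open>t \<le> C |S|\<^sup>\<theta>\<close>, which is impossible once \<open>S\<close> lies in a sufficiently short interval; so all level sets
  are null.
\<close>

theorem multiplication_necessary:
  assumes mult: "\<And>g. g \<in> borel_measurable (lebesgue_on {0<..}) \<Longrightarrow> Lnorm p u g < \<infinity> \<Longrightarrow>
      Lnorm q v (\<lambda>x. b l x * g x) \<le> ennreal C * Lnorm p u g" and C: "0 \<le> C"
    and q: "p \<le> q" and v: "v \<in> borel_measurable (lebesgue_on {0<..})" and b: "b l \<in> borel_measurable (lebesgue_on {0<..})"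
  shows "cond_B l p q u v b"
proof -
  have q1: "1 < q" using p q by simp
  have [measurable]: "v \<in> borel_measurable (lebesgue_on {0<..})" "b l \<in> borel_measurable (lebesgue_on {0<..})"
    "u \<in> borel_measurable (lebesgue_on {0<..})" using v b u_meas by auto
  define h where "h x = cmod (of_real (v x / u x) * b l x)" for x
  define h' where "h' x = (if 0 < x then h x else 0)" for x
  have hm [measurable]: "h \<in> borel_measurable (lebesgue_on {0<..})" unfolding h_def[abs_def] by measurable
  have h'm: "h' \<in> borel_measurable lebesgue" unfolding h'_def[abs_def] by (rule lebesgue_on_extend_measurable[OF hm])
  have lev: "{x. t \<le> h' x} \<inter> {a<..<d} \<in> lmeasurable" for t a d
  proof -
    have "{x \<in> space lebesgue. t \<le> h' x} \<in> sets lebesgue" using h'm by measurable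
    then have "{a<..<d} \<inter> {x. t \<le> h' x} \<in> lmeasurable" by (intro fmeasurable_Int_fmeasurable) (auto simp: lmeasurable_open)
    then show ?thesis by (simp add: Int_commute)
  qed
  have test: "t * measure lebesgue S powr inverse_exponent q \<le> C * measure lebesgue S powr inverse_exponent p"
    if "0 < t" "S = {x. t \<le> h' x} \<inter> {a<..<d}" "0 < measure lebesgue S" for t a d S
  proof (rule indicator_test[OF mult C q1 v b])
    show "S \<in> lmeasurable" unfolding that(2) by (rule lev)
    show "S \<subseteq> {0<..}" using that(1,2) by (auto simp: h'_def split: if_splits)
    show "t \<le> cmod (of_real (v x / u x) * b l x)" if "x \<in> S" for x
      using that \<open>S = _\<close> \<open>0 < t\<close> by (auto simp: h'_def h_def split: if_splits)
  qed (use that in auto)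
  show ?thesis
    unfolding cond_B_def
  proof (intro conjI impI)
    assume "p = q"
    have "AE x in lebesgue. \<not> (C + 1 \<le> h' x \<and> x \<in> {- real n<..<real n})" for n
    proof -
      let ?S = "{x. C + 1 \<le> h' x} \<inter> {- real n<..<real n}"
      have "measure lebesgue ?S = 0"
      proof (rule ccontr)
        assume "measure lebesgue ?S \<noteq> 0"
        then have pos: "0 < measure lebesgue ?S" by (simp add: zero_less_measure_iff)
        have "0 < C + 1" using C by simp
        from test[OF this refl pos] have "(C + 1) * measure lebesgue ?S powr inverse_exponent q \<le> C * measure lebesgue ?S powr inverse_exponent q"
          by (simp only: \<open>p = q\<close>)
        moreover have "0 < measure lebesgue ?S powr inverse_exponent q" using pos by simp
        ultimately show False unfolding distrib_right by linarith
      qed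
      then have "?S \<in> null_sets lebesgue" using lev[of "C + 1"] by (simp add: null_sets_def emeasure_eq_measure2 fmeasurableD)
      then have "AE x in lebesgue. x \<notin> ?S" by (rule AE_not_in)
      then show ?thesis by (auto elim!: eventually_mono)
    qed
    then have "AE x in lebesgue. \<forall>n. \<not> (C + 1 \<le> h' x \<and> x \<in> {- real n<..<real n})" by (simp only: AE_all_countable) blast
    then have "AE x in lebesgue. h' x \<le> C + 1"
    proof eventually_elim
      case (elim x)
      obtain n where "\<bar>x\<bar> < real n" using reals_Archimedean2 by blast
      then have "x \<in> {- real n<..<real n}" by (auto simp: abs_less_iff)
      then show ?case using elim[rule_format, of n] by (simp add: not_le less_imp_le)
    qed
    then have "AE x in lebesgue_on {0<..}. h x \<le> C + 1"
      by (subst AE_lebesgue_on_iff) (auto elim!: eventually_mono simp: h'_def)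
    then have "Lnorm \<infinity> (\<lambda>x. v x / u x) (b l) \<le> ennreal (C + 1)"
      unfolding Lnorm_on_eq_Lp_norm h_def[abs_def, symmetric] using C by (subst Lp_norm_le_iff_infinite) auto
    then show "Lnorm \<infinity> (\<lambda>x. v x / u x) (b l) < \<infinity>" by (simp add: le_less_trans)
  next
    assume "p < q"
    define \<theta> where "\<theta> = inverse_exponent p - inverse_exponent q"
    have \<theta>: "0 < \<theta>" using inverse_exponent_less[OF p \<open>p < q\<close>] by (simp add: \<theta>_def)
    have "AE x in lebesgue. \<not> (t \<le> h' x \<and> x \<in> {real i * \<delta> / 2<..<real i * \<delta> / 2 + \<delta>})"
      if t: "0 < t" and \<delta>: "0 < \<delta>" "C * \<delta> powr \<theta> < t" for t \<delta> i
    proof -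
      let ?S = "{x. t \<le> h' x} \<inter> {real i * \<delta> / 2<..<real i * \<delta> / 2 + \<delta>}"
      have "measure lebesgue ?S \<le> measure lebesgue {real i * \<delta> / 2<..<real i * \<delta> / 2 + \<delta>}"
        using lev by (intro measure_mono_fmeasurable) (auto simp: lmeasurable_open dest: fmeasurableD)
      then have le: "measure lebesgue ?S \<le> \<delta>" using \<delta> by simp
      have "measure lebesgue ?S = 0"
      proof (rule ccontr)
        let ?\<sigma> = "measure lebesgue ?S"
        assume "?\<sigma> \<noteq> 0"
        then have pos: "0 < ?\<sigma>" by (simp add: zero_less_measure_iff)
        have "t * ?\<sigma> powr inverse_exponent q \<le> C * ?\<sigma> powr inverse_exponent p"
          by (rule test[OF t refl pos])
        also have "?\<sigma> powr inverse_exponent p = ?\<sigma> powr \<theta> * ?\<sigma> powr inverse_exponent q"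
          unfolding powr_add[symmetric] \<theta>_def by simp
        finally have "t * ?\<sigma> powr inverse_exponent q \<le> C * ?\<sigma> powr \<theta> * ?\<sigma> powr inverse_exponent q" by (simp add: mult.assoc)
        moreover have "0 < ?\<sigma> powr inverse_exponent q" using pos by simp
        ultimately have "t \<le> C * ?\<sigma> powr \<theta>" by (rule mult_right_le_imp_le)
        also have "\<dots> \<le> C * \<delta> powr \<theta>" using C \<theta> le pos by (intro mult_left_mono powr_mono2) auto
        finally show False using \<delta> by simp
      qed
      then have "?S \<in> null_sets lebesgue" using lev[of t] by (simp add: null_sets_def emeasure_eq_measure2 fmeasurableD)
      then have "AE x in lebesgue. x \<notin> ?S" by (rule AE_not_in)
      then show ?thesis by (auto elim!: eventually_mono)
    qed
    note local = this
    have small: "AE x in lebesgue. 0 < x \<longrightarrow> h' x < t" if t: "0 < t" for t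
    proof -
      \<comment> \<open>With this length \<open>C \<delta>\<^sup>\<theta> < t\<close>. The intervals are spaced by \<open>\<delta> / 2\<close>, so the open half-line is covered
        although their endpoints are omitted.\<close>
      define \<delta> where "\<delta> = (t / (2 * (C + 1))) powr (1 / \<theta>)"
      have \<delta>: "0 < \<delta>" using t C by (simp add: \<delta>_def)
      have "\<delta> powr \<theta> = t / (2 * (C + 1))" using \<theta> t C by (simp add: \<delta>_def powr_powr)
      then have "C * \<delta> powr \<theta> = C / (C + 1) * (t / 2)" by simp
      also have "\<dots> \<le> 1 * (t / 2)" using C t by (intro mult_right_mono) auto
      finally have "C * \<delta> powr \<theta> < t" using t by simp
      then have "AE x in lebesgue. \<forall>i. \<not> (t \<le> h' x \<and> x \<in> {real i * \<delta> / 2<..<real i * \<delta> / 2 + \<delta>})"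
        using local[OF t \<delta>] by (simp only: AE_all_countable) blast
      then show ?thesis
      proof eventually_elim
        case (elim x)
        show ?case
        proof
          assume x: "0 < x"
          define i where "i = nat (\<lceil>2 * x / \<delta>\<rceil> - 1)"
          have c1: "1 \<le> \<lceil>2 * x / \<delta>\<rceil>" using x \<delta> by (simp add: one_le_ceiling)
          then have ri: "real i = of_int \<lceil>2 * x / \<delta>\<rceil> - 1" by (simp add: i_def)
          have "real i < 2 * x / \<delta>" "2 * x / \<delta> \<le> real i + 1" unfolding ri by linarith+
          then have "real i * \<delta> < 2 * x" "2 * x \<le> (real i + 1) * \<delta>" using \<delta> by (simp_all add: field_simps)
          then have "x \<in> {real i * \<delta> / 2<..<real i * \<delta> / 2 + \<delta>}" using \<delta> by (auto simp: algebra_simps)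
          then show "h' x < t" using elim[rule_format, of i] by (simp add: not_le)
        qed
      qed
    qed
    have "AE x in lebesgue. \<forall>n. 0 < x \<longrightarrow> h' x < 1 / real (Suc n)"
      using small by (simp only: AE_all_countable) simp
    then have "AE x in lebesgue. 0 < x \<longrightarrow> h' x = 0"
    proof eventually_elim
      case (elim x)
      show ?case
      proof
        assume "0 < x"
        show "h' x = 0"
        proof (rule ccontr)
          assume "h' x \<noteq> 0"
          then have "0 < h' x" by (simp add: h'_def h_def split: if_splits)
          then obtain n where "1 / real (Suc n) < h' x" using nat_approx_posE by blast
          then show False using elim \<open>0 < x\<close> by (meson less_asym)
        qed
      qed
    qed
    then have "AE x in lebesgue_on {0<..}. h x = 0"
      by (subst AE_lebesgue_on_iff) (auto elim!: eventually_mono simp: h'_def)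
    then show "AE x in lebesgue_on {0<..}. v x \<noteq> 0 \<longrightarrow> b l x = 0"
      using AE_weight_pos by eventually_elim (auto simp: h_def)
  qed
qed

end

section \<open>Necessity of the moment conditions\<close>

context weight
begin

text \<open>
  The doubling hypothesis concerns the power \<open>l - 2\<close> and polynomials have degree at most \<open>l - 1\<close>, which
  matches \<open>n = l - 2\<close> in \<open>coefficient_bound\<close>. For \<open>l = 1\<close> the polynomial is its single coefficient.
\<close>

lemma coefficient_bound_weight:
  assumes l: "l \<ge> 1" and doubling: "l \<ge> 2 \<longrightarrow> (\<exists>D::real. \<forall>r>0.
       (\<integral>\<^sup>+x. ennreal (x powr (real (l - 2) * c)) * neg_conj_pow u p x \<partial>lebesgue_on {0<..<2 * r})
       \<le> ennreal D * (\<integral>\<^sup>+x. ennreal (x powr (real (l - 2) * c)) * neg_conj_pow u p x \<partial>lebesgue_on {0<..<r}))"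
  shows "\<exists>C>0. \<forall>r>0. \<forall>a::nat \<Rightarrow> real. \<forall>k<l.
     ennreal (\<bar>a k\<bar> powr c) * \<Phi> k r \<le> ennreal C * wint W (\<lambda>t. \<bar>\<Sum>j<l. a j * t ^ j\<bar> powr c) {0<..<r}"
proof (cases "l \<ge> 2")
  case True
  then obtain D where D: "\<And>r. 0 < r \<Longrightarrow> \<Phi> (l - 2) (2 * r) \<le> ennreal D * \<Phi> (l - 2) r"
    using doubling unfolding wint_eq \<Phi>_def by blast
  interpret doubling_weight W c "l - 2" D
    using c_ge_1 \<Phi>_finite \<Phi>_pos D W_nonneg unfolding \<Phi>_def by unfold_locales auto
  have S: "Suc (l - 2) = l - 1" using True by simp
  have set: "{..l - 1} = {..<l}" using l by auto
  have lt: "k < l \<longleftrightarrow> k \<le> l - 1" for k using l by auto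
  show ?thesis
    using coefficient_bound unfolding S set \<Phi>_def lt .
next
  case False
  then have l1: "l = 1" using l by simp
  have "ennreal (\<bar>a 0\<bar> powr c) * \<Phi> 0 r \<le> ennreal 1 * wint W (\<lambda>t. \<bar>\<Sum>j<l. a j * t ^ j\<bar> powr c) {0<..<r}" for r and a :: "nat \<Rightarrow> real"
  proof -
    have "ennreal (\<bar>a 0\<bar> powr c) * \<Phi> 0 r = ennreal (\<bar>a 0\<bar> powr c) * (\<integral>\<^sup>+x. ennreal (W x) * indicator {0<..<r} x \<partial>lebesgue)"
      unfolding \<Phi>_def wint_def by (rule arg_cong2[where f = "(*)", OF refl], rule nn_integral_cong) (auto simp: indicator_def)
    also have "\<dots> = (\<integral>\<^sup>+x. ennreal (\<bar>a 0\<bar> powr c) * (ennreal (W x) * indicator {0<..<r} x) \<partial>lebesgue)"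
      by (intro nn_integral_cmult[symmetric] borel_measurable_times_ennreal borel_measurable_indicator) auto
    also have "\<dots> = wint W (\<lambda>t. \<bar>\<Sum>j<l. a j * t ^ j\<bar> powr c) {0<..<r}"
      unfolding wint_def by (intro nn_integral_cong) (auto simp: indicator_def l1 ennreal_mult W_nonneg)
    finally show ?thesis by simp
  qed
  then show ?thesis by (intro exI[of _ 1]) (auto simp: l1)
qed

text \<open>
  Real functions suffice for testing, and the dominated extension is carried out for real functionals.
\<close>

definition test_space :: "real \<Rightarrow> (real \<Rightarrow> real) set" where
  "test_space r = {g. g \<in> borel_measurable lebesgue \<and> (\<forall>x. x \<notin> {0<..<r} \<longrightarrow> g x = 0) \<and> Lnorm p u (\<lambda>x. of_real (g x)) < \<infinity>}"

definition test_norm :: "(real \<Rightarrow> real) \<Rightarrow> real" where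
  "test_norm g = enn2real (Lnorm p u (\<lambda>x. of_real (g x)))"

definition test_moment :: "real \<Rightarrow> nat \<Rightarrow> (real \<Rightarrow> real) \<Rightarrow> real" where
  "test_moment r j g = integral {0..r} (\<lambda>t. t ^ j * g t)"

lemma test_space_measurable:
  assumes "g \<in> test_space r"
  shows "(\<lambda>x. of_real (g x) :: complex) \<in> borel_measurable (lebesgue_on {0<..})"
  using assms by (intro measurable_restrict_space1) (auto simp: test_space_def)

lemma test_norm_eq: "g \<in> test_space r \<Longrightarrow> Lnorm p u (\<lambda>x. of_real (g x)) = ennreal (test_norm g)"
  by (simp add: test_space_def test_norm_def less_top)

lemma test_moment_integrable:
  assumes g: "g \<in> test_space r"
  shows "(\<lambda>t. t ^ j * g t) integrable_on {0..r}"
proof -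
  have "(\<lambda>t. of_real (t ^ j) * (of_real (g t) :: complex)) integrable_on {0..r}"
    using g by (intro set_lebesgue_integral_eq_integral(1) moment_integrable test_space_measurable[OF g]) (auto simp: test_space_def)
  from integrable_linear[OF this bounded_linear_Re] show ?thesis by (simp add: o_def flip: of_real_mult of_real_power)
qed

lemma moment_test:
  assumes g: "g \<in> test_space r" and x: "0 \<le> r" "r \<le> x"
  shows "moment (\<lambda>t. of_real (g t)) j x = of_real (test_moment r j g)"
proof -
  have "((\<lambda>t. t ^ j * g t) has_integral test_moment r j g) {0..r}"
    unfolding test_moment_def using test_moment_integrable[OF g] by (simp add: has_integral_integral)
  then have "((\<lambda>t. t ^ j * g t) has_integral test_moment r j g) {0..x}"
    by (rule has_integral_on_superset) (use g x in \<open>auto simp: test_space_def\<close>)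
  from has_integral_linear[OF this bounded_linear_of_real[where 'a = complex]]
  have "((\<lambda>t. of_real (t ^ j) * of_real (g t)) has_integral (of_real (test_moment r j g) :: complex)) {0..x}"
    by (simp add: o_def)
  then show ?thesis unfolding moment_def by (rule integral_unique)
qed

text \<open>
  Minkowski's inequality in the form that yields both closure under linear combinations and the seminorm property.
\<close>

lemma test_norm_lincomb_le:
  assumes f: "f \<in> test_space r" and g: "g \<in> test_space r"
  shows "Lnorm p u (\<lambda>x. of_real (a * f x + b * g x)) \<le> ennreal (\<bar>a\<bar> * test_norm f + \<bar>b\<bar> * test_norm g)"
proof -
  note m = test_space_measurable[OF f] test_space_measurable[OF g]
  have "Lnorm p u (\<lambda>x. of_real a * of_real (f x) + of_real b * of_real (g x))
    \<le> Lnorm p u (\<lambda>x. of_real a * of_real (f x)) + Lnorm p u (\<lambda>x. of_real b * of_real (g x))"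
    by (intro Lnorm_on_add_le p u_meas borel_measurable_times m) auto
  also have "\<dots> = ennreal \<bar>a\<bar> * ennreal (test_norm f) + ennreal \<bar>b\<bar> * ennreal (test_norm g)"
    by (simp only: Lnorm_on_cmult[OF p u_meas m(1)] Lnorm_on_cmult[OF p u_meas m(2)] test_norm_eq[OF f] test_norm_eq[OF g] norm_of_real)
  also have "\<dots> = ennreal (\<bar>a\<bar> * test_norm f + \<bar>b\<bar> * test_norm g)"
    by (simp add: ennreal_mult test_norm_def)
  finally show ?thesis by (simp only: of_real_add of_real_mult)
qed

lemma lin_closed_test_space: "lin_closed (test_space r)"
  unfolding lin_closed_def
proof (intro ballI allI)
  fix f g a b assume f: "f \<in> test_space r" and g: "g \<in> test_space r"
  have "Lnorm p u (\<lambda>x. of_real (a * f x + b * g x)) < \<infinity>"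
    by (rule le_less_trans[OF test_norm_lincomb_le[OF f g]]) simp
  moreover have "(\<lambda>x. a * f x + b * g x) \<in> borel_measurable lebesgue"
    using f g by (intro borel_measurable_add borel_measurable_times) (auto simp: test_space_def)
  ultimately show "(\<lambda>x. a * f x + b * g x) \<in> test_space r"
    using f g unfolding test_space_def by simp
qed

lemma seminorm_test_norm: "0 \<le> s \<Longrightarrow> seminorm_on (test_space r) (\<lambda>g. s * test_norm g)"
  unfolding seminorm_on_def
proof (intro ballI allI)
  fix f g a b assume s: "0 \<le> s" and f: "f \<in> test_space r" and g: "g \<in> test_space r"
  have "test_norm (\<lambda>x. a * f x + b * g x) \<le> \<bar>a\<bar> * test_norm f + \<bar>b\<bar> * test_norm g"
  proof -
    have "test_norm (\<lambda>x. a * f x + b * g x) \<le> enn2real (ennreal (\<bar>a\<bar> * test_norm f + \<bar>b\<bar> * test_norm g))"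
      unfolding test_norm_def[of "\<lambda>x. a * f x + b * g x"] by (rule enn2real_mono[OF test_norm_lincomb_le[OF f g]]) simp
    also have "\<dots> = \<bar>a\<bar> * test_norm f + \<bar>b\<bar> * test_norm g"
      by (rule enn2real_ennreal) (simp add: test_norm_def)
    finally show ?thesis .
  qed
  then have "s * test_norm (\<lambda>x. a * f x + b * g x) \<le> s * (\<bar>a\<bar> * test_norm f + \<bar>b\<bar> * test_norm g)"
    using s by (rule mult_left_mono)
  then show "s * test_norm (\<lambda>x. a * f x + b * g x) \<le> \<bar>a\<bar> * (s * test_norm f) + \<bar>b\<bar> * (s * test_norm g)"
    by (simp add: algebra_simps)
qed

lemma lin_on_test_moment: "lin_on (test_space r) (test_moment r j)"
  unfolding lin_on_def
proof (intro ballI allI)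
  fix f g a b assume f: "f \<in> test_space r" and g: "g \<in> test_space r"
  have "integral {0..r} (\<lambda>t. a * (t ^ j * f t) + b * (t ^ j * g t)) = a * test_moment r j f + b * test_moment r j g"
    using test_moment_integrable[OF f] test_moment_integrable[OF g]
    by (subst Henstock_Kurzweil_Integration.integral_add) (auto simp: test_moment_def integrable_on_mult_right)
  also have "(\<lambda>t. a * (t ^ j * f t) + b * (t ^ j * g t)) = (\<lambda>t. t ^ j * (a * f t + b * g t))"
    by (simp add: fun_eq_iff algebra_simps)
  finally show "test_moment r j (\<lambda>x. a * f x + b * g x) = a * test_moment r j f + b * test_moment r j g"
    by (simp add: test_moment_def)
qed

text \<open>
  Test on \<open>g = sgn Q |Q|\<^sup>c\<^sup>-\<^sup>1 W\<close>, the case of equality in Hoelder's inequality: with \<open>x\<close> the integral of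
  \<open>|Q|\<^sup>c W\<close>, the functional has the value \<open>x\<close> at \<open>g\<close> and the norm of \<open>g\<close> is at most \<open>x\<^sup>1\<^sup>-\<^sup>1\<^sup>/\<^sup>c\<close>.
\<close>

theorem converse_Hoelder:
  fixes a :: "nat \<Rightarrow> real" and l :: nat
  defines "Q \<equiv> \<lambda>t. \<Sum>j<l. a j * t ^ j"
  assumes r: "0 < r" and s: "0 \<le> s"
    and bound: "\<And>g. g \<in> test_space r \<Longrightarrow> \<bar>\<Sum>j<l. a j * test_moment r j g\<bar> \<le> s * test_norm g"
  shows "wint W (\<lambda>t. \<bar>Q t\<bar> powr c) {0<..<r} \<le> ennreal (s powr c)"
proof -
  define X where "X = wint W (\<lambda>t. \<bar>Q t\<bar> powr c) {0<..<r}"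
  have Qm [measurable]: "Q \<in> borel_measurable lebesgue"
    unfolding Q_def by (rule measurable_completion) simp
  define h where "h t = indicator {0<..<r} t * (\<bar>Q t\<bar> powr c * W t)" for t
  have hm [measurable]: "h \<in> borel_measurable lebesgue"
    unfolding h_def[abs_def] by (intro borel_measurable_times borel_measurable_indicator) (measurable, auto)
  have h0: "0 \<le> h t" for t by (simp add: h_def W_nonneg)
  have X_eq: "X = (\<integral>\<^sup>+t. ennreal (h t) * indicator {0<..<r} t \<partial>lebesgue)"
    unfolding X_def wint_def by (intro nn_integral_cong) (auto simp: h_def indicator_def)
  \<comment> \<open>The integral is finite because \<open>Q\<close> is bounded by \<open>B\<close> on \<open>(0, r)\<close>; this is needed to divide by its power.\<close>
  define B where "B = (\<Sum>j<l. \<bar>a j\<bar> * r ^ j)"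
  have QB: "\<bar>Q t\<bar> \<le> B" if "t \<in> {0<..<r}" for t
    unfolding Q_def B_def
    by (rule order_trans[OF sum_abs sum_mono]) (use that in \<open>auto simp: abs_mult power_abs intro!: mult_left_mono power_mono\<close>)
  have "X \<le> (\<integral>\<^sup>+t. ennreal (B powr c) * (ennreal (t powr (real 0 * c) * W t) * indicator {0<..<r} t) \<partial>lebesgue)"
    unfolding X_def wint_def
  proof (rule nn_integral_mono)
    fix t
    have "\<bar>Q t\<bar> powr c * W t \<le> B powr c * W t" if "t \<in> {0<..<r}"
      using QB[OF that] c_ge_1 W_nonneg by (intro mult_right_mono powr_mono2) auto
    then show "ennreal (\<bar>Q t\<bar> powr c * W t) * indicator {0<..<r} t \<le> ennreal (B powr c) * (ennreal (t powr (real 0 * c) * W t) * indicator {0<..<r} t)"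
      by (auto simp: indicator_def W_nonneg ennreal_mult[symmetric] intro!: ennreal_leI)
  qed
  also have "\<dots> = ennreal (B powr c) * \<Phi> 0 r"
    unfolding \<Phi>_def wint_def
    by (intro nn_integral_cmult borel_measurable_times_ennreal borel_measurable_indicator) (measurable, auto intro: measurable_completion)
  also have "\<dots> < \<infinity>" using \<Phi>_finite[OF r, of 0] by (simp add: ennreal_mult_less_top)
  finally have X_fin: "X < \<infinity>" .
  define x where "x = enn2real X"
  have Xx: "X = ennreal x" "0 \<le> x" using X_fin by (auto simp: x_def less_top)
  show ?thesis
  proof (cases "x = 0")
    case True
    then show ?thesis using Xx by (simp add: X_def)
  next
    case False
    then have x: "0 < x" using Xx by simp
    define g where "g t = indicator {0<..<r} t * (sgn (Q t) * (\<bar>Q t\<bar> powr (c - 1) * W t))" for t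
    have gm [measurable]: "g \<in> borel_measurable lebesgue"
      unfolding g_def[abs_def] by (intro borel_measurable_times borel_measurable_indicator) (measurable, auto)
    have gm': "(\<lambda>t. of_real (g t) :: complex) \<in> borel_measurable (lebesgue_on {0<..})"
      by (rule measurable_restrict_space1) measurable
    have ug: "cmod (of_real (u t) * of_real (g t)) = (if Q t = 0 then 0 else \<bar>Q t\<bar> powr (c - 1) * u t powr (1 - c)) * indicator {0<..<r} t"
      if "0 < u t" "0 < t" for t
    proof -
      have "u t * u t powr (- c) = u t powr (1 - c)"
        using that powr_add[of "u t" 1 "- c"] by simp
      then show ?thesis
        using that by (auto simp: g_def W_def u_ext_def norm_mult abs_mult indicator_def abs_sgn_eq mult_ac)
    qed
    have norm_le: "Lnorm p u (\<lambda>t. of_real (g t)) \<le> ennreal (x powr (1 - 1 / c))"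
    proof (cases "p = \<infinity>")
      case True
      then have c1: "c = 1" by (simp add: conj_exp_def)
      have um: "u \<in> borel_measurable (lebesgue_on {0<..})" by (rule u_meas)
      have ugm: "(\<lambda>t. cmod (of_real (u t) * of_real (g t))) \<in> borel_measurable (lebesgue_on {0<..})"
        using um gm' by measurable
      have "AE t in lebesgue_on {0<..}. cmod (of_real (u t) * of_real (g t)) \<le> 1"
        using AE_weight_pos AE_space
      proof eventually_elim
        case (elim t)
        then show ?case using ug[of t] by (auto simp: c1 indicator_def)
      qed
      then have "Lnorm \<infinity> u (\<lambda>t. of_real (g t)) \<le> ennreal 1"
        unfolding Lnorm_on_eq_Lp_norm
        by (subst Lp_norm_le_iff_infinite[OF ugm]) auto
      then show ?thesis using True c1 x by simp
    next
      case False
      define P where "P = enn2real p"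
      have cP: "1 < P" "(c - 1) * P = c" "1 < c" using exponent_real[OF p False] conj_exp_conjugate[OF p False] by (auto simp: P_def)
      have e1: "(1 - 1 / c) * P = 1"
      proof -
        have "(1 - 1 / c) * P = (c - 1) * P / c" using cP by (simp add: field_simps)
        then show ?thesis using cP by simp
      qed
      have "(\<integral>\<^sup>+t. ennreal (cmod (of_real (u t) * of_real (g t)) powr P) \<partial>lebesgue_on {0<..}) = (\<integral>\<^sup>+t. ennreal (h t) \<partial>lebesgue_on {0<..})"
      proof (rule nn_integral_cong_AE)
        show "AE t in lebesgue_on {0<..}. ennreal (cmod (of_real (u t) * of_real (g t)) powr P) = ennreal (h t)"
          using AE_weight_pos AE_space
        proof eventually_elim
          case (elim t)
          then have t: "0 < u t" "0 < t" by auto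
          have "(\<bar>Q t\<bar> powr (c - 1) * u t powr (1 - c)) powr P = \<bar>Q t\<bar> powr ((c - 1) * P) * u t powr ((1 - c) * P)"
            by (simp only: powr_mult powr_powr)
          also have "\<dots> = \<bar>Q t\<bar> powr c * u t powr (- c)"
          proof -
            have "(1 - c) * P = - c" using cP(2) by (simp add: algebra_simps)
            then show ?thesis using cP(2) by simp
          qed
          finally have "(\<bar>Q t\<bar> powr (c - 1) * u t powr (1 - c)) powr P = \<bar>Q t\<bar> powr c * W t"
            using t by (simp add: W_def u_ext_def)
          then show ?case using ug[OF t] cP by (auto simp: h_def indicator_def)
        qed
      qed
      also have "\<dots> = (\<integral>\<^sup>+t. ennreal (h t) * indicator {0<..} t \<partial>lebesgue)" by (rule nn_integral_lebesgue_on) simp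
      also have "\<dots> = X" unfolding X_eq by (intro nn_integral_cong) (auto simp: h_def indicator_def)
      also have "\<dots> = ennreal ((x powr (1 - 1 / c)) powr P)"
        using e1 x Xx(1) by (simp only: powr_powr) simp
      finally show ?thesis
        unfolding Lnorm_on_eq_Lp_norm by (subst Lp_norm_le_iff_finite[OF p False]) (simp_all add: P_def)
    qed
    have gV: "g \<in> test_space r"
      unfolding test_space_def using norm_le by (auto simp: g_def le_less_trans)
    have "(\<Sum>j<l. a j * test_moment r j g) = integral {0..r} (\<lambda>t. \<Sum>j<l. a j * (t ^ j * g t))"
      using test_moment_integrable[OF gV] by (subst integral_sum) (auto simp: test_moment_def integrable_on_mult_right)
    also have "(\<lambda>t. \<Sum>j<l. a j * (t ^ j * g t)) = h"
    proof
      fix t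
      have "(\<Sum>j<l. a j * (t ^ j * g t)) = Q t * g t" by (simp add: Q_def sum_distrib_right mult.assoc)
      also have "\<dots> = h t"
      proof (cases "Q t = 0")
        case False
        have "Q t * sgn (Q t) = \<bar>Q t\<bar>" by (simp add: abs_sgn mult.commute)
        moreover have "\<bar>Q t\<bar> * \<bar>Q t\<bar> powr (c - 1) = \<bar>Q t\<bar> powr c"
          using False powr_add[of "\<bar>Q t\<bar>" 1 "c - 1"] by simp
        ultimately show ?thesis by (simp add: g_def h_def mult.assoc[symmetric])
      qed (simp add: g_def h_def)
      finally show "(\<Sum>j<l. a j * (t ^ j * g t)) = h t" .
    qed
    also have "integral {0..r} h = x"
    proof -
      have "h absolutely_integrable_on {0..r}"
        using X_fin h0 by (intro absolutely_integrable_of_nn_integral hm) (simp add: X_eq)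
      then have "ennreal (integral {0..r} h) = ennreal x"
        using integral_eq_nn_integral_open[OF hm h0] X_eq Xx(1) by simp
      moreover have "0 \<le> integral {0..r} h"
        using \<open>h absolutely_integrable_on {0..r}\<close> h0 by (intro Henstock_Kurzweil_Integration.integral_nonneg set_lebesgue_integral_eq_integral(1))
      ultimately show ?thesis using Xx(2) by simp
    qed
    finally have "x \<le> s * test_norm g" using bound[OF gV] x by simp
    also have "\<dots> \<le> s * x powr (1 - 1 / c)"
    proof (rule mult_left_mono[OF _ s])
      show "test_norm g \<le> x powr (1 - 1 / c)"
        using norm_le unfolding test_norm_eq[OF gV] by (simp add: ennreal_le_iff)
    qed
    finally have "x powr (1 / c) * x powr (1 - 1 / c) \<le> s * x powr (1 - 1 / c)"
      using x by (simp add: powr_add[symmetric])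
    then have "x powr (1 / c) \<le> s" using x by (simp add: mult_le_cancel_right)
    then have "(x powr (1 / c)) powr c \<le> s powr c" using c_ge_1 by (intro powr_mono2) auto
    then have "x \<le> s powr c" using x c_ge_1 by (simp add: powr_powr)
    then show ?thesis using Xx by (simp add: X_def[symmetric] ennreal_leI)
  qed
qed

text \<open>
  Fix \<open>k\<close> and \<open>r\<close>, and let \<open>y > 0\<close> be at most the norm of \<open>d\<^sub>k\<close> on \<open>(r, \<infinity>)\<close>. If \<open>g\<close> is supported in \<open>(0, r)\<close> and
  only its \<open>k\<close>-th moment \<open>M\<close> is nonzero, then \<open>reduced_op\<close> maps \<open>g\<close> on \<open>(r, \<infinity>)\<close> to \<open>\<plusminus> M / k!\<close> times \<open>d\<^sub>k\<close>, so
  \<open>|M|\<close> is at most \<open>s = (C + 1) k! / y\<close> times the norm of \<open>g\<close>. Dominated extension, the converse of Hoelder's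
  inequality and the coefficient bound turn this into \<open>K k r \<le> const \<cdot> s\<close>.
\<close>

theorem Volterra_bounded_imp_cond_A:
  assumes l: "l \<ge> 1" and doubling: "l \<ge> 2 \<longrightarrow> (\<exists>D::real. \<forall>r>0.
       (\<integral>\<^sup>+x. ennreal (x powr (real (l - 2) * c)) * neg_conj_pow u p x \<partial>lebesgue_on {0<..<2 * r})
       \<le> ennreal D * (\<integral>\<^sup>+x. ennreal (x powr (real (l - 2) * c)) * neg_conj_pow u p x \<partial>lebesgue_on {0<..<r}))"
    and q: "p \<le> q" and v: "v \<in> borel_measurable (lebesgue_on {0<..})"
    and b: "\<forall>m\<le>l. b m \<in> borel_measurable (lebesgue_on {0<..})"
    and T: "\<And>g. g \<in> borel_measurable (lebesgue_on {0<..}) \<Longrightarrow> Lnorm p u g < \<infinity> \<Longrightarrow>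
      Lnorm q v (reduced_op l b g) \<le> ennreal C * Lnorm p u g" and C: "0 \<le> C"
  shows "cond_A l p q u v b"
  unfolding cond_A_iff
proof (intro allI impI)
  fix k assume k: "k < l"
  have q1: "1 < q" using p q by simp
  obtain Cp where Cp: "0 < Cp" "\<And>r (a::nat \<Rightarrow> real) k. 0 < r \<Longrightarrow> k < l \<Longrightarrow>
     ennreal (\<bar>a k\<bar> powr c) * \<Phi> k r \<le> ennreal Cp * wint W (\<lambda>t. \<bar>\<Sum>j<l. a j * t ^ j\<bar> powr c) {0<..<r}"
    using coefficient_bound_weight[OF l doubling] by blast
  define A where "A = (C + 1) * fact k * Cp powr (1 / c)"
  have A: "0 < A" using C Cp by (simp add: A_def)
  \<comment> \<open>A real \<open>y\<close> below the norm is used because that norm is not known to be finite at this stage.\<close>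
  have claim: "y * K k r \<le> A" if r: "0 < r" and y: "0 < y" "ennreal y \<le> Lnorm_on {r<..} q v (d_coeff l b k)" for r y
  proof -
    define s where "s = (C + 1) * fact k / y"
    have s: "0 \<le> s" using C y by (simp add: s_def)
    have sub: "{r<..} \<subseteq> {0<..}" using r by auto
    have vr: "v \<in> borel_measurable (lebesgue_on {r<..})" by (rule borel_measurable_lebesgue_on_subset[OF v sub])
    have dr: "d_coeff l b k \<in> borel_measurable (lebesgue_on {r<..})" by (rule borel_measurable_lebesgue_on_subset[OF d_coeff_measurable[OF b] sub])
    have kill: "\<bar>test_moment r k g\<bar> \<le> s * test_norm g"
      if g: "g \<in> test_space r" and zero: "\<And>j. j \<in> {..<l} - {k} \<Longrightarrow> test_moment r j g = 0" for g
    proof -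
      define M where "M = test_moment r k g"
      let ?G = "\<lambda>t. of_real (g t) :: complex"
      note Gm = test_space_measurable[OF g]
      have Gf: "Lnorm p u ?G < \<infinity>" using g by (simp add: test_space_def)
      have Tm: "reduced_op l b ?G \<in> borel_measurable (lebesgue_on {r<..})"
        by (rule borel_measurable_lebesgue_on_subset[OF reduced_op_measurable[OF b Gm Gf] sub])
      have "Lnorm_on {r<..} q v (\<lambda>x. of_real ((-1) ^ k / fact k * M) * d_coeff l b k x) = Lnorm_on {r<..} q v (reduced_op l b ?G)"
      proof (rule Lnorm_on_cong_AE[OF q1 vr _ Tm])
        show "AE x in lebesgue_on {r<..}. of_real ((-1) ^ k / fact k * M) * d_coeff l b k x = reduced_op l b ?G x"
        proof (rule AE_I2)
          fix x assume "x \<in> space (lebesgue_on {r<..})"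
          then have x: "r < x" by simp
          have mom: "moment ?G j x = of_real (test_moment r j g)" for j
            using moment_test[OF g] r x by simp
          have "reduced_op l b ?G x = (\<Sum>j<l. of_real ((-1) ^ j / fact j) * (d_coeff l b j x * of_real (test_moment r j g)))"
            using g x by (simp add: reduced_op_def mom test_space_def)
          also have "\<dots> = of_real ((-1) ^ k / fact k) * (d_coeff l b k x * of_real M)"
            using k zero by (subst sum.remove[of _ k]) (auto simp: M_def)
          finally show "of_real ((-1) ^ k / fact k * M) * d_coeff l b k x = reduced_op l b ?G x" by simp
        qed
      qed (use dr in \<open>auto intro!: borel_measurable_times\<close>)
      then have "ennreal (\<bar>M\<bar> / fact k) * Lnorm_on {r<..} q v (d_coeff l b k) = Lnorm_on {r<..} q v (reduced_op l b ?G)"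
        unfolding Lnorm_on_cmult[OF q1 vr dr] norm_of_real by (simp add: abs_mult abs_divide power_abs)
      also have "\<dots> \<le> Lnorm q v (reduced_op l b ?G)"
        by (intro Lnorm_on_mono_set v reduced_op_measurable[OF b Gm Gf] q1 sub) simp
      also have "\<dots> \<le> ennreal C * ennreal (test_norm g)"
        unfolding test_norm_eq[OF g, symmetric] by (rule T[OF Gm Gf])
      finally have "ennreal (\<bar>M\<bar> / fact k) * Lnorm_on {r<..} q v (d_coeff l b k) \<le> ennreal C * ennreal (test_norm g)" .
      moreover have "ennreal (\<bar>M\<bar> / fact k) * ennreal y \<le> ennreal (\<bar>M\<bar> / fact k) * Lnorm_on {r<..} q v (d_coeff l b k)"
        using y(2) by (rule mult_left_mono) simp
      ultimately have "ennreal (\<bar>M\<bar> / fact k) * ennreal y \<le> ennreal C * ennreal (test_norm g)" by (rule order_trans[rotated])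
      then have "\<bar>M\<bar> / fact k * y \<le> C * test_norm g"
        using y C by (simp add: ennreal_mult[symmetric] ennreal_le_iff test_norm_def)
      also have "\<dots> \<le> (C + 1) * test_norm g" by (intro mult_right_mono) (auto simp: test_norm_def)
      finally have "\<bar>M\<bar> \<le> s * test_norm g" using y by (simp add: s_def field_simps)
      then show ?thesis by (simp add: M_def)
    qed
    have "\<exists>cc. \<forall>g\<in>test_space r. \<bar>test_moment r k g - (\<Sum>j\<in>{..<l} - {k}. cc j * test_moment r j g)\<bar> \<le> s * test_norm g"
      by (rule dominated_extension_finite[OF _ lin_closed_test_space seminorm_test_norm[OF s] lin_on_test_moment lin_on_test_moment kill]) auto
    then obtain cc where cc: "\<And>g. g \<in> test_space r \<Longrightarrow> \<bar>test_moment r k g - (\<Sum>j\<in>{..<l} - {k}. cc j * test_moment r j g)\<bar> \<le> s * test_norm g"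
      by blast
    define a where "a j = (if j = k then 1 else - cc j)" for j
    have dominated: "\<bar>\<Sum>j<l. a j * test_moment r j g\<bar> \<le> s * test_norm g" if "g \<in> test_space r" for g
    proof -
      have "(\<Sum>j<l. a j * test_moment r j g) = test_moment r k g - (\<Sum>j\<in>{..<l} - {k}. cc j * test_moment r j g)"
        using k by (subst sum.remove[of _ k]) (auto simp: a_def sum_negf)
      then show ?thesis using cc[OF that] by simp
    qed
    have "a k = 1" by (simp add: a_def)
    then have Cp_a: "\<Phi> k r \<le> ennreal Cp * wint W (\<lambda>t. \<bar>\<Sum>j<l. a j * t ^ j\<bar> powr c) {0<..<r}"
      using Cp(2)[OF r k, of a] by simp
    from converse_Hoelder[OF r s dominated]
    have "wint W (\<lambda>t. \<bar>\<Sum>j<l. a j * t ^ j\<bar> powr c) {0<..<r} \<le> ennreal (s powr c)" .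
    then have "\<Phi> k r \<le> ennreal Cp * ennreal (s powr c)"
      by (intro order_trans[OF Cp_a] mult_left_mono) auto
    then have "K k r powr c \<le> Cp * s powr c"
      using \<Phi>_eq[OF r, of k] Cp(1) by (simp add: ennreal_mult[symmetric] ennreal_le_iff)
    then have "(K k r powr c) powr (1 / c) \<le> (Cp * s powr c) powr (1 / c)"
      using c_ge_1 by (intro powr_mono2) auto
    then have "K k r \<le> Cp powr (1 / c) * s"
      using K_pos[OF r, of k] c_ge_1 s by (simp add: powr_powr powr_mult)
    then have "y * K k r \<le> y * (Cp powr (1 / c) * s)" using y by (intro mult_left_mono) auto
    also have "\<dots> = A" using y by (simp add: A_def s_def)
    finally show ?thesis .
  qed
  have "Lnorm_on {r<..} q v (d_coeff l b k) * ennreal (K k r) \<le> ennreal A" if r: "0 < r" for r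
  proof (cases "Lnorm_on {r<..} q v (d_coeff l b k)")
    case (real x)
    show ?thesis
    proof (cases "x = 0")
      case False
      then have "x * K k r \<le> A" using real by (intro claim[OF r]) auto
      then show ?thesis using real K_pos[OF r, of k] by (simp add: ennreal_mult[symmetric] ennreal_leI)
    qed (use real in simp)
  next
    case top
    have "(A + 1) / K k r * K k r \<le> A" using A K_pos[OF r, of k] top by (intro claim[OF r]) auto
    then show ?thesis using K_pos[OF r, of k] by simp
  qed
  then show "\<exists>A>0. \<forall>r>0. Lnorm_on {r<..} q v (d_coeff l b k) * ennreal (K k r) \<le> ennreal A"
    using A by blast
qed

end

section \<open>The operator on the Sobolev spaces\<close>

lemma acts_boundedly_LspaceI:
  fixes n :: "'a \<Rightarrow> ennreal"
  assumes "\<And>f. f \<in> X \<Longrightarrow> T f \<in> borel_measurable (lebesgue_on {0<..}) \<and>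
    Lnorm q v (T f) \<le> ennreal C * n f \<and> n f < \<infinity>"
  shows "acts_boundedly T X n (Lspace q v) (Lnorm q v)"
proof -
  have "Lnorm q v (T f) < \<infinity>" if "f \<in> X" for f
  proof (rule le_less_trans)
    show "Lnorm q v (T f) \<le> ennreal C * n f" using assms[OF that] by blast
    show "ennreal C * n f < \<infinity>" using assms[OF that] by (simp add: ennreal_mult_less_top)
  qed
  then show ?thesis using assms unfolding acts_boundedly_def Lspace_def by blast
qed

context weight
begin

lemma reduced_op_bounded:
  assumes A: "cond_A l p q u v b" and B: "cond_B l p q u v b" and q: "p \<le> q"
    and v: "v \<in> borel_measurable (lebesgue_on {0<..})"
    and b: "\<forall>m\<le>l. b m \<in> borel_measurable (lebesgue_on {0<..})"
  shows "\<exists>C\<ge>0. \<forall>g. g \<in> borel_measurable (lebesgue_on {0<..}) \<longrightarrow> Lnorm p u g < \<infinity> \<longrightarrow>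
    Lnorm q v (reduced_op l b g) \<le> ennreal C * Lnorm p u g"
proof -
  have q1: "1 < q" using p q by simp
  have bl: "b l \<in> borel_measurable (lebesgue_on {0<..})" using b by auto
  obtain C1 where C1: "0 \<le> C1" "\<And>g. g \<in> borel_measurable (lebesgue_on {0<..}) \<Longrightarrow> Lnorm p u g < \<infinity> \<Longrightarrow>
    Lnorm q v (\<lambda>x. \<Sum>j<l. of_real ((-1) ^ j / fact j) * (d_coeff l b j x * moment g j x)) \<le> ennreal C1 * Lnorm p u g"
    using Volterra_part_bounded[OF A q v b] by (elim exE conjE) (rule that, assumption, blast)
  obtain C2 where C2: "0 \<le> C2" "\<And>g. g \<in> borel_measurable (lebesgue_on {0<..}) \<Longrightarrow> Lnorm p u g < \<infinity> \<Longrightarrow>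
    Lnorm q v (\<lambda>x. b l x * g x) \<le> ennreal C2 * Lnorm p u g"
    using multiplication_bounded[OF B q v bl] by (elim exE conjE) (rule that, assumption, blast)
  have "Lnorm q v (reduced_op l b g) \<le> ennreal (C1 + C2) * Lnorm p u g"
    if g: "g \<in> borel_measurable (lebesgue_on {0<..})" "Lnorm p u g < \<infinity>" for g
  proof -
    have [measurable]: "d_coeff l b j \<in> borel_measurable (lebesgue_on {0<..})" for j by (rule d_coeff_measurable[OF b])
    have [measurable]: "moment g j \<in> borel_measurable (lebesgue_on {0<..})" for j by (rule moment_measurable[OF g])
    have [measurable]: "g \<in> borel_measurable (lebesgue_on {0<..})" "b l \<in> borel_measurable (lebesgue_on {0<..})" using g bl by auto
    have "Lnorm q v (reduced_op l b g) \<le> Lnorm q v (\<lambda>x. \<Sum>j<l. of_real ((-1) ^ j / fact j) * (d_coeff l b j x * moment g j x))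
      + Lnorm q v (\<lambda>x. b l x * g x)"
      unfolding reduced_op_def[abs_def] by (rule Lnorm_on_add_le[OF q1 v]) measurable
    also have "\<dots> \<le> ennreal C1 * Lnorm p u g + ennreal C2 * Lnorm p u g"
      by (intro add_mono C1(2) C2(2) g)
    finally show ?thesis using C1(1) C2(1) by (simp add: distrib_right)
  qed
  then show ?thesis using C1(1) C2(1) by (intro exI[of _ "C1 + C2"]) auto
qed

text \<open>
  Condition (A) is derived first. By the sufficiency part it bounds the Hardy terms, and what remains of
  the operator is multiplication by \<open>b\<^sub>l\<close>.
\<close>

lemma sobolev0_bounded_imp_cond_AB:
  assumes l: "l \<ge> 1" and doubling: "l \<ge> 2 \<longrightarrow> (\<exists>D::real. \<forall>r>0.
       (\<integral>\<^sup>+x. ennreal (x powr (real (l - 2) * c)) * neg_conj_pow u p x \<partial>lebesgue_on {0<..<2 * r})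
       \<le> ennreal D * (\<integral>\<^sup>+x. ennreal (x powr (real (l - 2) * c)) * neg_conj_pow u p x \<partial>lebesgue_on {0<..<r}))"
    and q: "p \<le> q" and v: "v \<in> borel_measurable (lebesgue_on {0<..})"
    and b: "\<forall>m\<le>l. b m \<in> borel_measurable (lebesgue_on {0<..})"
    and bounded: "acts_boundedly (diff_op l b) (sobolev0 l p u) (sobolev0_norm l p u) (Lspace q v) (Lnorm q v)"
  shows "cond_A l p q u v b" and "cond_B l p q u v b"
proof -
  have q1: "1 < q" using p q by simp
  have bl: "b l \<in> borel_measurable (lebesgue_on {0<..})" using b by auto
  obtain C0 :: real where C0: "\<And>f. f \<in> sobolev0 l p u \<Longrightarrow> diff_op l b f \<in> Lspace q v"
    "\<And>f. f \<in> sobolev0 l p u \<Longrightarrow> Lnorm q v (diff_op l b f) \<le> ennreal C0 * sobolev0_norm l p u f"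
    using bounded unfolding acts_boundedly_def by blast
  \<comment> \<open>A bound with a negative constant is a bound by zero.\<close>
  define C where "C = max C0 0"
  have C: "0 \<le> C" by (simp add: C_def)
  have T: "Lnorm q v (reduced_op l b g) \<le> ennreal C * Lnorm p u g"
    if g: "g \<in> borel_measurable (lebesgue_on {0<..})" "Lnorm p u g < \<infinity>" for g
  proof -
    define f where "f = volterra g (l - 1)"
    note f = volterra_sobolev0[OF l g, folded f_def]
    have ac: "has_ac_deriv l f" and lim: "\<And>k. k < l \<Longrightarrow> (nth_deriv k f \<longlongrightarrow> 0) (at_right 0)"
      and fin: "Lnorm p u (nth_deriv l f) < \<infinity>"
      using f(1) by (auto simp: sobolev0_def sobolev0_norm_def)
    have eq: "diff_op l b f x = reduced_op l b (nth_deriv l f) x" if "0 < x" for x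
      using diff_op_representation[OF ac lim fin that] by simp
    have "AE x in lebesgue_on {0<..}. reduced_op l b g x = diff_op l b f x"
      using f(4) AE_space by eventually_elim (simp add: eq reduced_op_def f(3))
    moreover have "diff_op l b f \<in> borel_measurable (lebesgue_on {0<..})"
      using C0(1)[OF f(1)] by (simp add: Lspace_def)
    ultimately have "Lnorm q v (reduced_op l b g) = Lnorm q v (diff_op l b f)"
      by (intro Lnorm_on_cong_AE q1 v reduced_op_measurable[OF b g])
    also have "\<dots> \<le> ennreal C0 * Lnorm p u g"
      using C0(2)[OF f(1)] by (simp add: f(2))
    also have "\<dots> \<le> ennreal C * Lnorm p u g"
      by (intro mult_right_mono ennreal_leI) (auto simp: C_def)
    finally show ?thesis .
  qed
  show A: "cond_A l p q u v b"
    by (rule Volterra_bounded_imp_cond_A[OF l doubling q v b T C])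
  obtain C1 where C1: "0 \<le> C1" "\<And>g. g \<in> borel_measurable (lebesgue_on {0<..}) \<Longrightarrow> Lnorm p u g < \<infinity> \<Longrightarrow>
    Lnorm q v (\<lambda>x. \<Sum>j<l. of_real ((-1) ^ j / fact j) * (d_coeff l b j x * moment g j x)) \<le> ennreal C1 * Lnorm p u g"
    using Volterra_part_bounded[OF A q v b] by (elim exE conjE) (rule that, assumption, blast)
  show "cond_B l p q u v b"
  proof (rule multiplication_necessary[where l = l and b = b and C = "C + C1", OF _ _ q v bl])
    show "0 \<le> C + C1" using C C1(1) by simp
    fix g assume g: "g \<in> borel_measurable (lebesgue_on {0<..})" "Lnorm p u g < \<infinity>"
    have [measurable]: "d_coeff l b j \<in> borel_measurable (lebesgue_on {0<..})" for j by (rule d_coeff_measurable[OF b])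
    have [measurable]: "moment g j \<in> borel_measurable (lebesgue_on {0<..})" for j by (rule moment_measurable[OF g])
    define V where "V x = (\<Sum>j<l. of_real ((-1) ^ j / fact j) * (d_coeff l b j x * moment g j x))" for x
    have Vm [measurable]: "V \<in> borel_measurable (lebesgue_on {0<..})" unfolding V_def[abs_def] by measurable
    have Tm: "reduced_op l b g \<in> borel_measurable (lebesgue_on {0<..})" by (rule reduced_op_measurable[OF b g])
    have "(\<lambda>x. b l x * g x) = (\<lambda>x. reduced_op l b g x + (-1) * V x)"
      by (simp add: reduced_op_def V_def fun_eq_iff)
    then have "Lnorm q v (\<lambda>x. b l x * g x) = Lnorm q v (\<lambda>x. reduced_op l b g x + (-1) * V x)" by (rule arg_cong)
    also have "\<dots> \<le> Lnorm q v (reduced_op l b g) + Lnorm q v (\<lambda>x. (-1) * V x)"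
      by (rule Lnorm_on_add_le[OF q1 v Tm]) measurable
    also have "\<dots> = Lnorm q v (reduced_op l b g) + Lnorm q v V"
      by (simp only: Lnorm_on_cmult[OF q1 v Vm]) simp
    also have "\<dots> \<le> ennreal C * Lnorm p u g + ennreal C1 * Lnorm p u g"
      unfolding V_def[abs_def] by (intro add_mono T C1(2) g)
    finally show "Lnorm q v (\<lambda>x. b l x * g x) \<le> ennreal (C + C1) * Lnorm p u g"
      using C C1(1) by (simp add: distrib_right)
  qed
qed

lemma sobolev0_bounded:
  assumes l: "l \<ge> 1" and A: "cond_A l p q u v b" and B: "cond_B l p q u v b" and q: "p \<le> q"
    and v: "v \<in> borel_measurable (lebesgue_on {0<..})"
    and b: "\<forall>m\<le>l. b m \<in> borel_measurable (lebesgue_on {0<..})"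
  shows "acts_boundedly (diff_op l b) (sobolev0 l p u) (sobolev0_norm l p u) (Lspace q v) (Lnorm q v)"
proof -
  have q1: "1 < q" using p q by simp
  obtain C where C: "0 \<le> C" "\<And>g. g \<in> borel_measurable (lebesgue_on {0<..}) \<Longrightarrow> Lnorm p u g < \<infinity> \<Longrightarrow>
    Lnorm q v (reduced_op l b g) \<le> ennreal C * Lnorm p u g"
    using reduced_op_bounded[OF A B q v b] by (elim exE conjE) (rule that, assumption, blast)
  have bound: "diff_op l b f \<in> borel_measurable (lebesgue_on {0<..}) \<and> Lnorm q v (diff_op l b f) \<le> ennreal C * sobolev0_norm l p u f
      \<and> sobolev0_norm l p u f < \<infinity>"
    if f: "f \<in> sobolev0 l p u" for f
  proof -
    have ac: "has_ac_deriv l f" and lim: "\<And>k. k < l \<Longrightarrow> (nth_deriv k f \<longlongrightarrow> 0) (at_right 0)"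
      and fin: "Lnorm p u (nth_deriv l f) < \<infinity>"
      using f by (auto simp: sobolev0_def sobolev0_norm_def)
    note g = has_ac_deriv_measurable[OF l ac] fin
    have eq: "diff_op l b f x = reduced_op l b (nth_deriv l f) x" if "0 < x" for x
      using diff_op_representation[OF ac lim fin that] by simp
    have Tm: "reduced_op l b (nth_deriv l f) \<in> borel_measurable (lebesgue_on {0<..})" by (rule reduced_op_measurable[OF b g])
    then have m: "diff_op l b f \<in> borel_measurable (lebesgue_on {0<..})"
      by (subst measurable_cong[where g = "reduced_op l b (nth_deriv l f)"]) (auto simp: eq)
    have "Lnorm q v (diff_op l b f) = Lnorm q v (reduced_op l b (nth_deriv l f))"
      by (rule Lnorm_on_cong_AE[OF q1 v m Tm]) (auto intro!: AE_I2 simp: eq)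
    then show ?thesis using C(2)[OF g] m fin by (simp add: sobolev0_norm_def)
  qed
  show ?thesis by (rule acts_boundedly_LspaceI[OF bound])
qed

lemma sobolev0_subset_sobolev:
  assumes "f \<in> sobolev0 l p u"
  shows "f \<in> sobolev l p u" and "sobolev_norm l p u f = sobolev0_norm l p u f"
proof -
  have lim: "(nth_deriv k f \<longlongrightarrow> 0) (at_right 0)" if "k < l" for k
    using assms that by (auto simp: sobolev0_def)
  then have "deriv_at_0 k f = 0" if "k < l" for k
    unfolding deriv_at_0_def using that by (intro tendsto_Lim) auto
  then show "sobolev_norm l p u f = sobolev0_norm l p u f"
    by (simp add: sobolev_norm_def sobolev0_norm_def)
  then show "f \<in> sobolev l p u"
    using assms by (auto simp: sobolev_def sobolev0_def)
qed

text \<open>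
  These functions have vanishing \<open>l\<close>-th derivative, so their norm is finite whatever the weight; boundedness
  on them is condition (C).
\<close>

lemma monomial_sobolev:
  assumes k: "k < l"
  shows "(\<lambda>x. of_real x ^ k) \<in> sobolev l p u"
proof -
  let ?f = "\<lambda>x. of_real x ^ k :: complex"
  have "nth_deriv m ?f differentiable (at x)" if "0 < x" for m x
  proof -
    have "((\<lambda>y. if m \<le> k then of_real (fact k / fact (k - m)) * of_real y ^ (k - m) else 0 :: complex)
       has_vector_derivative (if m \<le> k then of_real (fact k / fact (k - m)) * (of_nat (k - m) * of_real x ^ (k - m - 1)) else 0)) (at x)"
      by (auto intro!: derivative_eq_intros has_vector_derivative_real_field simp: has_vector_derivative_const)
    then have "\<exists>D. (nth_deriv m ?f has_vector_derivative D) (at x)"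
      using that by (subst has_vector_derivative_cong_open[of "{0<..}" x _ "\<lambda>y. if m \<le> k then of_real (fact k / fact (k - m)) * of_real y ^ (k - m) else 0"])
        (auto simp: nth_deriv_monomial)
    then show ?thesis by (auto simp: has_vector_derivative_def intro: differentiableI)
  qed
  moreover have "abs_cont_on {a..b} (nth_deriv (l - 1) ?f)" if "0 < a" for a b
  proof (rule abs_cont_on_cong[where f = "\<lambda>x. if l - 1 \<le> k then of_real (fact k) else 0"])
    show "abs_cont_on {a..b} (\<lambda>x. if l - 1 \<le> k then of_real (fact k) else 0)"
      unfolding abs_cont_on_def by (auto intro: exI[of _ 1])
  qed (use k that in \<open>auto simp: nth_deriv_monomial\<close>)
  ultimately have ac: "has_ac_deriv l ?f" by (simp add: has_ac_deriv_def)
  have lim: "\<exists>c. (nth_deriv m ?f \<longlongrightarrow> c) (at_right 0)" for m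
  proof -
    let ?g = "\<lambda>x. if m \<le> k then of_real (fact k / fact (k - m) * x ^ (k - m)) else 0 :: complex"
    have "(?g \<longlongrightarrow> ?g 0) (at_right 0)" by (cases "m \<le> k") (auto intro!: tendsto_eq_intros)
    moreover have "\<forall>\<^sub>F x in at_right 0. ?g x = nth_deriv m ?f x"
      by (auto simp: eventually_at_filter nth_deriv_monomial)
    ultimately show ?thesis by (blast intro: Lim_transform_eventually)
  qed
  have m: "nth_deriv l ?f \<in> borel_measurable (lebesgue_on {0<..})"
    using has_ac_deriv_measurable[OF _ ac] k by simp
  have "Lnorm p u (nth_deriv l ?f) = Lnorm p u (\<lambda>x::real. 0)"
    by (rule Lnorm_on_cong_AE[OF p u_meas m]) (use k in \<open>auto intro!: AE_I2 simp: nth_deriv_monomial\<close>)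
  then have "sobolev_norm l p u ?f < \<infinity>" using Lnorm_on_0[OF p] by (simp add: sobolev_norm_def)
  then show ?thesis using ac lim by (simp add: sobolev_def)
qed

text \<open>
  The representation splits the operator into \<open>reduced_op\<close> and finitely many multiples of the functions
  \<open>P(x,D) x\<^sup>k\<close>, whose coefficients are initial values and so part of the norm.
\<close>

lemma sobolev_bounded:
  assumes l: "l \<ge> 1" and A: "cond_A l p q u v b" and B: "cond_B l p q u v b" and cond_C: "cond_C l q v b" and q: "p \<le> q"
    and v: "v \<in> borel_measurable (lebesgue_on {0<..})"
    and b: "\<forall>m\<le>l. b m \<in> borel_measurable (lebesgue_on {0<..})"
  shows "acts_boundedly (diff_op l b) (sobolev l p u) (sobolev_norm l p u) (Lspace q v) (Lnorm q v)"
proof -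
  have q1: "1 < q" using p q by simp
  obtain C where C: "0 \<le> C" "\<And>g. g \<in> borel_measurable (lebesgue_on {0<..}) \<Longrightarrow> Lnorm p u g < \<infinity> \<Longrightarrow>
    Lnorm q v (reduced_op l b g) \<le> ennreal C * Lnorm p u g"
    using reduced_op_bounded[OF A B q v b] by (elim exE conjE) (rule that, assumption, blast)
  define P where "P k = diff_op l b (\<lambda>x. of_real x ^ k)" for k
  have Pm [measurable]: "P k \<in> borel_measurable (lebesgue_on {0<..})" for k
  proof -
    have [measurable]: "(\<lambda>x. if m \<le> k then of_real (fact k / fact (k - m) * x ^ (k - m)) else 0 :: complex) \<in> borel_measurable (lebesgue_on {0<..})" for m
      by (rule measurable_restrict_space1, rule measurable_completion) simp
    have "(\<lambda>x. \<Sum>m\<le>l. b m x * (if m \<le> k then of_real (fact k / fact (k - m) * x ^ (k - m)) else 0)) \<in> borel_measurable (lebesgue_on {0<..})"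
      using b by (intro borel_measurable_sum borel_measurable_times) auto
    then show ?thesis
      by (subst measurable_cong[where g = "\<lambda>x. \<Sum>m\<le>l. b m x * (if m \<le> k then of_real (fact k / fact (k - m) * x ^ (k - m)) else 0)"])
        (auto simp: P_def diff_op_def nth_deriv_monomial intro!: sum.cong)
  qed
  define N where "N k = enn2real (Lnorm q v (P k))" for k
  have N: "Lnorm q v (P k) = ennreal (N k)" if "k < l" for k
    using cond_C that by (simp add: cond_C_def P_def N_def less_top)
  have N0: "0 \<le> N k" for k by (simp add: N_def)
  define E where "E = C + (\<Sum>k<l. N k)"
  have E: "C \<le> E" "0 \<le> E" "k < l \<Longrightarrow> N k \<le> E" for k
  proof -
    have S0: "0 \<le> (\<Sum>k<l. N k)" by (intro sum_nonneg N0)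
    then show "C \<le> E" "0 \<le> E" using C by (auto simp: E_def)
    assume "k < l"
    then have "N k \<le> (\<Sum>k<l. N k)" by (intro member_le_sum N0) auto
    then show "N k \<le> E" using C by (simp add: E_def)
  qed
  have bound: "diff_op l b f \<in> borel_measurable (lebesgue_on {0<..}) \<and> Lnorm q v (diff_op l b f) \<le> ennreal E * sobolev_norm l p u f
      \<and> sobolev_norm l p u f < \<infinity>"
    if f: "f \<in> sobolev l p u" for f
  proof -
    define a where "a k = deriv_at_0 k f" for k
    have ac: "has_ac_deriv l f" and fin': "sobolev_norm l p u f < \<infinity>"
      using f by (auto simp: sobolev_def)
    have lim: "(nth_deriv k f \<longlongrightarrow> a k) (at_right 0)" if k: "k < l" for k
    proof -
      obtain z where "(nth_deriv k f \<longlongrightarrow> z) (at_right 0)" using f k by (auto simp: sobolev_def)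
      moreover from this have "a k = z" unfolding a_def deriv_at_0_def by (intro tendsto_Lim) auto
      ultimately show ?thesis by simp
    qed
    have fin: "Lnorm p u (nth_deriv l f) < \<infinity>" using fin' by (simp add: sobolev_norm_def)
    note g = has_ac_deriv_measurable[OF l ac] fin
    let ?R = "\<lambda>x. (\<Sum>k<l. a k / fact k * P k x) + reduced_op l b (nth_deriv l f) x"
    have eq: "diff_op l b f x = ?R x" if "0 < x" for x
      using diff_op_representation[OF ac lim fin that] by (simp add: P_def)
    have Tm [measurable]: "reduced_op l b (nth_deriv l f) \<in> borel_measurable (lebesgue_on {0<..})" by (rule reduced_op_measurable[OF b g])
    have Rm: "?R \<in> borel_measurable (lebesgue_on {0<..})" by measurable
    then have m: "diff_op l b f \<in> borel_measurable (lebesgue_on {0<..})"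
      by (subst measurable_cong[where g = ?R]) (auto simp: eq)
    have "Lnorm q v (diff_op l b f) = Lnorm q v ?R"
      by (rule Lnorm_on_cong_AE[OF q1 v m Rm]) (auto intro!: AE_I2 simp: eq)
    also have "\<dots> \<le> Lnorm q v (\<lambda>x. \<Sum>k<l. a k / fact k * P k x) + Lnorm q v (reduced_op l b (nth_deriv l f))"
      by (rule Lnorm_on_add_le[OF q1 v]) measurable
    also have "\<dots> \<le> (\<Sum>k<l. ennreal E * ennreal (cmod (a k))) + ennreal E * Lnorm p u (nth_deriv l f)"
    proof (rule add_mono)
      have "Lnorm q v (\<lambda>x. \<Sum>k<l. a k / fact k * P k x) \<le> (\<Sum>k<l. Lnorm q v (\<lambda>x. a k / fact k * P k x))"
        by (rule Lnorm_on_sum_le[OF q1 v]) auto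
      also have "\<dots> \<le> (\<Sum>k<l. ennreal E * ennreal (cmod (a k)))"
      proof (rule sum_mono)
        fix k assume "k \<in> {..<l}"
        then have k: "k < l" by simp
        have "Lnorm q v (\<lambda>x. a k / fact k * P k x) = ennreal (cmod (a k / fact k) * N k)"
          using k by (simp only: Lnorm_on_cmult[OF q1 v Pm]) (simp add: N ennreal_mult N0)
        also have "\<dots> \<le> ennreal (E * cmod (a k))"
        proof (rule ennreal_leI)
          \<comment> \<open>The factorials may be dropped, so one constant serves all initial values.\<close>
          have "cmod (a k / fact k) \<le> cmod (a k)"
            by (simp add: norm_divide divide_le_eq mult_le_cancel_left1 fact_ge_1)
          then have "cmod (a k / fact k) * N k \<le> cmod (a k) * E"
            using E N0 k by (intro mult_mono) auto
          then show "cmod (a k / fact k) * N k \<le> E * cmod (a k)" by (simp add: mult.commute)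
        qed
        finally show "Lnorm q v (\<lambda>x. a k / fact k * P k x) \<le> ennreal E * ennreal (cmod (a k))"
          using E by (simp add: ennreal_mult)
      qed
      finally show "Lnorm q v (\<lambda>x. \<Sum>k<l. a k / fact k * P k x) \<le> (\<Sum>k<l. ennreal E * ennreal (cmod (a k)))" .
      show "Lnorm q v (reduced_op l b (nth_deriv l f)) \<le> ennreal E * Lnorm p u (nth_deriv l f)"
        using C(2)[OF g] E(1) by (elim order_trans) (intro mult_right_mono ennreal_leI, auto)
    qed
    also have "\<dots> = ennreal E * sobolev_norm l p u f"
      by (simp only: sobolev_norm_def a_def sum_distrib_left distrib_left)
    finally show ?thesis using m fin' by blast
  qed
  show ?thesis by (rule acts_boundedly_LspaceI[OF bound])
qed

end

theorem theorem2p2: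
  fixes l :: nat and p q :: ennreal and u v :: "real \<Rightarrow> real" and b :: "nat \<Rightarrow> real \<Rightarrow> complex"
  assumes l: "l \<ge> 1"
    and pq: "1 < p" "p \<le> q"
    and u_meas: "u \<in> borel_measurable (lebesgue_on {0<..})" and u_nonneg: "\<forall>x>0. 0 \<le> u x"
    and v_meas: "v \<in> borel_measurable (lebesgue_on {0<..})" and v_nonneg: "\<forall>x>0. 0 \<le> v x"
    and b_meas: "\<forall>m\<le>l. b m \<in> borel_measurable (lebesgue_on {0<..})"
    and u_int: "\<forall>r>0. (\<integral>\<^sup>+x. neg_conj_pow u p x \<partial>lebesgue_on {0<..<r}) < \<infinity>"
    and doubling: "l \<ge> 2 \<longrightarrow> (\<exists>D::real. \<forall>r>0.
       (\<integral>\<^sup>+x. ennreal (x powr (real (l - 2) * conj_exp p)) * neg_conj_pow u p x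
          \<partial>lebesgue_on {0<..<2 * r})
       \<le> ennreal D * (\<integral>\<^sup>+x. ennreal (x powr (real (l - 2) * conj_exp p)) * neg_conj_pow u p x
          \<partial>lebesgue_on {0<..<r}))"
  shows "(acts_boundedly (diff_op l b) (sobolev0 l p u) (sobolev0_norm l p u) (Lspace q v) (Lnorm q v)
            \<longleftrightarrow> cond_A l p q u v b \<and> cond_B l p q u v b)
       \<and> (acts_boundedly (diff_op l b) (sobolev l p u) (sobolev_norm l p u) (Lspace q v) (Lnorm q v)
            \<longleftrightarrow> cond_A l p q u v b \<and> cond_B l p q u v b \<and> cond_C l q v b)"
proof -
  interpret weight p u using pq u_meas u_nonneg u_int by unfold_locales auto
  let ?P = "diff_op l b" and ?L = "Lspace q v" and ?n = "Lnorm q v"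
  have AB_iff: "acts_boundedly ?P (sobolev0 l p u) (sobolev0_norm l p u) ?L ?n \<longleftrightarrow> cond_A l p q u v b \<and> cond_B l p q u v b"
    using sobolev0_bounded_imp_cond_AB[OF l doubling pq(2) v_meas b_meas]
      sobolev0_bounded[OF l _ _ pq(2) v_meas b_meas] by blast
  have "acts_boundedly ?P (sobolev0 l p u) (sobolev0_norm l p u) ?L ?n \<and> cond_C l q v b"
    if bounded: "acts_boundedly ?P (sobolev l p u) (sobolev_norm l p u) ?L ?n"
  proof
    show "acts_boundedly ?P (sobolev0 l p u) (sobolev0_norm l p u) ?L ?n"
      using bounded unfolding acts_boundedly_def by (metis sobolev0_subset_sobolev)
    show "cond_C l q v b"
      using bounded monomial_sobolev unfolding acts_boundedly_def cond_C_def Lspace_def by blast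
  qed
  then show ?thesis
    using AB_iff sobolev_bounded[OF l _ _ _ pq(2) v_meas b_meas] by blast
qed

end
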